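(* Consider the matrix approximation problem $\min_{[\mathbf{Y}]\in\mathcal{M}}H([\mathbf{Y}])$, $H([\mathbf{Y}])=\frac12\|\mathbf{Y}\mathbf{Y}^\top-\mathbf{X}^*\|_F^2$. Given an initialization $\widetilde{\mathbf{Y}}_0\in\mathbb{R}^{p\times r}_*$, let $\mathbf{K}_0=\mathbf{U}^{*\top}\widetilde{\mathbf{Y}}_0$ and $\mathbf{J}_0=\mathbf{U}_\perp^{*\top}\widetilde{\mathbf{Y}}_0$. Suppose $$\sigma_1(\widetilde{\mathbf{Y}}_0)\le\sigma_1(\mathbf{Y}^* ),\quad\sigma_1(\mathbf{J}_0)\le\sigma_r(\mathbf{Y}^* )/2,\quad0<\sigma_r(\mathbf{K}_0)\le\sigma_r(\mathbf{Y}^* )/2,\quad\sigma_1^2(\mathbf{J}_0)\le\frac{\sigma_r^2(\mathbf{Y}^* )}{8\sigma_1(\mathbf{Y}^* )}\sigma_r(\mathbf{K}_0).$$ Let $\epsilon>0$ and $\zeta\in(0,1)$. Then for properly chosen $T_0,T_1$, stepsize $\eta$, and input parameters $(L,\rho,K,\mathfrak{I},\widetilde\epsilon,\zeta)$ of the subroutine PRGD (i.e. there exist such choices), Algorithm A described in the context, initialized at $\widetilde{\mathbf{Y}}_0$, outputs with probability at least $1-\zeta$ a matrix $\mathbf{Y}_{T_1}$ with $d([\mathbf{Y}_{T_1}],[\mathbf{Y}^*])\le\epsilon$, and moreover the number of calls to the Riemannian gradient during the whole algorithm is at most $$C\Big(\max\{1,\log(1/\sigma_r(\mathbf{K}_0))\}+\max\{1,\log^4(p)\}+\max\{1,\log(1/\epsilon)\}\Big),$$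 where $C$ is a universal constant depending only on $\sigma_r(\mathbf{Y}^* ),\sigma_1(\mathbf{Y}^* ),r$ and $\zeta$.
   Context: Let $0<r\le p$ be integers. $\|\cdot\|_F$ is the Frobenius norm and $\sigma_i(\cdot)$ the $i$-th largest singular value. $\mathbb{R}^{p\times r}_*$ is the set of real $p\times r$ matrices of full column rank, $\mathbb{O}_r$ the orthogonal group, and $\mathcal{M}=\mathbb{R}^{p\times r}_*/\mathbb{O}_r$ the quotient manifold with points $[\mathbf{Y}]=\{\mathbf{Y}\mathbf{O}:\mathbf{O}\in\mathbb{O}_r\}$ and the Riemannian metric induced from $\mathrm{tr}(\eta^\top\theta)$; the horizontal space at $\mathbf{Y}$ is $\mathcal{H}_{\mathbf{Y}}=\{\theta\in\mathbb{R}^{p\times r}:\mathbf{Y}^\top\theta\text{ symmetric}\}$, of dimension $\bar d=pr-(r^2-r)/2$, and $d([\mathbf{Y}_1],[\mathbf{Y}_2])=\min_{\mathbf{Q}\in\mathbb{O}_r}\|\mathbf{Y}_2\mathbf{Q}-\mathbf{Y}_1\|_F$. $\mathbf{X}^*$ is a symmetric positive semidefinite $p\times p$ matrix of rank $r$ with reduced eigendecomposition $\mathbf{U}^*\boldsymbol{\Sigma}^*\mathbf{U}^{*\top}$, $\mathbf{Y}^*=\mathbf{U}^*\boldsymbol{\Sigma}^{*1/2}$, and $\mathbf{U}^*_\perp\in\mathbb{R}^{p\times(p-r)}$ has orthonormal columns spanning the orthogonal complement of the column space of $\mathbf{U}^*$. The horizontal lift of the Riemannian gradient of $H$ is $\overline{\mathrm{grad}\,H([\mathbf{Y}])}=2(\mathbf{Y}\mathbf{Y}^\top-\mathbf{X}^*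 )\mathbf{Y}$; each evaluation of $(\mathbf{Y}\mathbf{Y}^\top-\mathbf{X}^* )\mathbf{Y}$ counts as a call to the Riemannian gradient. Algorithm A (perturbed Riemannian gradient descent with initial safeguard and local improvement). Inputs: $\widetilde{\mathbf{Y}}_0\in\mathbb{R}^{p\times r}_*$, positive integers $T_0,T_1$, stepsize $\eta$, Lipschitz constants $L,\rho$, curvature bound $K$, injectivity radius bound $\mathfrak{I}$, accuracy $\widetilde\epsilon$, failure parameter $\zeta$. (1) For $t=0,\dots,T_0-1$: $\widetilde{\mathbf{Y}}_{t+1}=\widetilde{\mathbf{Y}}_t-\eta(\widetilde{\mathbf{Y}}_t\widetilde{\mathbf{Y}}_t^\top-\mathbf{X}^* )\widetilde{\mathbf{Y}}_t$. (2) $\mathbf{Y}_0=\mathrm{PRGD}(\widetilde{\mathbf{Y}}_{T_0},L,\rho,K,\mathfrak{I},\widetilde\epsilon,\zeta)$. (3) For $t=0,\dots,T_1-1$: $\mathbf{Y}_{t+1}=\mathbf{Y}_t-\eta(\mathbf{Y}_t\mathbf{Y}_t^\top-\mathbf{X}^* )\mathbf{Y}_t$. Output $\mathbf{Y}_{T_1}$. Subroutine $\mathrm{PRGD}(\mathbf{Y}_0,L,\rho,K,\mathfrak{I},\epsilon',\zeta)$ (its internal variables are separate from those of Algorithm A). Fix constants $\hat c\ge4$ and $c_{\max}>0$ with $\sqrt{c_{\max}}\le\frac1{56\hat c^2}$; set $\chi=3\max\{\log(\bar dL\,H([\mathbf{Y}_0])/(\hat c\epsilon'^2\zeta)),4\}$,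 $\omega=g_{\mathrm{thres}}=\frac{\sqrt{c_{\max}}}{\chi^2}\epsilon'$, $f_{\mathrm{thres}}=\frac{c_{\max}}{\chi^3}\sqrt{\epsilon'^3/\rho}$, $t_{\mathrm{thres}}=\frac{\chi}{c_{\max}}\frac{L}{\sqrt{\rho\epsilon'}}$ (rounded up to an integer), $t_{\mathrm{noise}}=-t_{\mathrm{thres}}-1$, stepsize $\eta'=c_{\max}/L$, $t=0$. Repeat: (a) if $\|\overline{\mathrm{grad}\,H([\mathbf{Y}_t])}\|_F\le g_{\mathrm{thres}}$ and $t-t_{\mathrm{noise}}>t_{\mathrm{thres}}$, set $t_{\mathrm{noise}}\leftarrow t$, $\widetilde{\mathbf{Y}}_t\leftarrow\mathbf{Y}_t$, and $\mathbf{Y}_t\leftarrow\mathbf{Y}_t+\xi_t$ with $\xi_t$ drawn uniformly from $\{\theta\in\mathcal{H}_{\mathbf{Y}_t}:\|\theta\|_F\le\omega\}$; (b) if $t-t_{\mathrm{noise}}=t_{\mathrm{thres}}$ and $H([\mathbf{Y}_t])-H([\widetilde{\mathbf{Y}}_{t_{\mathrm{noise}}}])>-f_{\mathrm{thres}}$, stop and output $\widetilde{\mathbf{Y}}_{t_{\mathrm{noise}}}$; (c) $\mathbf{Y}_{t+1}\leftarrow\mathbf{Y}_t-\min\{\eta',\mathfrak{I}/\|\overline{\mathrm{grad}\,H([\mathbf{Y}_t])}\|_F\}\,\overline{\mathrm{grad}\,H([\mathbf{Y}_t])}$, and $t\leftarrow t+1$. *)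

theory Defs
  imports
    "HOL-Probability.Probability"
    "Jordan_Normal_Form.Char_Poly"
    "Jordan_Normal_Form.DL_Rank"
begin

text \<open>Matrices are the carrier-based \<open>real mat\<close> of Jordan_Normal_Form, because the constant in
  the theorem must be chosen before the ambient dimension \<open>p\<close>.\<close>

definition mat_inner :: "real mat \<Rightarrow> real mat \<Rightarrow> real" where
  "mat_inner A B = (\<Sum>i<dim_col A. (transpose_mat A * B) $$ (i, i))"

definition frob_norm :: "real mat \<Rightarrow> real" where
  "frob_norm A = sqrt (\<Sum>i<dim_row A. \<Sum>j<dim_col A. (A $$ (i, j))\<^sup>2)"

text \<open>The \<open>i\<close>-th largest singular value (1-based): the square roots of the eigenvalues of
  \<open>A\<^sup>T A\<close>, listed with multiplicity. Intended for \<open>1 \<le> i \<le> dim_col A\<close>; for a wide matrix the list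
  is padded with zeros, and a matrix without rows has all singular values 0.\<close>

definition sing_val :: "nat \<Rightarrow> real mat \<Rightarrow> real" where
  "sing_val i A =
     sqrt (rev (sorted_list_of_multiset (proots (char_poly (transpose_mat A * A)))) ! (i - 1))"

definition full_col_rank :: "nat \<Rightarrow> nat \<Rightarrow> real mat set" where
  "full_col_rank p r = {Y \<in> carrier_mat p r. vec_space.rank p Y = r}"

definition orth_group :: "nat \<Rightarrow> real mat set" where
  "orth_group r = {Q \<in> carrier_mat r r. transpose_mat Q * Q = 1\<^sub>m r \<and> Q * transpose_mat Q = 1\<^sub>m r}"

text \<open>The distance of the classes \<open>[Y1]\<close> and \<open>[Y2]\<close>. By compactness of the orthogonal group the
  infimum is a minimum.\<close>

definition quot_dist :: "real mat \<Rightarrow> real mat \<Rightarrow> real" where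
  "quot_dist Y1 Y2 = (INF Q \<in> orth_group (dim_col Y1). frob_norm (Y2 * Q - Y1))"

definition psd_mat :: "real mat \<Rightarrow> bool" where
  "psd_mat X \<longleftrightarrow> transpose_mat X = X \<and>
     (\<forall>v \<in> carrier_vec (dim_row X). 0 \<le> scalar_prod v (X *\<^sub>v v))"

definition reduced_eigendecomp :: "nat \<Rightarrow> nat \<Rightarrow> real mat \<Rightarrow> real mat \<Rightarrow> real mat \<Rightarrow> bool" where
  "reduced_eigendecomp p r X U S \<longleftrightarrow>
     U \<in> carrier_mat p r \<and> transpose_mat U * U = 1\<^sub>m r \<and>
     S \<in> carrier_mat r r \<and> diagonal_mat S \<and> (\<forall>i<r. 0 < S $$ (i, i)) \<and>
     X = U * S * transpose_mat U"

definition orth_compl_basis :: "nat \<Rightarrow> nat \<Rightarrow> real mat \<Rightarrow> real mat \<Rightarrow> bool" where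
  "orth_compl_basis p r U V \<longleftrightarrow>
     V \<in> carrier_mat p (p - r) \<and> transpose_mat V * V = 1\<^sub>m (p - r) \<and>
     vec_space.col_space p V =
       {v \<in> carrier_vec p. \<forall>u \<in> vec_space.col_space p U. scalar_prod v u = 0}"

definition objective :: "real mat \<Rightarrow> real mat \<Rightarrow> real" where
  "objective X Y = (frob_norm (Y * transpose_mat Y - X))\<^sup>2 / 2"

text \<open>Horizontal lift of the Riemannian gradient of the objective.\<close>

definition rgrad :: "real mat \<Rightarrow> real mat \<Rightarrow> real mat" where
  "rgrad X Y = 2 \<cdot>\<^sub>m ((Y * transpose_mat Y - X) * Y)"

definition gd_step :: "real mat \<Rightarrow> real \<Rightarrow> real mat \<Rightarrow> real mat" where
  "gd_step X \<eta> Y = Y - \<eta> \<cdot>\<^sub>m ((Y * transpose_mat Y - X) * Y)"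

definition hor_space :: "real mat \<Rightarrow> real mat set" where
  "hor_space Y = {\<theta> \<in> carrier_mat (dim_row Y) (dim_col Y).
     transpose_mat (transpose_mat Y * \<theta>) = transpose_mat Y * \<theta>}"

definition hor_dim :: "nat \<Rightarrow> nat \<Rightarrow> real" where
  "hor_dim p r = real p * real r - ((real r)\<^sup>2 - real r) / 2"

definition lin_comb :: "nat \<Rightarrow> nat \<Rightarrow> real mat list \<Rightarrow> (nat \<Rightarrow> real) \<Rightarrow> real mat" where
  "lin_comb p r B c = Matrix.mat p r (\<lambda>ij. \<Sum>k<length B. c k * (B ! k) $$ ij)"

definition hor_onb :: "real mat \<Rightarrow> real mat list \<Rightarrow> bool" where
  "hor_onb Y B \<longleftrightarrow> set B \<subseteq> hor_space Y \<and>
     (\<forall>k<length B. \<forall>l<length B. mat_inner (B ! k) (B ! l) = (if k = l then 1 else 0)) \<and>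
     (\<forall>\<theta> \<in> hor_space Y. \<exists>c. \<theta> = lin_comb (dim_row Y) (dim_col Y) B c)"

definition mat_borel :: "nat \<Rightarrow> nat \<Rightarrow> real mat measure" where
  "mat_borel p r = vimage_algebra (carrier_mat p r)
     (\<lambda>A. \<lambda>ij \<in> {..<p} \<times> {..<r}. A $$ ij) (\<Pi>\<^sub>M ij \<in> {..<p} \<times> {..<r}. borel)"

text \<open>Uniform distribution on the Frobenius ball of radius \<open>w\<close> in the horizontal space at \<open>Y\<close>:
  uniform coordinates, with respect to Lebesgue measure on the Euclidean ball, in an orthonormal
  basis. Lebesgue measure is rotation invariant, so the choice of the basis does not matter.\<close>

definition unif_hor_ball :: "real mat \<Rightarrow> real \<Rightarrow> real mat measure" where
  "unif_hor_ball Y w =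
     (let B = (SOME B. hor_onb Y B); I = {..<length B}
      in distr (uniform_measure (\<Pi>\<^sub>M k \<in> I. lborel)
                  {c \<in> I \<rightarrow>\<^sub>E UNIV. (\<Sum>k\<in>I. (c k)\<^sup>2) \<le> w\<^sup>2})
               (mat_borel (dim_row Y) (dim_col Y))
               (lin_comb (dim_row Y) (dim_col Y) B))"

record prgd_params =
  par_chat :: real
  par_cmax :: real
  par_L :: real
  par_rho :: real
  par_K :: real  \<comment> \<open>an input of the subroutine that its body does not use\<close>
  par_inj :: real
  par_acc :: real
  par_fail :: real

text \<open>If \<open>objective X Y0 = 0\<close>, then \<open>ln 0 = 0\<close> plays the role of \<open>\<log> 0 = -\<infinity>\<close>; the
  maximum is 4 in both readings.\<close>

definition chi :: "prgd_params \<Rightarrow> real mat \<Rightarrow> real mat \<Rightarrow> real" where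
  "chi P X Y0 = 3 * max (ln (hor_dim (dim_row Y0) (dim_col Y0) * par_L P * objective X Y0 /
     (par_chat P * (par_acc P)\<^sup>2 * par_fail P))) 4"

definition g_thres :: "prgd_params \<Rightarrow> real mat \<Rightarrow> real mat \<Rightarrow> real" where
  "g_thres P X Y0 = sqrt (par_cmax P) / (chi P X Y0)\<^sup>2 * par_acc P"

definition f_thres :: "prgd_params \<Rightarrow> real mat \<Rightarrow> real mat \<Rightarrow> real" where
  "f_thres P X Y0 = par_cmax P / (chi P X Y0) ^ 3 * sqrt ((par_acc P) ^ 3 / par_rho P)"

definition t_thres :: "prgd_params \<Rightarrow> real mat \<Rightarrow> real mat \<Rightarrow> int" where
  "t_thres P X Y0 = \<lceil>chi P X Y0 / par_cmax P * (par_L P / sqrt (par_rho P * par_acc P))\<rceil>"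

record prgd_state =
  st_time :: nat
  st_noise :: int      \<comment> \<open>time of the last perturbation\<close>
  st_saved :: "real mat"  \<comment> \<open>iterate just before the last perturbation\<close>
  st_cur :: "real mat"
  st_calls :: nat      \<comment> \<open>gradient evaluations so far\<close>

text \<open>The initial value of \<open>st_saved\<close> is never read: (b) cannot apply before a perturbation.\<close>

definition prgd_init :: "prgd_params \<Rightarrow> real mat \<Rightarrow> real mat \<Rightarrow> prgd_state" where
  "prgd_init P X Y0 = \<lparr>st_time = 0, st_noise = - t_thres P X Y0 - 1, st_saved = Y0,
     st_cur = Y0, st_calls = 0\<rparr>"

definition perturb_now :: "prgd_params \<Rightarrow> real mat \<Rightarrow> real mat \<Rightarrow> prgd_state \<Rightarrow> bool" where
  "perturb_now P X Y0 s \<longleftrightarrow> frob_norm (rgrad X (st_cur s)) \<le> g_thres P X Y0 \<and>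
     int (st_time s) - st_noise s > t_thres P X Y0"

definition perturb :: "prgd_state \<Rightarrow> real mat \<Rightarrow> prgd_state" where
  "perturb s \<xi> = s\<lparr>st_noise := int (st_time s), st_saved := st_cur s, st_cur := st_cur s + \<xi>\<rparr>"

definition stop_now :: "prgd_params \<Rightarrow> real mat \<Rightarrow> real mat \<Rightarrow> prgd_state \<Rightarrow> bool" where
  "stop_now P X Y0 s \<longleftrightarrow> int (st_time s) - st_noise s = t_thres P X Y0 \<and>
     objective X (st_cur s) - objective X (st_saved s) > - f_thres P X Y0"

definition count_call :: "prgd_state \<Rightarrow> prgd_state" where
  "count_call s = s\<lparr>st_calls := st_calls s + 1\<rparr>"

text \<open>If the gradient vanishes, the step length evaluates to a finite number (division by zero is
  0) and the iterate does not move.\<close>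

definition descend :: "prgd_params \<Rightarrow> real mat \<Rightarrow> prgd_state \<Rightarrow> prgd_state" where
  "descend P X s = s\<lparr>st_time := st_time s + 1,
     st_cur := st_cur s - min (par_cmax P / par_L P) (par_inj P / frob_norm (rgrad X (st_cur s)))
                 \<cdot>\<^sub>m rgrad X (st_cur s)\<rparr>"

text \<open>\<open>prgd_prob_within P X Y0 Q n s\<close> is the probability that the loop, entered in state \<open>s\<close>, stops
  during the next \<open>n\<close> passes and then the output and the total number of gradient calls satisfy
  \<open>Q\<close>; it is obtained by conditioning on the perturbation drawn in the current pass (so it is the
  iterated integral that defines the law of the chain). \<open>Y0\<close> is the input of the subroutine, on
  which the thresholds depend. Steps (a) and (c) of a pass are charged one gradient call each,
  also when no perturbation separates them and (c) could reuse the value from (a).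
  For an integrand not known to be measurable, \<open>nn_integral\<close> is the lower integral, so lower
  bounds on this quantity are never optimistic.\<close>

primrec prgd_prob_within ::
  "prgd_params \<Rightarrow> real mat \<Rightarrow> real mat \<Rightarrow> (real mat \<Rightarrow> nat \<Rightarrow> bool) \<Rightarrow> nat \<Rightarrow> prgd_state \<Rightarrow> ennreal"
where
  "prgd_prob_within P X Y0 Q 0 = (\<lambda>s. 0)"
| "prgd_prob_within P X Y0 Q (Suc n) = (\<lambda>s.
     let s1 = count_call s;
         continue = (\<lambda>s'. if stop_now P X Y0 s'
                          then (if Q (st_saved s') (st_calls s') then 1 else 0)
                          else prgd_prob_within P X Y0 Q n (descend P X (count_call s')))
     in if perturb_now P X Y0 s1
        then (\<integral>\<^sup>+ \<xi>. continue (perturb s1 \<xi>) \<partial>unif_hor_ball (st_cur s1) (g_thres P X Y0))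
        else continue s1)"

text \<open>Probability that the subroutine, started at \<open>Y0\<close>, terminates and that its output and number
  of gradient calls satisfy \<open>Q\<close>. The events on the right increase with \<open>n\<close>.\<close>

definition prgd_prob ::
  "prgd_params \<Rightarrow> real mat \<Rightarrow> real mat \<Rightarrow> (real mat \<Rightarrow> nat \<Rightarrow> bool) \<Rightarrow> ennreal" where
  "prgd_prob P X Y0 Q = (SUP n. prgd_prob_within P X Y0 Q n (prgd_init P X Y0))"

text \<open>The same for the whole algorithm: \<open>T0\<close> gradient steps, the subroutine, \<open>T1\<close> gradient steps.\<close>

definition algorithm_prob ::
  "prgd_params \<Rightarrow> real mat \<Rightarrow> nat \<Rightarrow> nat \<Rightarrow> real \<Rightarrow> real mat \<Rightarrow> (real mat \<Rightarrow> nat \<Rightarrow> bool) \<Rightarrow> ennreal"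
where
  "algorithm_prob P X T0 T1 \<eta> Y Q =
     prgd_prob P X ((gd_step X \<eta> ^^ T0) Y)
       (\<lambda>Z calls. Q ((gd_step X \<eta> ^^ T1) Z) (T0 + calls + T1))"

end

theory Submission
  imports Defs
begin

text \<open>
  Under the hypotheses on the initial point, gradient descent alone converges linearly to the target,
  so the perturbed subroutine only has to do no harm. Taking its accuracy large and scaling \<open>L\<close> with
  the square root of the accuracy makes the waiting time 1 and all thresholds larger than the gradient norm and the objective at its
  input: it perturbs at once, sees no sufficient decrease (the objective is nonnegative) and returns
  its input, with probability 1 and after three gradient calls.

  For the convergence let \<open>K = U\<^sup>T Y\<close> and \<open>J = Y - U K\<close>. One step maps \<open>J\<close> to
  \<open>J (I - \<eta> Y\<^sup>T Y)\<close>, so the norm of \<open>J\<close> does not increase, and while the smallest singular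
  value of \<open>K\<close> is below a fixed fraction of that of the target it grows by a constant factor
  (the smallness of \<open>J\<close> against it makes the cross term negligible). Once it is bounded below,
  both \<open>J\<close> and \<open>S - K K\<^sup>T\<close> decay geometrically. Hence the steps of \<open>K\<close> are summable, and
  its limit \<open>L\<close> satisfies \<open>L L\<^sup>T = S\<close>, which makes \<open>U L\<close> a point of the target class;
  this avoids a polar decomposition.
\<close>

section \<open>Vector norms and operator bounds\<close>

unbundle no inner_syntax and no vec_syntax

text \<open>The constant must not see the dimension \<open>p\<close>. Hence the estimates use
  operator bounds; in the convergence argument, passages to entries happen only for \<open>r\<close>
  by \<open>r\<close> matrices, and the Frobenius norm is summed over the \<open>r\<close> columns.
  With \<open>a\<close> and \<open>b\<close> the squares of the smallest and largest singular value
  of \<open>Ystar\<close>, the stepsize \<open>\<eta> = a / (2000 * b\<^sup>2)\<close> makes the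
  terms of second order in \<eta> small against the gain \<eta> a. The obstacle is the initial
  phase. The gap S - K K^T is then large, and the cross term K J^T J could destroy a tiny singular
  value of K. The lower bound of K^T is therefore applied at x + \<eta> (S - K K^T) x and not at x.
  If the new value of K^T at x is still small, so was the old one, and the push by S wins. Of the
  cross term only a part proportional to x is dangerous, and it is absorbed because J^2 is small
  against the lower bound of K. This smallness persists: the bound of J does not increase and the
  lower bound of K does not decrease.\<close>

definition vec_norm :: "real vec \<Rightarrow> real" where
  "vec_norm v = sqrt (v \<bullet> v)"

text \<open>Encoded as a bound instead of a norm: bounds compose directly and no supremum has to be
  formed.\<close>

definition opnorm_le :: "real mat \<Rightarrow> real \<Rightarrow> bool" where
  "opnorm_le A c \<longleftrightarrow> (\<forall>v \<in> carrier_vec (dim_col A). vec_norm (A *\<^sub>v v) \<le> c * vec_norm v)"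

lemma scalar_prod_self_nonneg [simp]: "0 \<le> v \<bullet> (v :: real vec)"
  by (auto simp: scalar_prod_def intro!: sum_nonneg)

lemma vec_norm_nonneg [simp]: "0 \<le> vec_norm v"
  by (simp add: vec_norm_def)

lemma vec_norm_power2: "(vec_norm v)\<^sup>2 = v \<bullet> v"
  by (simp add: vec_norm_def)

lemma vec_norm_L2: "vec_norm v = L2_set (($) v) {..<dim_vec v}"
  by (simp add: vec_norm_def L2_set_def scalar_prod_def power2_eq_square atLeast0LessThan)

lemma vec_norm_zero_iff:
  assumes "v \<in> carrier_vec n"
  shows "vec_norm v = 0 \<longleftrightarrow> v = 0\<^sub>v n"
proof
  assume "vec_norm v = 0"
  then have "\<forall>i<n. v $ i = 0" using assms by (auto simp: vec_norm_L2 L2_set_eq_0_iff)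
  then show "v = 0\<^sub>v n" using assms by auto
qed (simp add: vec_norm_def)

lemma scalar_prod_Cauchy_Schwarz:
  assumes "v \<in> carrier_vec n" "w \<in> carrier_vec n"
  shows "\<bar>v \<bullet> w\<bar> \<le> vec_norm v * vec_norm w"
proof -
  have "\<bar>v \<bullet> w\<bar> \<le> (\<Sum>i<n. \<bar>v $ i\<bar> * \<bar>w $ i\<bar>)"
    using assms sum_abs[of "\<lambda>i. v $ i * w $ i" "{..<n}"]
    by (simp add: scalar_prod_def atLeast0LessThan abs_mult)
  also have "\<dots> \<le> L2_set (($) v) {..<n} * L2_set (($) w) {..<n}"
    by (rule L2_set_mult_ineq)
  finally show ?thesis using assms by (simp add: vec_norm_L2)
qed

lemma vec_norm_triangle:
  assumes "v \<in> carrier_vec n" "w \<in> carrier_vec n"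
  shows "vec_norm (v + w) \<le> vec_norm v + vec_norm w"
  using assms L2_set_triangle_ineq[of "($) v" "($) w" "{..<n}"]
  by (simp add: vec_norm_L2 L2_set_def)

lemma vec_norm_smult: "vec_norm (c \<cdot>\<^sub>v v) = \<bar>c\<bar> * vec_norm v"
proof -
  have "(c \<cdot>\<^sub>v v) \<bullet> (c \<cdot>\<^sub>v v) = c\<^sup>2 * (v \<bullet> v)"
    by (simp add: power2_eq_square)
  then show ?thesis by (simp add: vec_norm_def real_sqrt_mult)
qed

lemma vec_norm_uminus: "vec_norm (- v) = vec_norm v"
  by (simp add: vec_norm_L2 L2_set_def)

lemma vec_norm_triangle_minus:
  assumes "v \<in> carrier_vec n" "w \<in> carrier_vec n"
  shows "vec_norm (v - w) \<le> vec_norm v + vec_norm w"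
proof -
  have "v - w = v + - w" using assms by auto
  then show ?thesis using vec_norm_triangle[of v n "- w"] assms by (simp add: vec_norm_uminus)
qed

lemma vec_norm_minus_power2:
  assumes "v \<in> carrier_vec n" "w \<in> carrier_vec n"
  shows "(vec_norm (v - w))\<^sup>2 = (vec_norm v)\<^sup>2 - 2 * (v \<bullet> w) + (vec_norm w)\<^sup>2"
  using assms
  by (simp add: vec_norm_power2 minus_scalar_prod_distrib[of _ n] scalar_prod_minus_distrib[of _ n]
      comm_scalar_prod[of w n v])

lemma mult_mat_smult_vec:
  "A \<in> carrier_mat m n \<Longrightarrow> v \<in> carrier_vec n \<Longrightarrow> A *\<^sub>v (c \<cdot>\<^sub>v v) = c \<cdot>\<^sub>v (A *\<^sub>v (v :: real vec))"
  by (rule mult_mat_vec)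

lemma smult_mat_mult_vec:
  "A \<in> carrier_mat m n \<Longrightarrow> v \<in> carrier_vec n \<Longrightarrow> (c \<cdot>\<^sub>m A) *\<^sub>v v = c \<cdot>\<^sub>v (A *\<^sub>v (v :: real vec))"
  by (intro eq_vecI) (auto simp: mult_mat_vec_def)

lemma opnorm_leD:
  "opnorm_le A c \<Longrightarrow> A \<in> carrier_mat m n \<Longrightarrow> v \<in> carrier_vec n \<Longrightarrow> vec_norm (A *\<^sub>v v) \<le> c * vec_norm v"
  by (auto simp: opnorm_le_def)

lemma opnorm_leI:
  assumes "A \<in> carrier_mat m n"
    and "\<And>v. v \<in> carrier_vec n \<Longrightarrow> vec_norm (A *\<^sub>v v) \<le> c * vec_norm v"
  shows "opnorm_le A c"
  using assms by (auto simp: opnorm_le_def)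

lemma opnorm_le_mono: "opnorm_le A c \<Longrightarrow> c \<le> d \<Longrightarrow> opnorm_le A d"
  unfolding opnorm_le_def by (meson mult_right_mono order_trans vec_norm_nonneg)

lemma opnorm_le_mult:
  assumes "opnorm_le A c" "opnorm_le B d" "0 \<le> c" "A \<in> carrier_mat l m" "B \<in> carrier_mat m n"
  shows "opnorm_le (A * B) (c * d)"
proof (rule opnorm_leI[of _ l n])
  fix v :: "real vec" assume v: "v \<in> carrier_vec n"
  have "vec_norm ((A * B) *\<^sub>v v) = vec_norm (A *\<^sub>v (B *\<^sub>v v))"
    using assms v by simp
  also have "\<dots> \<le> c * vec_norm (B *\<^sub>v v)"
    using assms v by (intro opnorm_leD) auto
  also have "\<dots> \<le> c * (d * vec_norm v)"
    using assms v by (intro mult_left_mono opnorm_leD) auto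
  finally show "vec_norm ((A * B) *\<^sub>v v) \<le> c * d * vec_norm v" by simp
qed (use assms in auto)

lemma opnorm_le_transpose:
  assumes "opnorm_le A c" "0 \<le> c" "A \<in> carrier_mat m n"
  shows "opnorm_le A\<^sup>T c"
proof (rule opnorm_leI[of _ n m])
  fix v :: "real vec" assume v: "v \<in> carrier_vec m"
  let ?w = "A\<^sup>T *\<^sub>v v"
  have w: "?w \<in> carrier_vec n" using assms v by auto
  have "(vec_norm ?w)\<^sup>2 = v \<bullet> (A *\<^sub>v ?w)"
    using transpose_vec_mult_scalar[OF assms(3) w v] by (simp add: vec_norm_power2)
  also have "\<dots> \<le> vec_norm v * vec_norm (A *\<^sub>v ?w)"
    using scalar_prod_Cauchy_Schwarz[of v m "A *\<^sub>v ?w"] assms v w by auto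
  also have "\<dots> \<le> vec_norm v * (c * vec_norm ?w)"
    using assms v w by (intro mult_left_mono opnorm_leD) auto
  finally have "vec_norm ?w * vec_norm ?w \<le> (c * vec_norm v) * vec_norm ?w"
    by (simp add: power2_eq_square algebra_simps)
  then show "vec_norm ?w \<le> c * vec_norm v"
    using assms vec_norm_nonneg[of ?w]
    by (cases "vec_norm ?w = 0") (auto simp: mult_le_cancel_right less_le)
qed (use assms in auto)

lemma scalar_prod_mult_transpose:
  assumes "A \<in> carrier_mat m n" "x \<in> carrier_vec n" "y \<in> carrier_vec m"
  shows "x \<bullet> (A\<^sup>T *\<^sub>v y) = (A *\<^sub>v x) \<bullet> (y :: real vec)"
  using transpose_vec_mult_scalar[OF assms] assms
  by (metis comm_scalar_prod mult_mat_vec_carrier transpose_carrier_mat)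

text \<open>The bound makes \<open>A\<close> invertible with an inverse of norm at most 1/c, and
  pairing that inverse with A^T transfers it by duality. It connects the growth argument, which
  works on K^T, with the decay of J, which needs K.\<close>

lemma bounded_below_transpose:
  fixes A :: "real mat"
  assumes A: "A \<in> carrier_mat n n" and c: "0 < c"
    and below: "\<And>x. x \<in> carrier_vec n \<Longrightarrow> c * vec_norm x \<le> vec_norm (A *\<^sub>v x)"
    and x: "x \<in> carrier_vec n"
  shows "c * vec_norm x \<le> vec_norm (A\<^sup>T *\<^sub>v x)"
proof -
  have "det A \<noteq> 0"
  proof
    assume "det A = 0"
    then obtain v where v: "v \<in> carrier_vec n" "v \<noteq> 0\<^sub>v n" "A *\<^sub>v v = 0\<^sub>v n"
      using det_0_iff_vec_prod_zero[OF A] by auto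
    have "vec_norm v \<le> 0"
      using below[OF v(1)] v(3) c vec_norm_zero_iff[of "0\<^sub>v n" n] by (simp add: mult_le_0_iff)
    then show False using v vec_norm_zero_iff[of v n] by (simp add: order_antisym)
  qed
  then obtain B where B: "B \<in> carrier_mat n n" "A * B = 1\<^sub>m n"
    using det_non_zero_imp_unit[OF A] by (auto simp: Units_def ring_mat_def)
  let ?u = "B *\<^sub>v x"
  have u: "?u \<in> carrier_vec n" using B x by auto
  have Au: "A *\<^sub>v ?u = x"
    using A B x by (metis assoc_mult_mat_vec one_mult_mat_vec)
  have cu: "c * vec_norm ?u \<le> vec_norm x" using below[OF u] Au by simp
  have "(vec_norm x)\<^sup>2 = ?u \<bullet> (A\<^sup>T *\<^sub>v x)"
    using scalar_prod_mult_transpose[OF A u x] Au by (simp add: vec_norm_power2)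
  also have "\<dots> \<le> vec_norm ?u * vec_norm (A\<^sup>T *\<^sub>v x)"
    using scalar_prod_Cauchy_Schwarz[OF u, of "A\<^sup>T *\<^sub>v x"] A x by auto
  finally have 1: "(vec_norm x)\<^sup>2 \<le> vec_norm ?u * vec_norm (A\<^sup>T *\<^sub>v x)" .
  have "vec_norm x * (c * vec_norm x) = c * (vec_norm x)\<^sup>2" by (simp add: power2_eq_square)
  also have "\<dots> \<le> (c * vec_norm ?u) * vec_norm (A\<^sup>T *\<^sub>v x)"
    using 1 c by simp
  also have "\<dots> \<le> vec_norm x * vec_norm (A\<^sup>T *\<^sub>v x)"
    using cu by (intro mult_right_mono) auto
  finally show ?thesis
    by (cases "vec_norm x = 0") (auto simp: mult_le_cancel_left less_le)
qed

lemma vec_norm_col_le: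
  assumes "opnorm_le A c" "A \<in> carrier_mat m n" "j < n"
  shows "vec_norm (col A j) \<le> c"
proof -
  have "A *\<^sub>v unit_vec n j = col A j"
    using assms by (intro eq_vecI) (auto simp: carrier_matD)
  moreover have "vec_norm (unit_vec n j) = 1"
    using assms by (simp add: vec_norm_def)
  ultimately show ?thesis
    using opnorm_leD[OF assms(1,2) unit_vec_carrier, of j] by simp
qed

lemma abs_index_mat_le_opnorm:
  assumes "opnorm_le A c" "A \<in> carrier_mat m n" "i < m" "j < n"
  shows "\<bar>A $$ (i, j)\<bar> \<le> c"
proof -
  have "\<bar>A $$ (i, j)\<bar> = \<bar>col A j $ i\<bar>" using assms by auto
  also have "\<dots> \<le> vec_norm (col A j)"
    using assms member_le_L2_set[of "{..<m}" i "\<lambda>i. \<bar>col A j $ i\<bar>"]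
    by (simp add: vec_norm_L2 L2_set_def)
  also have "\<dots> \<le> c" by (rule vec_norm_col_le[OF assms(1,2,4)])
  finally show ?thesis .
qed

lemma frob_norm_cols:
  assumes "A \<in> carrier_mat m n"
  shows "(frob_norm A)\<^sup>2 = (\<Sum>j<n. (vec_norm (col A j))\<^sup>2)"
proof -
  have "(frob_norm A)\<^sup>2 = (\<Sum>i<m. \<Sum>j<n. (A $$ (i, j))\<^sup>2)"
    using assms by (simp add: frob_norm_def sum_nonneg)
  also have "\<dots> = (\<Sum>j<n. \<Sum>i<m. (A $$ (i, j))\<^sup>2)" by (rule sum.swap)
  also have "\<dots> = (\<Sum>j<n. (vec_norm (col A j))\<^sup>2)"
    unfolding vec_norm_power2 using assms
    by (intro sum.cong) (auto simp: scalar_prod_def power2_eq_square atLeast0LessThan)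
  finally show ?thesis .
qed

lemma frob_norm_nonneg [simp]: "0 \<le> frob_norm A"
  by (simp add: frob_norm_def sum_nonneg)

text \<open>Each column is the image of a unit vector. Summing over the columns and not the rows
  keeps the factor at \<open>r\<close> for a \<open>p\<close> by \<open>r\<close> matrix.\<close>

lemma frob_norm_le_opnorm:
  assumes "opnorm_le A c" "A \<in> carrier_mat m n" "0 \<le> c"
  shows "frob_norm A \<le> real n * c"
proof -
  have "(frob_norm A)\<^sup>2 \<le> (\<Sum>j<n. c\<^sup>2)"
    unfolding frob_norm_cols[OF assms(2)] using vec_norm_col_le[OF assms(1,2)]
    by (intro sum_mono power_mono) auto
  also have "\<dots> \<le> (real n * c)\<^sup>2"
  proof -
    have "real n * c\<^sup>2 \<le> (real n)\<^sup>2 * c\<^sup>2"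
      by (intro mult_right_mono) (cases n, auto simp: power2_eq_square)
    then show ?thesis by (simp add: power_mult_distrib)
  qed
  finally show ?thesis using assms by (simp add: power2_le_iff_abs_le)
qed

text \<open>Crude in both dimensions; in the convergence argument it meets only \<open>r\<close> by
  \<open>r\<close> matrices.\<close>

lemma opnorm_le_entries:
  assumes A: "A \<in> carrier_mat m n" and c: "0 \<le> c"
    and entries: "\<And>i j. i < m \<Longrightarrow> j < n \<Longrightarrow> \<bar>A $$ (i, j)\<bar> \<le> c"
  shows "opnorm_le A (real m * real n * c)"
proof (rule opnorm_leI[OF A])
  fix v :: "real vec" assume v: "v \<in> carrier_vec n"
  have comp: "\<bar>v $ j\<bar> \<le> vec_norm v" if "j < n" for j
    using that v member_le_L2_set[of "{..<n}" j "\<lambda>i. \<bar>v $ i\<bar>"]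
    by (simp add: vec_norm_L2 L2_set_def)
  have row: "\<bar>(A *\<^sub>v v) $ i\<bar> \<le> real n * (c * vec_norm v)" if i: "i < m" for i
  proof -
    have "\<bar>(A *\<^sub>v v) $ i\<bar> \<le> (\<Sum>j<n. \<bar>A $$ (i, j) * v $ j\<bar>)"
      using i A v sum_abs[of "\<lambda>j. A $$ (i, j) * v $ j" "{..<n}"]
      by (simp add: scalar_prod_def atLeast0LessThan)
    also have "\<dots> \<le> (\<Sum>j<n. c * vec_norm v)"
      using entries[OF i] comp c by (intro sum_mono) (auto simp: abs_mult intro!: mult_mono)
    finally show ?thesis by simp
  qed
  have "vec_norm (A *\<^sub>v v) \<le> (\<Sum>i<m. \<bar>(A *\<^sub>v v) $ i\<bar>)"
    using A L2_set_le_sum_abs[of "($) (A *\<^sub>v v)" "{..<m}"] by (simp add: vec_norm_L2)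
  also have "\<dots> \<le> (\<Sum>i<m. real n * (c * vec_norm v))" by (intro sum_mono row) simp
  finally show "vec_norm (A *\<^sub>v v) \<le> real m * real n * c * vec_norm v"
    by (simp add: algebra_simps)
qed

text \<open>Expanding the square gives a first-order gain of twice \<eta> |A v|^2; the condition on
  \<open>\<eta>\<close> lets one half of it pay for the second-order term. Applied to Y for J, to
  Y^T for the norm bound and to K^T for the gap.\<close>

lemma gram_step_contracts:
  assumes A: "A \<in> carrier_mat m n" and op: "opnorm_le A c" and c: "0 \<le> c" and eta: "0 \<le> \<eta>" "\<eta> * c\<^sup>2 \<le> 1"
    and v: "v \<in> carrier_vec n"
  shows "(vec_norm (v - \<eta> \<cdot>\<^sub>v (A\<^sup>T *\<^sub>v (A *\<^sub>v v))))\<^sup>2 \<le> (vec_norm v)\<^sup>2 - \<eta> * (vec_norm (A *\<^sub>v v))\<^sup>2"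
proof -
  let ?w = "A\<^sup>T *\<^sub>v (A *\<^sub>v v)"
  have w: "?w \<in> carrier_vec n" using A v by auto
  have "vec_norm ?w \<le> c * vec_norm (A *\<^sub>v v)"
    using opnorm_le_transpose[OF op c A] A v by (intro opnorm_leD) auto
  then have "\<eta> * (\<eta> * (vec_norm ?w)\<^sup>2) \<le> \<eta> * (\<eta> * (c * vec_norm (A *\<^sub>v v))\<^sup>2)"
    using eta by (intro mult_left_mono power_mono) auto
  also have "\<dots> = \<eta> * ((\<eta> * c\<^sup>2) * (vec_norm (A *\<^sub>v v))\<^sup>2)"
    by (simp add: power_mult_distrib)
  also have "\<dots> \<le> \<eta> * (1 * (vec_norm (A *\<^sub>v v))\<^sup>2)"
    using eta by (intro mult_left_mono mult_right_mono) auto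
  finally have "(vec_norm (\<eta> \<cdot>\<^sub>v ?w))\<^sup>2 \<le> \<eta> * (vec_norm (A *\<^sub>v v))\<^sup>2"
    by (simp add: vec_norm_smult power_mult_distrib power2_eq_square algebra_simps)
  moreover have "v \<bullet> ?w = (vec_norm (A *\<^sub>v v))\<^sup>2"
    using scalar_prod_mult_transpose[OF A v, of "A *\<^sub>v v"] A v by (simp add: vec_norm_power2)
  moreover have "v \<bullet> (\<eta> \<cdot>\<^sub>v ?w) = \<eta> * (v \<bullet> ?w)"
    using v w by (intro scalar_prod_smult_distrib)
  ultimately show ?thesis
    using vec_norm_minus_power2[of v n "\<eta> \<cdot>\<^sub>v ?w"] v w by auto
qed

section \<open>Singular values as operator bounds\<close>

text \<open>No compactness is needed: let \<open>\<mu>\<close> be the infimum of the bounds of the quadratic form. If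
  \<open>B = \<mu> I - A\<close> had an inverse of norm at most \<open>C\<close>, then evaluating the form of \<open>B\<close> at
  \<open>v - C\<^sup>-\<^sup>1 B\<^sup>-\<^sup>1 v\<close> would show that \<open>\<mu> - 1/C\<close> is a bound as well.\<close>

lemma symmetric_mat_max_eigenvector:
  fixes A :: "real mat"
  assumes A: "A \<in> carrier_mat n n" and sym: "A\<^sup>T = A" and n: "0 < n"
  obtains \<mu> v where "eigenvector A v \<mu>"
    and "\<And>x. x \<in> carrier_vec n \<Longrightarrow> x \<bullet> (A *\<^sub>v x) \<le> \<mu> * (x \<bullet> x)"
proof -
  have bounded: "\<exists>c>0. opnorm_le B c" if B: "B \<in> carrier_mat n n" for B :: "real mat"
  proof -
    define c where "c = 1 + (\<Sum>i<n. \<Sum>j<n. \<bar>B $$ (i, j)\<bar>)"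
    have "\<bar>B $$ (i, j)\<bar> \<le> c" if ij: "i < n" "j < n" for i j
    proof -
      have "\<bar>B $$ (i, j)\<bar> \<le> (\<Sum>j<n. \<bar>B $$ (i, j)\<bar>)"
        using ij by (intro member_le_sum) auto
      also have "\<dots> \<le> (\<Sum>i<n. \<Sum>j<n. \<bar>B $$ (i, j)\<bar>)"
        using ij by (intro member_le_sum[of i "{..<n}" "\<lambda>i. \<Sum>j<n. \<bar>B $$ (i, j)\<bar>"])
          (auto intro: sum_nonneg)
      finally show ?thesis by (simp add: c_def)
    qed
    moreover have c: "0 < c" unfolding c_def by (auto intro!: add_pos_nonneg sum_nonneg)
    ultimately have "opnorm_le B (real n * real n * c)"
      using B by (intro opnorm_le_entries) auto
    moreover have "0 < real n * real n * c" using n c by simp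
    ultimately show ?thesis by blast
  qed
  define R where "R = {\<mu>. \<forall>x \<in> carrier_vec n. x \<bullet> (A *\<^sub>v x) \<le> \<mu> * (x \<bullet> x)}"
  have quad_le: "x \<bullet> (B *\<^sub>v x) \<le> c * (x \<bullet> x)"
    if "B \<in> carrier_mat n n" "opnorm_le B c" "x \<in> carrier_vec n" for B c x
  proof -
    have "x \<bullet> (B *\<^sub>v x) \<le> vec_norm x * vec_norm (B *\<^sub>v x)"
      using scalar_prod_Cauchy_Schwarz[of x n "B *\<^sub>v x"] that by auto
    also have "\<dots> \<le> vec_norm x * (c * vec_norm x)"
      using that by (intro mult_left_mono opnorm_leD) auto
    finally show ?thesis by (simp add: vec_norm_power2[symmetric] power2_eq_square mult_ac)
  qed
  have "R \<noteq> {}" using bounded[OF A] quad_le[OF A] unfolding R_def by blast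
  \<comment> \<open>Testing with the first unit vector bounds \<open>R\<close> from below, so that
    its infimum is meaningful.\<close>
  have "A $$ (0, 0) \<le> \<mu>" if "\<mu> \<in> R" for \<mu>
  proof -
    have "A *\<^sub>v unit_vec n 0 = col A 0" using A n by (intro eq_vecI) auto
    moreover have "unit_vec n 0 \<bullet> (A *\<^sub>v unit_vec n 0) \<le> \<mu> * (unit_vec n 0 \<bullet> unit_vec n 0)"
      using that unfolding R_def by auto
    ultimately show ?thesis using A n by simp
  qed
  then have bdd: "bdd_below R" by (auto simp: bdd_below_def)
  define \<mu> where "\<mu> = Inf R"
  have quad: "x \<bullet> (A *\<^sub>v x) \<le> \<mu> * (x \<bullet> x)" if x: "x \<in> carrier_vec n" for x
  proof (cases "x \<bullet> x = 0")
    case True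
    then have "vec_norm x = 0" by (simp add: vec_norm_def)
    then have "x = 0\<^sub>v n" using vec_norm_zero_iff[OF x] by simp
    then show ?thesis using A by simp
  next
    case False
    then have pos: "0 < x \<bullet> x" by (simp add: less_le)
    have "(x \<bullet> (A *\<^sub>v x)) / (x \<bullet> x) \<le> \<mu>"
      unfolding \<mu>_def using x pos \<open>R \<noteq> {}\<close>
      by (intro cInf_greatest) (auto simp: R_def divide_le_eq)
    then show ?thesis using pos by (simp add: divide_le_eq)
  qed
  define B where "B = \<mu> \<cdot>\<^sub>m 1\<^sub>m n - A"
  have B: "B \<in> carrier_mat n n" using A by (auto simp: B_def)
  have Bx: "B *\<^sub>v x = \<mu> \<cdot>\<^sub>v x - A *\<^sub>v x" if "x \<in> carrier_vec n" for x
    unfolding B_def using that A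
    by (subst minus_mult_distrib_mat_vec[of _ n n]) (auto simp: smult_mat_mult_vec[of _ n n])
  have BT: "B\<^sup>T = B"
  proof (rule eq_matI)
    fix i j assume "i < dim_row B" "j < dim_col B"
    then have ij: "i < n" "j < n" using B by auto
    have "A $$ (j, i) = A $$ (i, j)" using arg_cong[OF sym, of "\<lambda>M. M $$ (i, j)"] ij A by simp
    then show "B\<^sup>T $$ (i, j) = B $$ (i, j)" using ij A by (simp add: B_def)
  qed (use B in auto)
  have "det B = 0"
  proof (rule ccontr)
    assume "det B \<noteq> 0"
    then obtain B' where B': "B' \<in> carrier_mat n n" "B * B' = 1\<^sub>m n"
      using det_non_zero_imp_unit[OF B] by (auto simp: Units_def ring_mat_def)
    obtain C where C: "0 < C" "opnorm_le B' C" using bounded[OF B'(1)] by auto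
    have "\<mu> - 1 / C \<in> R" unfolding R_def
    proof safe
      fix v :: "real vec" assume v: "v \<in> carrier_vec n"
      define w where "w = B' *\<^sub>v v"
      have w: "w \<in> carrier_vec n" using B' v by (simp add: w_def)
      have Bw: "B *\<^sub>v w = v" unfolding w_def
        using B B' v by (metis assoc_mult_mat_vec one_mult_mat_vec)
      have wBv: "w \<bullet> (B *\<^sub>v v) = v \<bullet> v"
        using scalar_prod_mult_transpose[OF B w v] Bw BT by simp
      \<comment> \<open>This value maximizes 2 s - C s^2, the lower bound that the test vector
        yields for the form of \<open>B\<close>.\<close>
      define s where "s = 1 / C"
      let ?y = "v - s \<cdot>\<^sub>v w"
      have y: "?y \<in> carrier_vec n" using v w by simp
      have "B *\<^sub>v ?y = B *\<^sub>v v - s \<cdot>\<^sub>v v"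
        using B v w by (simp add: mult_minus_distrib_mat_vec[of _ n n] mult_mat_smult_vec[of _ n n] Bw)
      then have "?y \<bullet> (B *\<^sub>v ?y) = v \<bullet> (B *\<^sub>v v) - 2 * s * (v \<bullet> v) + s\<^sup>2 * (w \<bullet> v)"
        using B v w wBv
        by (simp add: minus_scalar_prod_distrib[of _ n] scalar_prod_minus_distrib[of _ n]
            power2_eq_square algebra_simps)
      moreover have "0 \<le> ?y \<bullet> (B *\<^sub>v ?y)"
        using quad[OF y] y A
        by (simp add: Bx[OF y] scalar_prod_minus_distrib[of _ n])
      moreover have "s\<^sup>2 * (w \<bullet> v) \<le> s\<^sup>2 * (C * (v \<bullet> v))"
        using quad_le[OF B'(1) C(2) v] comm_scalar_prod[OF v w]
        by (intro mult_left_mono) (auto simp: w_def)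
      moreover have "s\<^sup>2 * (C * (v \<bullet> v)) = s * (v \<bullet> v)"
        using C by (simp add: s_def power2_eq_square)
      ultimately have "s * (v \<bullet> v) \<le> v \<bullet> (B *\<^sub>v v)" by linarith
      also have "\<dots> = \<mu> * (v \<bullet> v) - v \<bullet> (A *\<^sub>v v)"
        using v A by (simp add: Bx scalar_prod_minus_distrib[of _ n])
      finally show "v \<bullet> (A *\<^sub>v v) \<le> (\<mu> - 1 / C) * (v \<bullet> v)" by (simp add: s_def algebra_simps)
    qed
    then have "\<mu> \<le> \<mu> - 1 / C" unfolding \<mu>_def using bdd by (rule cInf_lower)
    then show False using C by simp
  qed
  then obtain v where v: "v \<in> carrier_vec n" "v \<noteq> 0\<^sub>v n" "B *\<^sub>v v = 0\<^sub>v n"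
    using det_0_iff_vec_prod_zero[OF B] by auto
  have Av: "A *\<^sub>v v = \<mu> \<cdot>\<^sub>v v"
  proof (rule eq_vecI)
    fix i assume "i < dim_vec (\<mu> \<cdot>\<^sub>v v)"
    then have i: "i < n" using v by simp
    have "(\<mu> \<cdot>\<^sub>v v - A *\<^sub>v v) $ i = 0" using v(3) i by (simp add: Bx[OF v(1)])
    then show "(A *\<^sub>v v) $ i = (\<mu> \<cdot>\<^sub>v v) $ i" using A v i by simp
  qed (use A v in auto)
  then have "eigenvector A v \<mu>" using A v by (simp add: eigenvector_def)
  then show ?thesis using quad that by blast
qed

lemma symmetric_mat_min_eigenvector:
  fixes A :: "real mat"
  assumes A: "A \<in> carrier_mat n n" and sym: "A\<^sup>T = A" and n: "0 < n"
  obtains \<mu> v where "eigenvector A v \<mu>"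
    and "\<And>x. x \<in> carrier_vec n \<Longrightarrow> \<mu> * (x \<bullet> x) \<le> x \<bullet> (A *\<^sub>v x)"
proof -
  have neg: "(- A) *\<^sub>v x = - (A *\<^sub>v x)" if "x \<in> carrier_vec n" for x
    using A that by (intro eq_vecI) auto
  obtain \<mu> v where \<mu>: "eigenvector (- A) v \<mu>"
    and q: "\<And>x. x \<in> carrier_vec n \<Longrightarrow> x \<bullet> ((- A) *\<^sub>v x) \<le> \<mu> * (x \<bullet> x)"
    using symmetric_mat_max_eigenvector[of "- A" n] A sym n
    by (metis transpose_uminus uminus_carrier_iff_mat)
  have v: "v \<in> carrier_vec n" using \<mu> A by (simp add: eigenvector_def)
  have "A *\<^sub>v v = (- \<mu>) \<cdot>\<^sub>v v"
  proof (rule eq_vecI)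
    fix i assume "i < dim_vec ((- \<mu>) \<cdot>\<^sub>v v)"
    then have i: "i < n" using v by simp
    have "(- (A *\<^sub>v v)) $ i = (\<mu> \<cdot>\<^sub>v v) $ i"
      using \<mu> neg[OF v] by (simp add: eigenvector_def)
    then show "(A *\<^sub>v v) $ i = ((- \<mu>) \<cdot>\<^sub>v v) $ i" using A v i by simp
  qed (use A v in auto)
  then have "eigenvector A v (- \<mu>)" using \<mu> A by (simp add: eigenvector_def)
  moreover have "- \<mu> * (x \<bullet> x) \<le> x \<bullet> (A *\<^sub>v x)" if x: "x \<in> carrier_vec n" for x
    using q[OF x] A x by (simp add: neg)
  ultimately show ?thesis using that by blast
qed

section \<open>Real-rootedness of symmetric characteristic polynomials\<close>

lemma symmetric_mat_complex_eigenvalue_real: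
  fixes A :: "real mat"
  assumes A: "A \<in> carrier_mat n n" and sym: "A\<^sup>T = A"
    and root: "poly (map_poly complex_of_real (char_poly A)) z = 0"
  shows "z \<in> \<real>"
proof -
  let ?C = "map_mat complex_of_real A"
  have C: "?C \<in> carrier_mat n n" using A by simp
  have "eigenvalue ?C z"
    using root of_real_hom.char_poly_hom[OF A, where 'a = complex] eigenvalue_root_char_poly[OF C] by simp
  then obtain v where v: "v \<in> carrier_vec n" "v \<noteq> 0\<^sub>v n" "?C *\<^sub>v v = z \<cdot>\<^sub>v v"
    using C by (auto simp: eigenvalue_def eigenvector_def)
  let ?w = "conjugate v"
  have w: "?w \<in> carrier_vec n" using v by simp
  have CT: "?C\<^sup>T = ?C" using sym by (simp add: map_mat_transpose)
  have Cw: "?C *\<^sub>v ?w = cnj z \<cdot>\<^sub>v ?w"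
  proof (rule eq_vecI)
    fix i assume "i < dim_vec (cnj z \<cdot>\<^sub>v ?w)"
    then have i: "i < n" using v by simp
    have "(?C *\<^sub>v ?w) $ i = cnj ((?C *\<^sub>v v) $ i)"
      using A v(1) i by (simp add: scalar_prod_def cnj_sum)
    then show "(?C *\<^sub>v ?w) $ i = (cnj z \<cdot>\<^sub>v ?w) $ i" using v i by simp
  qed (use A v in auto)
  have "(?C *\<^sub>v ?w) \<bullet> v = ?w \<bullet> (?C *\<^sub>v v)"
    using transpose_vec_mult_scalar[OF C v(1) w] CT by simp
  then have "cnj z * (?w \<bullet> v) = z * (?w \<bullet> v)" using v w by (simp add: Cw)
  moreover have "?w \<bullet> v \<noteq> 0"
    using conjugate_square_eq_0_vec[OF v(1)] v(2) comm_scalar_prod[OF v(1) w] by simp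
  ultimately show ?thesis by (simp add: Reals_cnj_iff)
qed

text \<open>\<open>proots\<close> sees real roots only. A complex root exists by the fundamental
  theorem of algebra, is real by hypothesis and splits off a real linear factor, and the cofactor
  inherits the hypothesis.\<close>

lemma size_proots_real_rooted:
  fixes q :: "real poly"
  assumes "q \<noteq> 0" and "\<And>z. poly (map_poly complex_of_real q) z = 0 \<Longrightarrow> z \<in> \<real>"
  shows "size (proots q) = degree q"
  using assms
proof (induction "degree q" arbitrary: q)
  case 0
  then obtain c where "q = [:c:]" using degree_0_id by metis
  then show ?case by simp
next
  case (Suc d)
  have "degree (map_poly complex_of_real q) = degree q" by simp
  then have "\<not> constant (poly (map_poly complex_of_real q))"
    using Suc.hyps(2) by (simp add: constant_degree)
  then obtain z where z: "poly (map_poly complex_of_real q) z = 0"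
    using fundamental_theorem_of_algebra by blast
  then obtain x where x: "z = complex_of_real x" using Suc.prems by (auto elim: Reals_cases)
  have "poly q x = 0" using z unfolding x by simp
  then obtain k where k: "q = [:- x, 1:] * k" by (auto simp: poly_eq_0_iff_dvd)
  have k0: "k \<noteq> 0" using Suc.prems(1) k by auto
  have deg: "degree q = Suc (degree k)" unfolding k using k0 by (subst degree_mult_eq) auto
  have "size (proots k) = degree k"
  proof (rule Suc.hyps(1))
    fix z assume kz: "poly (map_poly complex_of_real k) z = 0"
    interpret of_real_poly_hom: map_poly_idom_hom complex_of_real ..
    have "map_poly complex_of_real q = map_poly complex_of_real [:- x, 1:] * map_poly complex_of_real k"
      unfolding k by (rule of_real_poly_hom.hom_mult)
    then have "poly (map_poly complex_of_real q) z = 0"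
      using kz by (metis mult_zero_right poly_mult)
    then show "z \<in> \<real>" by (rule Suc.prems)
  qed (use Suc.hyps deg k0 in auto)
  then show ?case unfolding deg unfolding k using k0 by (subst proots_mult) auto
qed

section \<open>Extreme singular values from the spectrum of the Gram matrix\<close>

lemma gram_quadratic_form:
  assumes "A \<in> carrier_mat m n" "v \<in> carrier_vec n"
  shows "v \<bullet> ((A\<^sup>T * A) *\<^sub>v v) = (vec_norm (A *\<^sub>v v))\<^sup>2"
proof -
  have "(A\<^sup>T * A) *\<^sub>v v = A\<^sup>T *\<^sub>v (A *\<^sub>v v)" using assms by (intro assoc_mult_mat_vec) auto
  then show ?thesis
    using scalar_prod_mult_transpose[OF assms, of "A *\<^sub>v v"] assms by (simp add: vec_norm_power2)
qed

lemma gram_symmetric: "A \<in> carrier_mat m n \<Longrightarrow> (A\<^sup>T * A)\<^sup>T = A\<^sup>T * (A :: real mat)"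
  by (simp add: transpose_mult[of _ n m _ n])

lemma eigenvector_mem_proots:
  fixes A :: "'a :: field mat"
  assumes "A \<in> carrier_mat n n" "eigenvector A v \<mu>"
  shows "\<mu> \<in># proots (char_poly A)"
proof -
  have "char_poly A \<noteq> 0" using degree_monic_char_poly[OF assms(1)] by auto
  moreover have "poly (char_poly A) \<mu> = 0"
    using assms eigenvalue_root_char_poly[OF assms(1)] by (auto simp: eigenvalue_def)
  ultimately show ?thesis by simp
qed

text \<open>This makes the list inside \<open>sing_val\<close> as long as the number of columns, so
  that the last singular value really is its smallest entry.\<close>

lemma size_proots_symmetric:
  fixes A :: "real mat"
  assumes "A \<in> carrier_mat n n" "A\<^sup>T = A"
  shows "size (proots (char_poly A)) = n"
proof -
  have "char_poly A \<noteq> 0" using degree_monic_char_poly[OF assms(1)] by auto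
  then have "size (proots (char_poly A)) = degree (char_poly A)"
    using symmetric_mat_complex_eigenvalue_real[OF assms] by (intro size_proots_real_rooted)
  then show ?thesis using degree_monic_char_poly[OF assms(1)] by simp
qed

lemma opnorm_le_sing_val:
  assumes A: "A \<in> carrier_mat m n" and n: "0 < n"
  shows "opnorm_le A (sing_val 1 A)"
proof (rule opnorm_leI[OF A])
  fix v :: "real vec" assume v: "v \<in> carrier_vec n"
  let ?G = "A\<^sup>T * A"
  define l where "l = sorted_list_of_multiset (proots (char_poly ?G))"
  have G: "?G \<in> carrier_mat n n" using A by auto
  obtain \<mu> u where \<mu>: "eigenvector ?G u \<mu>"
    and q: "\<And>x. x \<in> carrier_vec n \<Longrightarrow> x \<bullet> (?G *\<^sub>v x) \<le> \<mu> * (x \<bullet> x)"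
    using symmetric_mat_max_eigenvector[OF G gram_symmetric[OF A] n] by blast
  have "\<mu> \<in> set l" using eigenvector_mem_proots[OF G \<mu>] by (simp add: l_def)
  moreover have "sorted l" by (simp add: l_def)
  ultimately have "\<mu> \<le> rev l ! 0"
    by (cases l rule: rev_cases) (auto simp: sorted_append)
  then have "\<mu> * (v \<bullet> v) \<le> rev l ! 0 * (v \<bullet> v)" by (intro mult_right_mono) auto
  with q[OF v] have "(vec_norm (A *\<^sub>v v))\<^sup>2 \<le> rev l ! 0 * (v \<bullet> v)"
    using gram_quadratic_form[OF A v] by simp
  then have "vec_norm (A *\<^sub>v v) \<le> sqrt (rev l ! 0 * (v \<bullet> v))"
    by (rule real_le_rsqrt)
  then show "vec_norm (A *\<^sub>v v) \<le> sing_val 1 A * vec_norm v"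
    by (simp add: sing_val_def l_def vec_norm_def real_sqrt_mult)
qed

text \<open>The smallest eigenvalue bounds the form from below, and the head of the sorted root list
  is at most that eigenvalue. The head has index \<open>n - 1\<close> in the reversed list because
  the list has length \<open>n\<close>.\<close>

lemma sing_val_last_le:
  assumes A: "A \<in> carrier_mat m n" and n: "0 < n" and v: "v \<in> carrier_vec n"
  shows "sing_val n A * vec_norm v \<le> vec_norm (A *\<^sub>v v)"
proof -
  let ?G = "A\<^sup>T * A"
  define l where "l = sorted_list_of_multiset (proots (char_poly ?G))"
  have G: "?G \<in> carrier_mat n n" using A by auto
  obtain \<mu> u where \<mu>: "eigenvector ?G u \<mu>"
    and q: "\<And>x. x \<in> carrier_vec n \<Longrightarrow> \<mu> * (x \<bullet> x) \<le> x \<bullet> (?G *\<^sub>v x)"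
    using symmetric_mat_min_eigenvector[OF G gram_symmetric[OF A] n] by blast
  have "size (mset l) = n"
    unfolding l_def using size_proots_symmetric[OF G gram_symmetric[OF A]] by simp
  then have len: "length l = n" by simp
  have "\<mu> \<in> set l" using eigenvector_mem_proots[OF G \<mu>] by (simp add: l_def)
  moreover have "sorted l" by (simp add: l_def)
  ultimately have "l ! 0 \<le> \<mu>" by (cases l) auto
  moreover have "rev l ! (n - 1) = l ! 0" using len n by (simp add: rev_nth)
  ultimately have "rev l ! (n - 1) * (v \<bullet> v) \<le> \<mu> * (v \<bullet> v)" by (intro mult_right_mono) auto
  with q[OF v] have "rev l ! (n - 1) * (v \<bullet> v) \<le> (vec_norm (A *\<^sub>v v))\<^sup>2"
    using gram_quadratic_form[OF A v] by simp
  then have "sqrt (rev l ! (n - 1) * (v \<bullet> v)) \<le> vec_norm (A *\<^sub>v v)"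
    by (metis real_sqrt_le_iff real_sqrt_unique vec_norm_nonneg)
  then show ?thesis
    by (simp add: sing_val_def l_def vec_norm_def real_sqrt_mult)
qed

text \<open>The diagonal of \<open>D\<close> need not be ordered: the root list is its sorted
  rearrangement, so the two ends of the list bound every entry.\<close>

lemma sing_val_diagonal_gram:
  assumes A: "A \<in> carrier_mat m n" and n: "0 < n"
    and gram: "A\<^sup>T * A = D" and diag: "diagonal_mat D" and pos: "\<And>i. i < n \<Longrightarrow> 0 < D $$ (i, i)"
  shows "0 < sing_val n A" and "0 < sing_val 1 A"
    and "\<And>i. i < n \<Longrightarrow> (sing_val n A)\<^sup>2 \<le> D $$ (i, i)"
    and "\<And>i. i < n \<Longrightarrow> D $$ (i, i) \<le> (sing_val 1 A)\<^sup>2"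
proof -
  define l where "l = sorted_list_of_multiset (proots (char_poly D))"
  have D: "D \<in> carrier_mat n n" using A gram by auto
  have "upper_triangular D" using diag D by (auto simp: diagonal_mat_def)
  then have "char_poly D = (\<Prod>a\<leftarrow>diag_mat D. [:- a, 1:])" by (rule char_poly_upper_triangular[OF D])
  moreover have "proots (\<Prod>a\<leftarrow>xs. [:- a, 1:]) = mset xs" for xs :: "real list"
  proof (induction xs)
    case (Cons a xs)
    have "(\<Prod>a\<leftarrow>xs. [:- a, 1:]) \<noteq> 0" by (auto simp: prod_list_zero_iff)
    then show ?case using Cons by (simp add: proots_mult del: mult_pCons_left)
  qed simp
  ultimately have "mset l = mset (diag_mat D)" by (simp add: l_def)
  then have set: "set l = set (diag_mat D)" and len: "length l = n"
    using mset_eq_length[of l "diag_mat D"] mset_eq_setD[of l "diag_mat D"] D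
    by (simp_all add: diag_mat_def del: mset_map)
  have srt: "sorted l" by (simp add: l_def)
  have mem: "D $$ (i, i) \<in> set l" if "i < n" for i
    using that D by (auto simp: set diag_mat_def)
  have l_pos: "0 < x" if "x \<in> set l" for x
    using that D pos by (auto simp: set diag_mat_def)
  have last: "sing_val n A = sqrt (l ! 0)" and first: "sing_val 1 A = sqrt (l ! (n - 1))"
    using len n by (auto simp: sing_val_def gram l_def[symmetric] rev_nth)
  have p0: "0 < l ! 0" and p1: "0 < l ! (n - 1)" using len n by (auto intro!: l_pos)
  then show "0 < sing_val n A" "0 < sing_val 1 A" unfolding last first by simp_all
  fix i assume "i < n"
  then obtain k where k: "k < n" "l ! k = D $$ (i, i)"
    using mem len by (metis in_set_conv_nth)
  show "(sing_val n A)\<^sup>2 \<le> D $$ (i, i)"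
    using sorted_nth_mono[OF srt, of 0 k] k len p0 by (simp add: last)
  show "D $$ (i, i) \<le> (sing_val 1 A)\<^sup>2"
    using sorted_nth_mono[OF srt, of k "n - 1"] k len p1 unfolding first by simp
qed

section \<open>Parameters for which the subroutine returns its input\<close>

text \<open>Conditioning gives a probability measure only on a set of positive finite mass. The ball
  is squeezed between two cubes whose product measure is explicit; this covers every list
  \<open>B\<close> that \<open>SOME\<close> may return.\<close>

lemma emeasure_unif_hor_ball:
  assumes w: "0 < w"
  shows "emeasure (unif_hor_ball Y w) (space (unif_hor_ball Y w)) = 1"
proof -
  define B where "B = (SOME B. hor_onb Y B)"
  define I where "I = {..<length B}"
  define p r where "p = dim_row Y" and "r = dim_col Y"
  define M where "M = (\<Pi>\<^sub>M k \<in> I. (lborel :: real measure))"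
  define D where "D = {c \<in> I \<rightarrow>\<^sub>E (UNIV :: real set). (\<Sum>k\<in>I. (c k)\<^sup>2) \<le> w\<^sup>2}"
  have fin: "finite I" by (simp add: I_def)
  interpret product_sigma_finite "\<lambda>_ :: nat. lborel :: real measure"
    by (simp add: product_sigma_finite_def lborel.sigma_finite_measure_axioms)
  have sp: "space M = I \<rightarrow>\<^sub>E UNIV" by (simp add: M_def space_PiM)
  have box: "emeasure M (Pi\<^sub>E I (\<lambda>_. {- c..c})) = ennreal (2 * c) ^ card I" if "0 \<le> c" for c
    unfolding M_def using that fin by (subst emeasure_PiM) auto
  have "(\<lambda>c. \<Sum>k\<in>I. (c k)\<^sup>2) \<in> borel_measurable M" unfolding M_def by measurable
  then have "{c \<in> space M. (\<Sum>k\<in>I. (c k)\<^sup>2) \<le> w\<^sup>2} \<in> sets M" by measurable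
  then have D: "D \<in> sets M" by (simp add: D_def sp)
  have "D \<subseteq> Pi\<^sub>E I (\<lambda>_. {- w..w})"
  proof
    fix c assume c: "c \<in> D"
    have "\<bar>c k\<bar> \<le> w" if "k \<in> I" for k
    proof -
      have "(c k)\<^sup>2 \<le> (\<Sum>k\<in>I. (c k)\<^sup>2)" using that fin by (intro member_le_sum) auto
      then have "(c k)\<^sup>2 \<le> w\<^sup>2" using c by (simp add: D_def)
      then show ?thesis using w by (simp add: power2_le_iff_abs_le)
    qed
    then show "c \<in> Pi\<^sub>E I (\<lambda>_. {- w..w})" using c by (force simp: D_def PiE_iff abs_le_iff)
  qed
  then have "emeasure M D \<le> emeasure M (Pi\<^sub>E I (\<lambda>_. {- w..w}))"
    unfolding M_def using fin by (intro emeasure_mono sets_PiM_I_finite) auto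
  also have "\<dots> < \<infinity>" using w box[of w] by (simp add: ennreal_power)
  finally have finite_D: "emeasure M D \<noteq> \<infinity>" by simp
  \<comment> \<open>Half the side of an inscribed cube; the added 1 keeps it positive when the index
    set is empty.\<close>
  define d where "d = w / sqrt (real (card I + 1))"
  have d: "0 < d" using w by (simp add: d_def)
  have "Pi\<^sub>E I (\<lambda>_. {- d..d}) \<subseteq> D"
  proof
    fix c assume c: "c \<in> Pi\<^sub>E I (\<lambda>_. {- d..d})"
    have "(c k)\<^sup>2 \<le> d\<^sup>2" if "k \<in> I" for k
    proof -
      have "\<bar>c k\<bar> \<le> d" using PiE_mem[OF c that] by auto
      then show ?thesis using d by (simp add: power2_le_iff_abs_le)
    qed
    then have "(\<Sum>k\<in>I. (c k)\<^sup>2) \<le> real (card I) * d\<^sup>2"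
      using sum_bounded_above[of I "\<lambda>k. (c k)\<^sup>2" "d\<^sup>2"] by simp
    also have "\<dots> \<le> w\<^sup>2" by (simp add: d_def power_divide divide_le_eq field_simps)
    finally show "c \<in> D" using c by (auto simp: D_def PiE_iff)
  qed
  then have "emeasure M (Pi\<^sub>E I (\<lambda>_. {- d..d})) \<le> emeasure M D"
    using D by (intro emeasure_mono) auto
  moreover have "0 < emeasure M (Pi\<^sub>E I (\<lambda>_. {- d..d}))"
    using d box[of d] by (simp add: ennreal_power)
  ultimately have pos_D: "emeasure M D \<noteq> 0" by auto
  interpret U: prob_space "uniform_measure M D"
    using pos_D finite_D by (rule prob_space_uniform_measure)
  have coord: "(\<lambda>c. \<lambda>ij \<in> {..<p} \<times> {..<r}. lin_comb p r B c $$ ij)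
      \<in> measurable M (\<Pi>\<^sub>M ij \<in> {..<p} \<times> {..<r}. borel)"
  proof (rule measurable_restrict)
    fix ij assume "ij \<in> {..<p} \<times> {..<r}"
    then have "(\<lambda>c. lin_comb p r B c $$ ij) = (\<lambda>c. \<Sum>k\<in>I. c k * (B ! k) $$ ij)"
      by (auto simp: lin_comb_def I_def)
    also have "\<dots> \<in> borel_measurable M" unfolding M_def by measurable
    finally show "(\<lambda>c. lin_comb p r B c $$ ij) \<in> borel_measurable M" .
  qed
  have "lin_comb p r B \<in> measurable M (mat_borel p r)"
    unfolding mat_borel_def
    by (rule measurable_vimage_algebra2) (auto simp: lin_comb_def intro: coord[unfolded lin_comb_def])
  then have "lin_comb p r B \<in> measurable (uniform_measure M D) (mat_borel p r)"
    by (simp cong: measurable_cong_sets)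
  then have "prob_space (distr (uniform_measure M D) (mat_borel p r) (lin_comb p r B))"
    by (rule U.prob_space_distr)
  moreover have "unif_hor_ball Y w = distr (uniform_measure M D) (mat_borel p r) (lin_comb p r B)"
    by (simp add: unif_hor_ball_def Let_def B_def I_def p_def r_def M_def D_def)
  ultimately show ?thesis by (metis prob_space.emeasure_space_1)
qed

lemma objective_nonneg [simp]: "0 \<le> objective X Y"
  by (simp add: objective_def)

text \<open>If the thresholds exceed the gradient norm and the objective at the input, the loop perturbs
  at once and, as the objective is nonnegative, returns the input after the waiting time.\<close>

lemma prgd_prob_returns_input:
  assumes t: "t_thres P X Y = 1" and f: "objective X Y < f_thres P X Y"
    and g: "0 < g_thres P X Y" "frob_norm (rgrad X Y) \<le> g_thres P X Y"
    and Q: "Q Y 3"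
  shows "1 \<le> prgd_prob P X Y Q"
proof -
  define s where "s = count_call (prgd_init P X Y)"
  have cur: "st_cur s = Y" by (simp add: s_def count_call_def prgd_init_def)
  \<comment> \<open>Initially \<open>st_noise\<close> is -2, so the elapsed time 2 exceeds the
    waiting time 1.\<close>
  have perturb: "perturb_now P X Y s"
    using g by (simp add: perturb_now_def s_def count_call_def prgd_init_def)
  have cont: "(if stop_now P X Y (perturb s \<xi>)
      then (if Q (st_saved (perturb s \<xi>)) (st_calls (perturb s \<xi>)) then 1 else 0)
      else prgd_prob_within P X Y Q 1 (descend P X (count_call (perturb s \<xi>)))) = 1" for \<xi>
  proof -
    define s' where "s' = count_call (descend P X (count_call (perturb s \<xi>)))"
    \<comment> \<open>The three calls are those of (a) and (c) in the first pass and of (a) in the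
      second, which stops in (b) at time 1.\<close>
    have s': "st_time s' = 1" "st_noise s' = 0" "st_saved s' = Y" "st_calls s' = 3"
      by (simp_all add: s'_def s_def count_call_def descend_def perturb_def prgd_init_def)
    have "\<not> stop_now P X Y (perturb s \<xi>)"
      using t by (simp add: stop_now_def perturb_def)
    moreover have "\<not> perturb_now P X Y s'" using t s' by (simp add: perturb_now_def)
    moreover have "- f_thres P X Y < objective X (st_cur s') - objective X Y"
      using f objective_nonneg[of X "st_cur s'"] by linarith
    then have "stop_now P X Y s'" using t s' by (simp add: stop_now_def)
    ultimately show ?thesis using Q s' by (simp add: s'_def Let_def One_nat_def)
  qed
  have "prgd_prob_within P X Y Q (Suc 1) (prgd_init P X Y)
      = (\<integral>\<^sup>+ \<xi>. 1 \<partial>unif_hor_ball Y (g_thres P X Y))"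
    by (subst prgd_prob_within.simps(2))
      (simp only: Let_def s_def[symmetric] perturb if_True cont cur)
  also have "\<dots> = 1" using emeasure_unif_hor_ball[OF g(1)] by simp
  finally show ?thesis unfolding prgd_prob_def by (intro SUP_upper2[of "Suc 1"]) auto
qed

text \<open>\<open>chi\<close> depends on \<open>L\<close> and \<open>acc\<close>, while waiting
  time 1 forces \<open>L\<close> to be proportional to sqrt(acc). There is no circularity: the
  argument of the logarithm then decays like acc^(-3/2), so for large \<open>acc\<close> the value
  of \<open>chi\<close> sits at its floor 3 * 4 = 12, and both thresholds grow with
  \<open>acc\<close>.\<close>

lemma prgd_parameters_exist:
  assumes dims: "Y \<in> carrier_mat p r" "0 < r" "r \<le> p"
    and pos: "0 < chat" "0 < cmax" "0 < \<zeta>"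
  obtains L \<rho> acc :: real where "0 < L" "0 < \<rho>" "0 < acc"
    and "\<And>P. P = \<lparr>par_chat = chat, par_cmax = cmax, par_L = L, par_rho = \<rho>, par_K = K,
           par_inj = inj_rad, par_acc = acc, par_fail = \<zeta>\<rparr> \<Longrightarrow>
         t_thres P X Y = 1 \<and> objective X Y < f_thres P X Y \<and>
         0 < g_thres P X Y \<and> frob_norm (rgrad X Y) \<le> g_thres P X Y"
proof -
  define H G h where "H = objective X Y" and "G = frob_norm (rgrad X Y)" and "h = hor_dim p r"
  have H: "0 \<le> H" and G: "0 \<le> G" by (simp_all add: H_def G_def)
  have h: "0 \<le> h"
  proof -
    have arith: "0 \<le> x * y - (y\<^sup>2 - y) / 2" if "0 \<le> y" "y \<le> x" for x y :: real
    proof -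
      have "y\<^sup>2 \<le> x * y" using mult_right_mono[OF that(2,1)] by (simp add: power2_eq_square)
      moreover have "(y\<^sup>2 - y) / 2 \<le> y\<^sup>2" using that zero_le_power2[of y] by (simp add: field_simps)
      ultimately show ?thesis by simp
    qed
    show ?thesis unfolding h_def hor_dim_def using dims by (intro arith) auto
  qed
  define q where "q = h * cmax * H / (12 * chat * \<zeta>)"
  have q: "0 \<le> q" using h H pos by (simp add: q_def)
  \<comment> \<open>144 = 12^2 and 1728 = 12^3 come from \<open>chi = 12\<close>. The summands
    serve, in order, sqrt(acc) \<le> acc, the gradient threshold, the strict objective threshold and
    the logarithm.\<close>
  define acc where "acc = 1 + 144 * G / sqrt cmax + 1728 * (H + 1) / cmax + q"
  have acc_ge: "1 \<le> acc" "144 * G / sqrt cmax \<le> acc" "1728 * (H + 1) / cmax \<le> acc" "q \<le> acc"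
    using G H pos q by (simp_all add: acc_def)
  then have acc: "0 < acc" by linarith
  have sqrt_acc: "1 \<le> sqrt acc" using acc_ge(1) by simp
  define L where "L = cmax * sqrt acc / 12"
  have L: "0 < L" using pos acc by (simp add: L_def)
  show ?thesis
  proof (rule that[of L 1 acc])
    fix P :: prgd_params
    assume P: "P = \<lparr>par_chat = chat, par_cmax = cmax, par_L = L, par_rho = 1, par_K = K,
           par_inj = inj_rad, par_acc = acc, par_fail = \<zeta>\<rparr>"
    then have sel: "par_chat P = chat" "par_cmax P = cmax" "par_L P = L" "par_rho P = 1"
      "par_acc P = acc" "par_fail P = \<zeta>" by simp_all
    define a where "a = h * L * H / (chat * acc\<^sup>2 * \<zeta>)"
    have "a = q * sqrt acc / acc\<^sup>2" using pos by (simp add: a_def q_def L_def field_simps)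
    also have "\<dots> \<le> acc * acc / acc\<^sup>2"
    proof (intro divide_right_mono mult_mono acc_ge)
      show "sqrt acc \<le> acc" using acc_ge(1) by (intro real_le_lsqrt) (auto simp: power2_eq_square)
    qed (use acc in auto)
    also have "\<dots> = 1" using acc by (simp add: power2_eq_square)
    finally have "a \<le> 1" .
    moreover have "0 \<le> a" using h L H pos by (simp add: a_def)
    \<comment> \<open>\<open>a = 0\<close> occurs when the objective vanishes; then
      \<open>ln 0 = 0\<close>.\<close>
    ultimately have "ln a \<le> 0" by (cases "a = 0") auto
    then have "max (ln a) 4 = 4" by simp
    moreover have "chi P X Y = 3 * max (ln a) 4"
      using dims by (simp add: chi_def sel a_def h_def H_def)
    ultimately have chi: "chi P X Y = 12" by simp
    have "t_thres P X Y = 1"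
      using pos acc by (simp add: t_thres_def chi sel L_def)
    moreover have gt: "g_thres P X Y = sqrt cmax / 144 * acc"
      by (simp add: g_thres_def chi sel)
    have "G \<le> sqrt cmax / 144 * acc"
      using acc_ge(2) pos by (simp add: divide_le_eq mult_ac)
    moreover have "H < f_thres P X Y"
    proof -
      have "H + 1 \<le> cmax / 1728 * acc" using acc_ge(3) pos by (simp add: divide_le_eq mult_ac)
      also have "acc \<le> sqrt (acc ^ 3)"
        using acc_ge(1) acc by (intro real_le_rsqrt power_increasing) auto
      then have "cmax / 1728 * acc \<le> cmax / 1728 * sqrt (acc ^ 3)"
        using pos by (intro mult_left_mono) auto
      finally show ?thesis by (simp add: f_thres_def chi sel)
    qed
    moreover have "0 < sqrt cmax / 144 * acc" using pos acc by simp
    ultimately show "t_thres P X Y = 1 \<and> objective X Y < f_thres P X Y \<and>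
         0 < g_thres P X Y \<and> frob_norm (rgrad X Y) \<le> g_thres P X Y"
      unfolding gt by (simp add: H_def G_def)
  qed (use L acc in auto)
qed

text \<open>The parameters are fitted to the iterate \<open>Z\<close> that enters the subroutine;
  \<open>T1\<close> and \<open>Q\<close> can still be chosen afterwards.\<close>

lemma algorithm_prob_ge_1:
  assumes Y: "(gd_step X \<eta> ^^ T0) Y = Z" "Z \<in> carrier_mat p r"
    and dims: "0 < r" "r \<le> p" and pos: "0 < chat" "0 < cmax" "0 < \<zeta>"
  obtains L \<rho> acc :: real where "0 < L" "0 < \<rho>" "0 < acc"
    and "\<And>T1 Q. Q ((gd_step X \<eta> ^^ T1) Z) (T0 + 3 + T1) \<Longrightarrow>
      1 \<le> algorithm_prob \<lparr>par_chat = chat, par_cmax = cmax, par_L = L, par_rho = \<rho>, par_K = K,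
           par_inj = inj_rad, par_acc = acc, par_fail = \<zeta>\<rparr> X T0 T1 \<eta> Y Q"
proof -
  obtain L \<rho> acc where *: "0 < L" "0 < \<rho>" "0 < acc"
    and thres: "\<And>P. P = \<lparr>par_chat = chat, par_cmax = cmax, par_L = L, par_rho = \<rho>, par_K = K,
           par_inj = inj_rad, par_acc = acc, par_fail = \<zeta>\<rparr> \<Longrightarrow>
         t_thres P X Z = 1 \<and> objective X Z < f_thres P X Z \<and>
         0 < g_thres P X Z \<and> frob_norm (rgrad X Z) \<le> g_thres P X Z"
    using prgd_parameters_exist[OF Y(2) dims pos, where X = X and K = K and inj_rad = inj_rad]
    by blast
  show ?thesis
    by (rule that[OF *])
      (use thres[OF refl] Y(1) in \<open>auto simp: algorithm_prob_def intro!: prgd_prob_returns_input\<close>)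
qed

section \<open>Gradient descent in the coordinates of the target\<close>

lemma vec_norm_add_le:
  "v \<in> carrier_vec n \<Longrightarrow> w \<in> carrier_vec n \<Longrightarrow> vec_norm v \<le> x \<Longrightarrow> vec_norm w \<le> y \<Longrightarrow>
   vec_norm (v + w) \<le> x + y"
  using vec_norm_triangle[of v n w] by linarith

lemma vec_norm_diff_le:
  "v \<in> carrier_vec n \<Longrightarrow> w \<in> carrier_vec n \<Longrightarrow> vec_norm v \<le> x \<Longrightarrow> vec_norm w \<le> y \<Longrightarrow>
   vec_norm (v - w) \<le> x + y"
  using vec_norm_triangle_minus[of v n w] by linarith

lemma vec_norm_smult_le: "0 \<le> c \<Longrightarrow> vec_norm v \<le> x \<Longrightarrow> vec_norm (c \<cdot>\<^sub>v v) \<le> c * x"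
  by (simp add: vec_norm_smult mult_left_mono)

lemma opnorm_le_apply:
  assumes "opnorm_le A c" "A \<in> carrier_mat m n" "v \<in> carrier_vec n" "vec_norm v \<le> x" "0 \<le> c"
  shows "vec_norm (A *\<^sub>v v) \<le> c * x"
  using opnorm_leD[OF assms(1-3)] mult_left_mono[OF assms(4,5)] by linarith

text \<open>In the application \<open>a\<close> and \<open>b\<close> are the squared extreme
  singular values of \<open>Ystar\<close>. \<open>S\<close> enters only through its symmetry and
  these two bounds. The stepsize is made so that
  \<open>\<eta> * b\<^sup>2 = a / 2000\<close>.\<close>

locale gradient_descent =
  fixes p r :: nat and U S :: "real mat" and a b \<eta> :: real
  assumes U: "U \<in> carrier_mat p r" and UTU: "U\<^sup>T * U = 1\<^sub>m r"
    and S: "S \<in> carrier_mat r r" and S_sym: "S\<^sup>T = S"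
    and S_le: "opnorm_le S b"
    and S_ge: "\<And>x. x \<in> carrier_vec r \<Longrightarrow> a * (vec_norm x)\<^sup>2 \<le> x \<bullet> (S *\<^sub>v x)"
    and a: "0 < a" and ab: "a \<le> b" and \<eta>: "\<eta> = a / (2000 * b\<^sup>2)"
begin

lemma b: "0 < b" using a ab by simp

lemma eta_pos: "0 < \<eta>" using a b by (simp add: \<eta>)

lemma eta_b2: "\<eta> * b\<^sup>2 = a / 2000" using b by (simp add: \<eta>)

lemma eta_b: "\<eta> * b \<le> 1 / 2000"
proof -
  have "\<eta> * b = a / b / 2000" using b by (simp add: \<eta> power2_eq_square)
  then show ?thesis using ab b by simp
qed

lemma eta_a: "\<eta> * a \<le> 1 / 2000"
  using eta_b mult_left_mono[OF ab, of \<eta>] eta_pos by linarith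

definition X where "X = U * S * U\<^sup>T"

definition core :: "real mat \<Rightarrow> real mat" where "core Y = U\<^sup>T * Y"

text \<open>The part of \<open>Y\<close> orthogonal to the columns of \<open>U\<close>. Kept as a
  \<open>p\<close> by \<open>r\<close> matrix, it removes the complement basis from the dynamics;
  \<open>rest_norm_le\<close> relates it to \<open>J0\<close>.\<close>

definition rest :: "real mat \<Rightarrow> real mat" where "rest Y = Y - U * (U\<^sup>T * Y)"

definition gap :: "real mat \<Rightarrow> real mat" where "gap Y = S - core Y * (core Y)\<^sup>T"

lemma X: "X \<in> carrier_mat p p" using U S by (auto simp: X_def)

lemma carriers [simp]:
  assumes "Y \<in> carrier_mat p r"
  shows "core Y \<in> carrier_mat r r" "rest Y \<in> carrier_mat p r" "gap Y \<in> carrier_mat r r"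
    "gd_step X e Y \<in> carrier_mat p r"
  using assms U S X by (auto simp: core_def rest_def gap_def gd_step_def)

text \<open>Instances for the four shapes in play, so that rewriting leaves no dimension
  undetermined.\<close>

lemmas mv_minus = mult_minus_distrib_mat_vec[of _ p r] mult_minus_distrib_mat_vec[of _ r p]
  mult_minus_distrib_mat_vec[of _ r r] mult_minus_distrib_mat_vec[of _ p p]
lemmas mv_add = mult_add_distrib_mat_vec[of _ p r] mult_add_distrib_mat_vec[of _ r p]
  mult_add_distrib_mat_vec[of _ r r] mult_add_distrib_mat_vec[of _ p p]
lemmas mv_smult = mult_mat_smult_vec[of _ p r] mult_mat_smult_vec[of _ r p]
  mult_mat_smult_vec[of _ r r] mult_mat_smult_vec[of _ p p]
lemmas mv_distrib = mv_minus mv_add mv_smult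

lemma mv_carrier [simp]:
  fixes A :: "real mat"
  shows "A \<in> carrier_mat p r \<Longrightarrow> A *\<^sub>v v \<in> carrier_vec p"
    and "A \<in> carrier_mat r r \<Longrightarrow> A *\<^sub>v v \<in> carrier_vec r"
    and "A \<in> carrier_mat r p \<Longrightarrow> A *\<^sub>v v \<in> carrier_vec r"
  by (simp_all add: carrier_vecI)

section \<open>One gradient step in the coordinates K and J, as identities of matrix-vector
  products\<close>

lemma UT_U [simp]: "x \<in> carrier_vec r \<Longrightarrow> U\<^sup>T *\<^sub>v (U *\<^sub>v x) = x"
  using U UTU by (metis assoc_mult_mat_vec one_mult_mat_vec transpose_carrier_mat)

lemma core_vec: "Y \<in> carrier_mat p r \<Longrightarrow> v \<in> carrier_vec r \<Longrightarrow> core Y *\<^sub>v v = U\<^sup>T *\<^sub>v (Y *\<^sub>v v)"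
  unfolding core_def using U by (intro assoc_mult_mat_vec[of _ r p]) auto

lemma core_transpose_vec:
  assumes "Y \<in> carrier_mat p r" "x \<in> carrier_vec r"
  shows "(core Y)\<^sup>T *\<^sub>v x = Y\<^sup>T *\<^sub>v (U *\<^sub>v x)"
proof -
  have "(core Y)\<^sup>T = Y\<^sup>T * U"
    unfolding core_def using U assms by (subst transpose_mult[of _ r p _ r]) auto
  then show ?thesis using U assms by (simp add: assoc_mult_mat_vec[of _ r p])
qed

lemma rest_vec:
  assumes "Y \<in> carrier_mat p r" "v \<in> carrier_vec r"
  shows "rest Y *\<^sub>v v = Y *\<^sub>v v - U *\<^sub>v (core Y *\<^sub>v v)"
  unfolding rest_def core_def[symmetric] using U assms
  by (subst minus_mult_distrib_mat_vec[of _ p r])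
    (auto simp: assoc_mult_mat_vec[of _ p r _ r] simp del: index_mult_mat_vec)

lemma gap_vec:
  assumes "Y \<in> carrier_mat p r" "x \<in> carrier_vec r"
  shows "gap Y *\<^sub>v x = S *\<^sub>v x - core Y *\<^sub>v ((core Y)\<^sup>T *\<^sub>v x)"
  unfolding gap_def using assms S carriers(1)[OF assms(1)]
  by (subst minus_mult_distrib_mat_vec[of _ r r])
    (auto simp: assoc_mult_mat_vec[of _ r r _ r] intro!: mult_carrier_mat[of _ r r])

lemma X_vec: "v \<in> carrier_vec p \<Longrightarrow> X *\<^sub>v v = U *\<^sub>v (S *\<^sub>v (U\<^sup>T *\<^sub>v v))"
  unfolding X_def using U S
  by (simp add: assoc_mult_mat_vec[of _ p r _ p] assoc_mult_mat_vec[of _ p r _ r])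

lemma gd_step_vec:
  assumes Y: "Y \<in> carrier_mat p r" and v: "v \<in> carrier_vec r"
  shows "gd_step X \<eta> Y *\<^sub>v v =
    Y *\<^sub>v v - \<eta> \<cdot>\<^sub>v (Y *\<^sub>v (Y\<^sup>T *\<^sub>v (Y *\<^sub>v v)) - X *\<^sub>v (Y *\<^sub>v v))"
proof -
  let ?G = "Y * Y\<^sup>T - X"
  have G: "?G \<in> carrier_mat p p" using X by auto
  have Yv: "Y *\<^sub>v v \<in> carrier_vec p" using Y v by auto
  have "gd_step X \<eta> Y *\<^sub>v v = Y *\<^sub>v v - (\<eta> \<cdot>\<^sub>m (?G * Y)) *\<^sub>v v"
    unfolding gd_step_def using Y G v by (intro minus_mult_distrib_mat_vec[of _ p r]) auto
  also have "(\<eta> \<cdot>\<^sub>m (?G * Y)) *\<^sub>v v = \<eta> \<cdot>\<^sub>v ((?G * Y) *\<^sub>v v)"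
    using Y G v by (intro smult_mat_mult_vec[of _ p r]) auto
  also have "(?G * Y) *\<^sub>v v = ?G *\<^sub>v (Y *\<^sub>v v)"
    using Y G v by (intro assoc_mult_mat_vec[of _ p p]) auto
  also have "\<dots> = (Y * Y\<^sup>T) *\<^sub>v (Y *\<^sub>v v) - X *\<^sub>v (Y *\<^sub>v v)"
    using Y X Yv by (intro minus_mult_distrib_mat_vec[of _ p p]) auto
  also have "(Y * Y\<^sup>T) *\<^sub>v (Y *\<^sub>v v) = Y *\<^sub>v (Y\<^sup>T *\<^sub>v (Y *\<^sub>v v))"
    using Y Yv by (intro assoc_mult_mat_vec[of _ p r _ p]) auto
  finally show ?thesis .
qed

lemma X_sym: "X\<^sup>T = X"
proof -
  have "X\<^sup>T = U * (U * S)\<^sup>T" unfolding X_def using U S by (subst transpose_mult[of _ p r _ p]) auto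
  also have "(U * S)\<^sup>T = S * U\<^sup>T" using U S S_sym by (subst transpose_mult[of _ p r _ r]) auto
  finally show ?thesis using U S by (simp add: X_def assoc_mult_mat[of _ p r _ r _ p])
qed

lemma gd_step_transpose_vec:
  assumes Y: "Y \<in> carrier_mat p r" and z: "z \<in> carrier_vec p"
  shows "(gd_step X \<eta> Y)\<^sup>T *\<^sub>v z =
    Y\<^sup>T *\<^sub>v z - \<eta> \<cdot>\<^sub>v (Y\<^sup>T *\<^sub>v (Y *\<^sub>v (Y\<^sup>T *\<^sub>v z)) - Y\<^sup>T *\<^sub>v (X *\<^sub>v z))"
proof -
  let ?G = "Y * Y\<^sup>T - X"
  have G: "?G \<in> carrier_mat p p" using X by auto
  have GT: "?G\<^sup>T = ?G"
    using Y X X_sym by (simp add: transpose_minus[of _ p p] transpose_mult[of _ p r _ p])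
  have YT: "Y\<^sup>T \<in> carrier_mat r p" using Y by simp
  have "(gd_step X \<eta> Y)\<^sup>T = Y\<^sup>T - (\<eta> \<cdot>\<^sub>m (?G * Y))\<^sup>T"
    unfolding gd_step_def using Y G by (intro transpose_minus[of _ p r]) auto
  also have "(\<eta> \<cdot>\<^sub>m (?G * Y))\<^sup>T = \<eta> \<cdot>\<^sub>m (?G * Y)\<^sup>T" by (intro eq_matI) auto
  also have "(?G * Y)\<^sup>T = Y\<^sup>T * ?G"
    using transpose_mult[OF G Y] GT by simp
  finally have "(gd_step X \<eta> Y)\<^sup>T *\<^sub>v z = (Y\<^sup>T - \<eta> \<cdot>\<^sub>m (Y\<^sup>T * ?G)) *\<^sub>v z" by simp
  also have "\<dots> = Y\<^sup>T *\<^sub>v z - (\<eta> \<cdot>\<^sub>m (Y\<^sup>T * ?G)) *\<^sub>v z"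
    using YT G z by (intro minus_mult_distrib_mat_vec[of _ r p]) auto
  also have "(\<eta> \<cdot>\<^sub>m (Y\<^sup>T * ?G)) *\<^sub>v z = \<eta> \<cdot>\<^sub>v ((Y\<^sup>T * ?G) *\<^sub>v z)"
    using YT G z by (intro smult_mat_mult_vec[of _ r p]) auto
  also have "(Y\<^sup>T * ?G) *\<^sub>v z = Y\<^sup>T *\<^sub>v (?G *\<^sub>v z)"
    using YT G z by (intro assoc_mult_mat_vec[of _ r p]) auto
  also have "?G *\<^sub>v z = (Y * Y\<^sup>T) *\<^sub>v z - X *\<^sub>v z"
    using Y X z by (intro minus_mult_distrib_mat_vec[of _ p p]) auto
  also have "(Y * Y\<^sup>T) *\<^sub>v z = Y *\<^sub>v (Y\<^sup>T *\<^sub>v z)"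
    using Y z by (intro assoc_mult_mat_vec[of _ p r _ p]) auto
  also have "Y\<^sup>T *\<^sub>v (Y *\<^sub>v (Y\<^sup>T *\<^sub>v z) - X *\<^sub>v z)
      = Y\<^sup>T *\<^sub>v (Y *\<^sub>v (Y\<^sup>T *\<^sub>v z)) - Y\<^sup>T *\<^sub>v (X *\<^sub>v z)"
    using YT Y X z by (intro mv_minus) auto
  finally show ?thesis .
qed

lemma opnorm_U: "opnorm_le U 1"
proof (rule opnorm_leI[OF U])
  fix v :: "real vec" assume v: "v \<in> carrier_vec r"
  have "(vec_norm (U *\<^sub>v v))\<^sup>2 = v \<bullet> (U\<^sup>T *\<^sub>v (U *\<^sub>v v))"
    using scalar_prod_mult_transpose[OF U v, of "U *\<^sub>v v"] U v by (simp add: vec_norm_power2)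
  also have "\<dots> = (vec_norm v)\<^sup>2" using v by (simp add: vec_norm_power2)
  finally show "vec_norm (U *\<^sub>v v) \<le> 1 * vec_norm v" by simp
qed

lemma opnorm_UT: "opnorm_le U\<^sup>T 1"
  using opnorm_le_transpose[OF opnorm_U _ U] by simp

lemma opnorm_X: "opnorm_le X b"
proof -
  have US: "U * S \<in> carrier_mat p r" and UT: "U\<^sup>T \<in> carrier_mat r p" using U S by auto
  have "opnorm_le (U * S) (1 * b)" using opnorm_le_mult[OF opnorm_U S_le _ U S] by simp
  then have "opnorm_le (U * S * U\<^sup>T) (1 * b * 1)" using b by (intro opnorm_le_mult[OF _ opnorm_UT _ US UT]) auto
  then show ?thesis by (simp add: X_def)
qed

lemma opnorm_core: "Y \<in> carrier_mat p r \<Longrightarrow> opnorm_le Y c \<Longrightarrow> opnorm_le (core Y) c"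
  using opnorm_le_mult[OF opnorm_UT, of Y c r p r] U by (simp add: core_def)

lemma UT_rest: "Y \<in> carrier_mat p r \<Longrightarrow> v \<in> carrier_vec r \<Longrightarrow> U\<^sup>T *\<^sub>v (rest Y *\<^sub>v v) = 0\<^sub>v r"
  using U by (simp add: rest_vec mv_minus core_vec)

text \<open>The columns of \<open>U * core Y\<close> and of \<open>rest Y\<close> are orthogonal by
  \<open>UT_rest\<close>, so the mixed terms of the Gram matrix vanish.\<close>

lemma gram_split:
  assumes Y: "Y \<in> carrier_mat p r" and v: "v \<in> carrier_vec r"
  shows "Y\<^sup>T *\<^sub>v (Y *\<^sub>v v) = (core Y)\<^sup>T *\<^sub>v (core Y *\<^sub>v v) + (rest Y)\<^sup>T *\<^sub>v (rest Y *\<^sub>v v)"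
proof -
  have RT: "(rest Y)\<^sup>T = Y\<^sup>T - (core Y)\<^sup>T * U\<^sup>T"
    unfolding rest_def core_def[symmetric] using Y U carriers(1)[OF Y]
    by (subst transpose_minus[of _ p r]) (auto simp: transpose_mult[of _ p r _ r] intro!: mult_carrier_mat[of _ p r])
  let ?w = "rest Y *\<^sub>v v"
  have w: "?w \<in> carrier_vec p" using Y v carriers(2)[OF Y] by auto
  have "(rest Y)\<^sup>T *\<^sub>v ?w = Y\<^sup>T *\<^sub>v ?w - ((core Y)\<^sup>T * U\<^sup>T) *\<^sub>v ?w"
    unfolding RT using Y U w carriers(1)[OF Y]
    by (intro minus_mult_distrib_mat_vec[of _ r p] mult_carrier_mat[of _ r r]) auto
  also have "((core Y)\<^sup>T * U\<^sup>T) *\<^sub>v ?w = (core Y)\<^sup>T *\<^sub>v (U\<^sup>T *\<^sub>v ?w)"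
    using Y U w carriers(1)[OF Y] by (intro assoc_mult_mat_vec[of _ r r _ p]) auto
  also have "\<dots> = 0\<^sub>v r" using UT_rest[OF Y v] carriers(1)[OF Y] by auto
  also have "Y\<^sup>T *\<^sub>v ?w = Y\<^sup>T *\<^sub>v (Y *\<^sub>v v) - Y\<^sup>T *\<^sub>v (U *\<^sub>v (core Y *\<^sub>v v))"
    unfolding rest_vec[OF Y v] using Y U v carriers(1)[OF Y] by (intro mv_minus) auto
  also have "Y\<^sup>T *\<^sub>v (U *\<^sub>v (core Y *\<^sub>v v)) = (core Y)\<^sup>T *\<^sub>v (core Y *\<^sub>v v)"
    using Y v carriers(1)[OF Y] by (subst core_transpose_vec) auto
  finally have "(rest Y)\<^sup>T *\<^sub>v ?w = Y\<^sup>T *\<^sub>v (Y *\<^sub>v v) - (core Y)\<^sup>T *\<^sub>v (core Y *\<^sub>v v) - 0\<^sub>v r" .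
  moreover have "(core Y)\<^sup>T *\<^sub>v (core Y *\<^sub>v v) \<in> carrier_vec r" "Y\<^sup>T *\<^sub>v (Y *\<^sub>v v) \<in> carrier_vec r"
    using Y carriers(1)[OF Y] by auto
  moreover have "x = y + w" if "w = x - y - 0\<^sub>v r" "y \<in> carrier_vec r" "x \<in> carrier_vec r"
    for x y w :: "real vec"
    using that by (intro eq_vecI) auto
  ultimately show ?thesis by blast
qed

lemma core_step_vec:
  assumes Y: "Y \<in> carrier_mat p r" and v: "v \<in> carrier_vec r"
  shows "core (gd_step X \<eta> Y) *\<^sub>v v = core Y *\<^sub>v v - \<eta> \<cdot>\<^sub>v
    (core Y *\<^sub>v ((core Y)\<^sup>T *\<^sub>v (core Y *\<^sub>v v)) + core Y *\<^sub>v ((rest Y)\<^sup>T *\<^sub>v (rest Y *\<^sub>v v))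
      - S *\<^sub>v (core Y *\<^sub>v v))"
proof -
  have N: "Y\<^sup>T *\<^sub>v (Y *\<^sub>v v) \<in> carrier_vec r" using Y by auto
  have "core (gd_step X \<eta> Y) *\<^sub>v v = U\<^sup>T *\<^sub>v (gd_step X \<eta> Y *\<^sub>v v)"
    using Y v by (intro core_vec) auto
  also have "\<dots> = U\<^sup>T *\<^sub>v (Y *\<^sub>v v) - \<eta> \<cdot>\<^sub>v
      (U\<^sup>T *\<^sub>v (Y *\<^sub>v (Y\<^sup>T *\<^sub>v (Y *\<^sub>v v))) - S *\<^sub>v (U\<^sup>T *\<^sub>v (Y *\<^sub>v v)))"
    unfolding gd_step_vec[OF Y v] using Y v U S N
    by (simp add: mv_distrib X_vec del: index_mult_mat_vec)
  also have "\<dots> = core Y *\<^sub>v v - \<eta> \<cdot>\<^sub>v (core Y *\<^sub>v (Y\<^sup>T *\<^sub>v (Y *\<^sub>v v)) - S *\<^sub>v (core Y *\<^sub>v v))"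
    using Y v N by (simp add: core_vec)
  also have "core Y *\<^sub>v (Y\<^sup>T *\<^sub>v (Y *\<^sub>v v)) = core Y *\<^sub>v ((core Y)\<^sup>T *\<^sub>v (core Y *\<^sub>v v))
      + core Y *\<^sub>v ((rest Y)\<^sup>T *\<^sub>v (rest Y *\<^sub>v v))"
    unfolding gram_split[OF Y v] using Y by (intro mv_add) auto
  finally show ?thesis .
qed

text \<open>In matrix form K^T (I + \<eta> (S - K K^T)) - \<eta> J^T J K^T, the shape needed to
  bound K^T from below.\<close>

lemma core_step_transpose_vec:
  assumes Y: "Y \<in> carrier_mat p r" and x: "x \<in> carrier_vec r"
  shows "(core (gd_step X \<eta> Y))\<^sup>T *\<^sub>v x = (core Y)\<^sup>T *\<^sub>v x - \<eta> \<cdot>\<^sub>v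
    ((core Y)\<^sup>T *\<^sub>v (core Y *\<^sub>v ((core Y)\<^sup>T *\<^sub>v x)) + (rest Y)\<^sup>T *\<^sub>v (rest Y *\<^sub>v ((core Y)\<^sup>T *\<^sub>v x))
      - (core Y)\<^sup>T *\<^sub>v (S *\<^sub>v x))"
proof -
  have Ux: "U *\<^sub>v x \<in> carrier_vec p" using U by auto
  have "(core (gd_step X \<eta> Y))\<^sup>T *\<^sub>v x = (gd_step X \<eta> Y)\<^sup>T *\<^sub>v (U *\<^sub>v x)"
    using Y x by (intro core_transpose_vec) auto
  also have "\<dots> = (core Y)\<^sup>T *\<^sub>v x - \<eta> \<cdot>\<^sub>v
      (Y\<^sup>T *\<^sub>v (Y *\<^sub>v ((core Y)\<^sup>T *\<^sub>v x)) - (core Y)\<^sup>T *\<^sub>v (S *\<^sub>v x))"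
    unfolding gd_step_transpose_vec[OF Y Ux] using Y x U S Ux
    by (simp add: X_vec core_transpose_vec)
  also have "Y\<^sup>T *\<^sub>v (Y *\<^sub>v ((core Y)\<^sup>T *\<^sub>v x)) = (core Y)\<^sup>T *\<^sub>v (core Y *\<^sub>v ((core Y)\<^sup>T *\<^sub>v x))
      + (rest Y)\<^sup>T *\<^sub>v (rest Y *\<^sub>v ((core Y)\<^sup>T *\<^sub>v x))"
    using Y x by (intro gram_split) auto
  finally show ?thesis .
qed

text \<open>The contribution of \<open>X\<close> lies in the range of \<open>U\<close> and is killed
  by the projection I - U U^T; what remains multiplies J from the right only.\<close>

lemma rest_step_vec:
  assumes Y: "Y \<in> carrier_mat p r" and v: "v \<in> carrier_vec r"
  shows "rest (gd_step X \<eta> Y) *\<^sub>v v = rest Y *\<^sub>v (v - \<eta> \<cdot>\<^sub>v (Y\<^sup>T *\<^sub>v (Y *\<^sub>v v)))"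
proof -
  define u N where "u = Y *\<^sub>v v" and "N = Y\<^sup>T *\<^sub>v (Y *\<^sub>v v)"
  have u: "u \<in> carrier_vec p" and N: "N \<in> carrier_vec r" using Y v by (auto simp: u_def N_def)
  have g: "gd_step X \<eta> Y *\<^sub>v v = u - \<eta> \<cdot>\<^sub>v (Y *\<^sub>v N - U *\<^sub>v (S *\<^sub>v (U\<^sup>T *\<^sub>v u)))"
    unfolding gd_step_vec[OF Y v] u_def N_def using Y v by (simp add: X_vec)
  have "core (gd_step X \<eta> Y) *\<^sub>v v = U\<^sup>T *\<^sub>v (gd_step X \<eta> Y *\<^sub>v v)"
    using Y v by (intro core_vec) auto
  also have "\<dots> = U\<^sup>T *\<^sub>v u - \<eta> \<cdot>\<^sub>v (U\<^sup>T *\<^sub>v (Y *\<^sub>v N) - S *\<^sub>v (U\<^sup>T *\<^sub>v u))"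
    unfolding g using Y U S u N by (simp add: mv_distrib)
  finally have "U *\<^sub>v (core (gd_step X \<eta> Y) *\<^sub>v v) = U *\<^sub>v (U\<^sup>T *\<^sub>v u)
      - \<eta> \<cdot>\<^sub>v (U *\<^sub>v (U\<^sup>T *\<^sub>v (Y *\<^sub>v N)) - U *\<^sub>v (S *\<^sub>v (U\<^sup>T *\<^sub>v u)))"
    using Y U S u N by (simp add: mv_distrib)
  then have "rest (gd_step X \<eta> Y) *\<^sub>v v = (u - \<eta> \<cdot>\<^sub>v (Y *\<^sub>v N - U *\<^sub>v (S *\<^sub>v (U\<^sup>T *\<^sub>v u))))
      - (U *\<^sub>v (U\<^sup>T *\<^sub>v u) - \<eta> \<cdot>\<^sub>v (U *\<^sub>v (U\<^sup>T *\<^sub>v (Y *\<^sub>v N)) - U *\<^sub>v (S *\<^sub>v (U\<^sup>T *\<^sub>v u))))"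
    using Y v g by (simp add: rest_vec)
  moreover have "rest Y *\<^sub>v (v - \<eta> \<cdot>\<^sub>v N) = (u - U *\<^sub>v (U\<^sup>T *\<^sub>v u))
      - \<eta> \<cdot>\<^sub>v (Y *\<^sub>v N - U *\<^sub>v (U\<^sup>T *\<^sub>v (Y *\<^sub>v N)))"
    using Y v N by (simp add: mv_distrib rest_vec core_vec u_def)
  ultimately show ?thesis unfolding N_def[symmetric] using Y U u N
    by (intro eq_vecI) (auto simp: algebra_simps simp del: index_mult_mat_vec)
qed

end

section \<open>One-step estimates\<close>

text \<open>\<open>n\<close>, \<open>t\<close>, \<open>h\<close>, \<open>w\<close> stand for the
  norms of v, Y v, Y^T Y v and Y v - \<eta> Y Y^T Y v. With the Rayleigh quotient x = t^2 / n^2, the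
  cubic part shrinks \<open>t\<close> by 1 - \<eta> x / 2 and the target adds at most \<eta> b t.
  The net factor is 1 + \<eta> \<delta> / 2, where \<delta> = 2 b - x is the room left below the
  bound, so for small \<open>\<eta>\<close> the step cannot overshoot.\<close>

lemma bounded_step_scalar:
  fixes n t w h b \<eta> :: real
  assumes "0 \<le> n" "0 \<le> t" "0 \<le> w" "0 < b" "0 \<le> \<eta>" "\<eta> * b \<le> 1 / 8"
    and w: "w\<^sup>2 \<le> t\<^sup>2 - \<eta> * h\<^sup>2" and h: "t\<^sup>2 \<le> n * h" and t: "t \<le> sqrt (2 * b) * n"
  shows "w + \<eta> * b * t \<le> sqrt (2 * b) * n"
proof (cases "n = 0")
  case True
  then have "t = 0" using t \<open>0 \<le> t\<close> by simp
  then have "t\<^sup>2 = 0" by simp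
  moreover have "0 \<le> \<eta> * h\<^sup>2" using \<open>0 \<le> \<eta>\<close> by simp
  ultimately have "w\<^sup>2 \<le> 0" using w by linarith
  then show ?thesis using True \<open>t = 0\<close> by simp
next
  case False
  then have n: "0 < n" using \<open>0 \<le> n\<close> by simp
  define x \<delta> where "x = t\<^sup>2 / n\<^sup>2" and "\<delta> = 2 * b - x"
  have "t\<^sup>2 \<le> (sqrt (2 * b) * n)\<^sup>2" using t \<open>0 \<le> t\<close> by (intro power_mono)
  then have x: "0 \<le> x" "x \<le> 2 * b"
    using n \<open>0 < b\<close> by (auto simp: x_def power_mult_distrib divide_le_eq)
  have tn: "t\<^sup>2 = n\<^sup>2 * x" using n by (simp add: x_def)
  have "\<eta> * x \<le> \<eta> * (2 * b)" using x \<open>0 \<le> \<eta>\<close> by (intro mult_left_mono)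
  then have ex: "\<eta> * x \<le> 1 / 4" using \<open>\<eta> * b \<le> 1 / 8\<close> by simp
  have "(t\<^sup>2)\<^sup>2 \<le> (n * h)\<^sup>2" using h by (intro power_mono) auto
  then have "(n\<^sup>2 * x)\<^sup>2 \<le> (n * h)\<^sup>2" by (simp only: tn)
  then have "n\<^sup>2 * (n\<^sup>2 * x\<^sup>2) \<le> n\<^sup>2 * h\<^sup>2" by (simp add: power_mult_distrib power2_eq_square mult_ac)
  then have "n\<^sup>2 * x\<^sup>2 \<le> h\<^sup>2" by (rule mult_left_le_imp_le) (use n in simp)
  then have "\<eta> * (n\<^sup>2 * x\<^sup>2) \<le> \<eta> * h\<^sup>2" using \<open>0 \<le> \<eta>\<close> by (intro mult_left_mono)
  then have "w\<^sup>2 \<le> t\<^sup>2 * (1 - \<eta> * x)" using w tn by (simp add: algebra_simps power2_eq_square)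
  also have "\<dots> \<le> t\<^sup>2 * (1 - \<eta> * x / 2)\<^sup>2"
    using zero_le_square[of "\<eta> * x"]
    by (intro mult_left_mono) (auto simp: power2_eq_square algebra_simps)
  finally have "w\<^sup>2 \<le> (t * (1 - \<eta> * x / 2))\<^sup>2" by (simp add: power_mult_distrib)
  then have "w \<le> t * (1 - \<eta> * x / 2)"
    by (rule power2_le_imp_le) (use ex \<open>0 \<le> t\<close> in \<open>intro mult_nonneg_nonneg, simp_all\<close>)
  then have le: "w + \<eta> * b * t \<le> t * (1 + \<eta> * \<delta> / 2)"
    by (simp add: \<delta>_def algebra_simps diff_divide_distrib)
  have \<delta>: "0 \<le> \<delta>" using x by (simp add: \<delta>_def)
  have "\<eta> * \<delta> \<le> \<eta> * (2 * b)" using x \<open>0 \<le> \<eta>\<close> by (intro mult_left_mono) (auto simp: \<delta>_def)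
  then have ed: "\<eta> * \<delta> \<le> 1 / 4" using \<open>\<eta> * b \<le> 1 / 8\<close> by simp
  have "(\<eta> * x) * (\<eta> * \<delta>) \<le> 1 / 4 * (1 / 4)"
    using ex ed x \<delta> \<open>0 \<le> \<eta>\<close> by (intro mult_mono) auto
  \<comment> \<open>The left side is the increase of \<open>x\<close> under the squared growth
    factor; it fits into the room \<open>\<delta>\<close>.\<close>
  then have "\<delta> * (\<eta> * x + (\<eta> * x) * (\<eta> * \<delta>) / 4) \<le> \<delta> * 1"
    using ex \<delta> by (intro mult_left_mono) auto
  then have "x * (1 + \<eta> * \<delta> / 2)\<^sup>2 \<le> 2 * b"
    by (simp add: \<delta>_def power2_eq_square algebra_simps)
  then have "n\<^sup>2 * (x * (1 + \<eta> * \<delta> / 2)\<^sup>2) \<le> n\<^sup>2 * (2 * b)" by (intro mult_left_mono) auto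
  then have "(t * (1 + \<eta> * \<delta> / 2))\<^sup>2 \<le> (sqrt (2 * b) * n)\<^sup>2"
    using tn \<open>0 < b\<close> by (simp add: power_mult_distrib mult_ac)
  then have "t * (1 + \<eta> * \<delta> / 2) \<le> sqrt (2 * b) * n"
    by (rule power2_le_imp_le) (use \<open>0 < b\<close> n in simp)
  with le show ?thesis by linarith
qed

text \<open>Here n = |x|, k = |K^T x|, \<open>s\<close> is the same quantity after the step,
  \<open>z\<close> is the norm of x + \<eta> (S - K K^T) x, \<open>m\<close> the old lower bound of
  K^T and \<open>j\<close> the bound of J^T J. When \<open>s\<close> is below the threshold,
  \<open>k\<close> is small too, so \<open>z\<close> exceeds \<open>n\<close> by the factor 1 + 3/4
  \<eta> a. The lower bound at the shifted vector turns this into growth of \<open>s\<close>, of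
  which the J-terms take only a part.\<close>

lemma growth_step_scalar:
  fixes a b \<eta> m j n s k z :: real
  assumes a: "0 < a" "a \<le> b" and eta: "0 < \<eta>" "\<eta> * b\<^sup>2 = a / 2000"
    and m: "0 < m" and j: "0 \<le> j" "j \<le> a / 4" "j \<le> a * m / (2 * sqrt b)"
    and n: "0 \<le> n" and s: "0 \<le> s" and k: "0 \<le> k" "k \<le> s + \<eta> * j * k + 3 * \<eta> * sqrt (2 * b) * b * n"
    and z: "m * z \<le> s + \<eta> * j * k" "n\<^sup>2 * (1 + \<eta> * a) - \<eta> * k\<^sup>2 \<le> n * z"
  shows "min (sqrt a / 8) (m * (1 + \<eta> * a / 16)) * n \<le> s"
proof (cases "n = 0 \<or> sqrt a / 8 * n \<le> s")
  case True
  have "min (sqrt a / 8) (m * (1 + \<eta> * a / 16)) * n \<le> sqrt a / 8 * n"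
    using n by (intro mult_right_mono) auto
  then show ?thesis using True s by auto
next
  case False
  then have n: "0 < n" and small: "s < sqrt a / 8 * n" using n by auto
  have b: "0 < b" using a by simp
  define \<beta> where "\<beta> = sqrt (2 * b)"
  have \<beta>: "0 < \<beta>" "\<beta>\<^sup>2 = 2 * b" using b by (auto simp: \<beta>_def)
  have eb: "\<eta> * b \<le> 1 / 2000"
  proof -
    have "\<eta> * b * b = a / 2000" using eta(2) unfolding power2_eq_square by (simp only: mult.assoc)
    also have "\<dots> \<le> 1 / 2000 * b" using a(2) by simp
    finally have "\<eta> * b * b \<le> 1 / 2000 * b" .
    then show ?thesis using b by (rule mult_right_le_imp_le)
  qed
  have "\<eta> * a \<le> \<eta> * b" using a eta by (intro mult_left_mono) auto
  with eb have ea: "0 < \<eta> * a" "\<eta> * a \<le> 1 / 2000"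
    using eta(1) a(1) by (simp, linarith)
  have ej: "0 \<le> \<eta> * j" "\<eta> * j \<le> \<eta> * a / 4"
    using mult_left_mono[OF j(2), of \<eta>] j eta by auto
  have ej2: "\<eta> * j \<le> 1 / 2" using ej ea by linarith
  have "\<eta> * j * k \<le> 1 / 2 * k" using ej2 k by (intro mult_right_mono)
  then have k2: "k \<le> 2 * s + 6 * \<eta> * \<beta> * b * n" using k(2) by (simp add: \<beta>_def)
  have "k\<^sup>2 \<le> (2 * s + 6 * \<eta> * \<beta> * b * n)\<^sup>2" using k2 k by (intro power_mono)
  also have "\<dots> \<le> 8 * s\<^sup>2 + 72 * (\<eta> * \<beta> * b * n)\<^sup>2"
    using zero_le_power2[of "2 * s - 6 * \<eta> * \<beta> * b * n"]
    by (simp add: power2_eq_square algebra_simps)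
  also have "72 * (\<eta> * \<beta> * b * n)\<^sup>2 = 144 * (\<eta> * b\<^sup>2) * (\<eta> * b) * n\<^sup>2"
    by (simp add: power_mult_distrib \<beta>(2)) (simp add: power2_eq_square)
  also have "\<dots> \<le> 144 * (a / 2000) * (1 / 2000) * n\<^sup>2"
    unfolding eta(2) using eb a by (intro mult_right_mono mult_left_mono) auto
  also have "8 * s\<^sup>2 \<le> 8 * (sqrt a / 8 * n)\<^sup>2" using small s by (intro mult_left_mono power_mono) auto
  also have "8 * (sqrt a / 8 * n)\<^sup>2 = a / 8 * n\<^sup>2"
    using a by (simp add: power_mult_distrib power_divide)
  finally have "k\<^sup>2 \<le> a / 8 * n\<^sup>2 + 144 * (a / 2000) * (1 / 2000) * n\<^sup>2" by simp
  also have "\<dots> \<le> a / 4 * n\<^sup>2" using a by (simp add: field_simps)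
  finally have "\<eta> * k\<^sup>2 \<le> \<eta> * (a / 4 * n\<^sup>2)" using eta by (intro mult_left_mono) auto
  then have "n * (n * (1 + 3 * (\<eta> * a) / 4)) \<le> n * z"
    using z(2) by (simp add: power2_eq_square algebra_simps)
  then have "n * (1 + 3 * (\<eta> * a) / 4) \<le> z" using n by simp
  then have "m * (n * (1 + 3 * (\<eta> * a) / 4)) \<le> m * z" using m by simp
  also have "\<dots> \<le> s + \<eta> * j * k" by (rule z(1))
  \<comment> \<open>The bound on \<open>k\<close> splits the J-term. Its part in \<open>s\<close> is
    controlled by \<open>j \<le> a / 4\<close>; its part in \<open>n\<close> needs the bound of
    \<open>j\<close> relative to \<open>m\<close>, which makes it comparable with
    \<open>m * n\<close>.\<close>
  also have "\<dots> \<le> s + \<eta> * j * (2 * s + 6 * \<eta> * \<beta> * b * n)"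
    using k2 ej by (intro add_left_mono mult_left_mono)
  also have "\<dots> = s * (1 + 2 * (\<eta> * j)) + 6 * \<eta>\<^sup>2 * b * n * (\<beta> * j)"
    by (simp add: power2_eq_square algebra_simps)
  also have "s * (1 + 2 * (\<eta> * j)) \<le> s * (1 + \<eta> * a / 2)" using ej s by (intro mult_left_mono) auto
  also have "\<beta> * j \<le> \<beta> * (a * m / (2 * sqrt b))" using j \<beta> by (intro mult_left_mono) auto
  also have "\<beta> * (a * m / (2 * sqrt b)) = sqrt 2 / 2 * a * m"
    using b by (simp add: \<beta>_def real_sqrt_mult)
  also have "\<dots> \<le> 1 * a * m"
    using a m sqrt_le_D real_sqrt_le_mono[of 2 4] by (intro mult_right_mono) auto
  also have "6 * \<eta>\<^sup>2 * b * n * (1 * a * m) = 6 * (\<eta> * b) * ((\<eta> * a) * (m * n))"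
    by (simp add: power2_eq_square)
  also have "\<dots> \<le> 6 * (1 / 2000) * ((\<eta> * a) * (m * n))"
    using eb ea m n by (intro mult_right_mono mult_left_mono) auto
  finally have "m * n * (1 + 3 * (\<eta> * a) / 4) \<le> s * (1 + \<eta> * a / 2) + 6 / 2000 * (\<eta> * a) * (m * n)"
    using eta b n by (simp add: algebra_simps)
  moreover have "0 \<le> (\<eta> * a) * (m * n)" using ea m n by simp
  ultimately have main: "m * n * (1 + 11 * (\<eta> * a) / 16) \<le> s * (1 + \<eta> * a / 2)"
    by (simp add: algebra_simps)
  \<comment> \<open>To first order this is 9/16 against 11/16; the difference covers the product
    term.\<close>
  have "(1 + \<eta> * a / 16) * (1 + \<eta> * a / 2) \<le> 1 + 11 * (\<eta> * a) / 16"
  proof -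
    have "(1 + u / 16) * (1 + u / 2) \<le> 1 + 11 * u / 16" if "0 < u" "u \<le> 1 / 2000" for u :: real
    proof -
      have "u * u \<le> u * 1" using that by (intro mult_left_mono) auto
      then show ?thesis using that by (simp add: algebra_simps)
    qed
    then show ?thesis using ea by blast
  qed
  then have "m * n * ((1 + \<eta> * a / 16) * (1 + \<eta> * a / 2)) \<le> m * n * (1 + 11 * (\<eta> * a) / 16)"
    using m n by (intro mult_left_mono) auto
  also note main
  finally have "(m * n * (1 + \<eta> * a / 16)) * (1 + \<eta> * a / 2) \<le> s * (1 + \<eta> * a / 2)"
    by (simp add: mult_ac)
  then have "m * n * (1 + \<eta> * a / 16) \<le> s" using ea by (simp add: mult_le_cancel_right)
  moreover have "min (sqrt a / 8) (m * (1 + \<eta> * a / 16)) * n \<le> m * (1 + \<eta> * a / 16) * n"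
    using n by (intro mult_right_mono) auto
  ultimately show ?thesis by (simp add: mult_ac)
qed

context gradient_descent
begin

text \<open>The estimate of \<open>bounded_step_scalar\<close> keeps half of the shrinking by Y Y^T,
  and this half balances the stretching by X at the squared norm 2 b. Hence the radius is not
  sqrt(b).\<close>

definition \<beta> where "\<beta> = sqrt (2 * b)"

lemma \<beta>: "0 < \<beta>" "\<beta>\<^sup>2 = 2 * b" "\<beta> * \<beta> = 2 * b"
  using b by (auto simp: \<beta>_def)

lemma eta_beta: "\<eta> * \<beta>\<^sup>2 \<le> 1"
  using eta_b by (simp add: \<beta>)

lemma bounded_step:
  assumes Y: "Y \<in> carrier_mat p r" and op: "opnorm_le Y \<beta>"
  shows "opnorm_le (gd_step X \<eta> Y) \<beta>"
proof (rule opnorm_leI[of _ p r])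
  fix v :: "real vec" assume v: "v \<in> carrier_vec r"
  let ?u = "Y *\<^sub>v v"
  let ?N = "Y\<^sup>T *\<^sub>v ?u"
  let ?w = "?u - \<eta> \<cdot>\<^sub>v (Y *\<^sub>v ?N)"
  have u: "?u \<in> carrier_vec p" and N: "?N \<in> carrier_vec r" and w: "?w \<in> carrier_vec p"
    using Y v by auto
  have "gd_step X \<eta> Y *\<^sub>v v = ?w + \<eta> \<cdot>\<^sub>v (X *\<^sub>v ?u)"
  proof -
    have "x - \<eta> \<cdot>\<^sub>v (y - z) = x - \<eta> \<cdot>\<^sub>v y + \<eta> \<cdot>\<^sub>v z"
      if "x \<in> carrier_vec p" "y \<in> carrier_vec p" "z \<in> carrier_vec p" for x y z :: "real vec"
      using that by (intro eq_vecI) (auto simp: algebra_simps)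
    then show ?thesis unfolding gd_step_vec[OF Y v] using Y u N X by auto
  qed
  then have "vec_norm (gd_step X \<eta> Y *\<^sub>v v) \<le> vec_norm ?w + \<eta> * (b * vec_norm ?u)"
    using w u X eta_pos b opnorm_leD[OF opnorm_X X u]
    by (auto intro!: vec_norm_add_le[of _ p] vec_norm_smult_le)
  moreover have "vec_norm ?w + \<eta> * b * vec_norm ?u \<le> sqrt (2 * b) * vec_norm v"
  proof (rule bounded_step_scalar)
    show "(vec_norm ?w)\<^sup>2 \<le> (vec_norm ?u)\<^sup>2 - \<eta> * (vec_norm ?N)\<^sup>2"
      using gram_step_contracts[of "Y\<^sup>T" r p \<beta> \<eta> ?u] opnorm_le_transpose[OF op _ Y] Y u \<beta> eta_pos eta_beta
      by simp
    have "(vec_norm ?u)\<^sup>2 = v \<bullet> ?N"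
      using scalar_prod_mult_transpose[OF Y v u] by (simp add: vec_norm_power2)
    then show "(vec_norm ?u)\<^sup>2 \<le> vec_norm v * vec_norm ?N"
      using scalar_prod_Cauchy_Schwarz[OF v N] by simp
    show "vec_norm ?u \<le> sqrt (2 * b) * vec_norm v"
      using opnorm_leD[OF op Y v] by (simp add: \<beta>_def)
  qed (use b eta_pos eta_b in auto)
  ultimately show "vec_norm (gd_step X \<eta> Y *\<^sub>v v) \<le> \<beta> * vec_norm v" by (simp add: \<beta>_def)
qed (use Y in auto)

lemma core_le:
  assumes "Y \<in> carrier_mat p r" "v \<in> carrier_vec r"
  shows "vec_norm (core Y *\<^sub>v v) \<le> vec_norm (Y *\<^sub>v v)"
  using opnorm_leD[OF opnorm_UT, of r p "Y *\<^sub>v v"] U assms by (simp add: core_vec)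

text \<open>The factor I - \<eta> Y^T Y shrinks v by an amount governed by |Y v|, which is at least
  |K v|. The choice \<open>f = 0\<close> gives monotonicity, a positive \<open>f\<close> gives
  decay.\<close>

lemma rest_step:
  assumes Y: "Y \<in> carrier_mat p r" and op: "opnorm_le Y \<beta>" and J: "opnorm_le (rest Y) c" and c: "0 \<le> c"
    and f: "0 \<le> f" and below: "\<And>v. v \<in> carrier_vec r \<Longrightarrow> f * vec_norm v \<le> vec_norm (core Y *\<^sub>v v)"
  shows "opnorm_le (rest (gd_step X \<eta> Y)) (c * sqrt (1 - \<eta> * f\<^sup>2))"
proof (rule opnorm_leI[of _ p r])
  fix v :: "real vec" assume v: "v \<in> carrier_vec r"
  let ?w = "v - \<eta> \<cdot>\<^sub>v (Y\<^sup>T *\<^sub>v (Y *\<^sub>v v))"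
  have w: "?w \<in> carrier_vec r" using Y v by auto
  have "(vec_norm ?w)\<^sup>2 \<le> (vec_norm v)\<^sup>2 - \<eta> * (vec_norm (Y *\<^sub>v v))\<^sup>2"
    using \<beta> eta_pos eta_beta by (intro gram_step_contracts[OF Y op]) (auto simp: v)
  also have "\<dots> \<le> (vec_norm v)\<^sup>2 - \<eta> * (f * vec_norm v)\<^sup>2"
    using below[OF v] core_le[OF Y v] eta_pos f
    by (intro diff_left_mono mult_left_mono power_mono) auto
  finally have "(vec_norm ?w)\<^sup>2 \<le> (1 - \<eta> * f\<^sup>2) * (vec_norm v)\<^sup>2"
    by (simp add: power_mult_distrib algebra_simps)
  then have "vec_norm ?w \<le> sqrt ((1 - \<eta> * f\<^sup>2) * (vec_norm v)\<^sup>2)" by (rule real_le_rsqrt)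
  then have "vec_norm ?w \<le> sqrt (1 - \<eta> * f\<^sup>2) * vec_norm v" by (simp add: real_sqrt_mult)
  then have "vec_norm (rest Y *\<^sub>v ?w) \<le> c * (sqrt (1 - \<eta> * f\<^sup>2) * vec_norm v)"
    using J Y w c by (intro opnorm_le_apply[of _ c p r]) auto
  then show "vec_norm (rest (gd_step X \<eta> Y) *\<^sub>v v) \<le> c * sqrt (1 - \<eta> * f\<^sup>2) * vec_norm v"
    using Y v by (simp add: rest_step_vec)
qed (use Y in auto)

lemma rest_step_nonincreasing:
  assumes "Y \<in> carrier_mat p r" "opnorm_le Y \<beta>" "opnorm_le (rest Y) c" "0 \<le> c"
  shows "opnorm_le (rest (gd_step X \<eta> Y)) c"
  using rest_step[OF assms order_refl] by simp

lemma rest_gram_le: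
  assumes Y: "Y \<in> carrier_mat p r" and J: "opnorm_le (rest Y) c" "0 \<le> c"
    and v: "v \<in> carrier_vec r" "vec_norm v \<le> x"
  shows "vec_norm ((rest Y)\<^sup>T *\<^sub>v (rest Y *\<^sub>v v)) \<le> c\<^sup>2 * x"
proof -
  have R: "rest Y \<in> carrier_mat p r" using Y by simp
  have "vec_norm ((rest Y)\<^sup>T *\<^sub>v (rest Y *\<^sub>v v)) \<le> c * (c * x)"
    using J v R opnorm_le_transpose[OF J R]
    by (intro opnorm_le_apply[of "(rest Y)\<^sup>T" c r p] opnorm_le_apply[of "rest Y" c p r]) auto
  then show ?thesis by (simp add: power2_eq_square)
qed

text \<open>\<open>b\<close> comes from S and \<open>\<beta>\<^sup>2 = 2 * b\<close> from K K^T.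
  This crude bound holds from the start, before the gap contracts.\<close>

lemma opnorm_gap:
  assumes Y: "Y \<in> carrier_mat p r" and op: "opnorm_le Y \<beta>"
  shows "opnorm_le (gap Y) (3 * b)"
proof (rule opnorm_leI[of _ r r])
  fix x :: "real vec" assume x: "x \<in> carrier_vec r"
  have K: "core Y \<in> carrier_mat r r" using Y by simp
  have oK: "opnorm_le (core Y) \<beta>" by (rule opnorm_core[OF Y op])
  have "vec_norm (gap Y *\<^sub>v x) \<le> b * vec_norm x + \<beta> * (\<beta> * vec_norm x)"
    unfolding gap_vec[OF Y x] using S K x \<beta> b opnorm_leD[OF S_le S x] oK opnorm_le_transpose[OF oK _ K]
    by (intro vec_norm_diff_le[of _ r] opnorm_le_apply[of "core Y" \<beta> r r] opnorm_le_apply[of "(core Y)\<^sup>T" \<beta> r r]) auto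
  then show "vec_norm (gap Y *\<^sub>v x) \<le> 3 * b * vec_norm x"
    by (simp add: mult.assoc[symmetric] \<beta>)
qed (use Y in auto)

text \<open>No smallness of the gap is available here. Positivity of S gives x . z \<ge> (1 + \<eta>
  a) |x|^2 - \<eta> |K^T x|^2 for the shifted vector z, so z is longer than x as long as K^T x is
  small.\<close>

lemma growth_step:
  assumes Y: "Y \<in> carrier_mat p r" and op: "opnorm_le Y \<beta>" and J: "opnorm_le (rest Y) c" and c: "0 \<le> c"
    and small: "c\<^sup>2 \<le> a / 4" "c\<^sup>2 \<le> a * m / (2 * sqrt b)" and m: "0 < m"
    and below: "\<And>x. x \<in> carrier_vec r \<Longrightarrow> m * vec_norm x \<le> vec_norm ((core Y)\<^sup>T *\<^sub>v x)"
    and x: "x \<in> carrier_vec r"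
  shows "min (sqrt a / 8) (m * (1 + \<eta> * a / 16)) * vec_norm x \<le> vec_norm ((core (gd_step X \<eta> Y))\<^sup>T *\<^sub>v x)"
proof -
  define K where "K = core Y"
  have K: "K \<in> carrier_mat r r" using Y by (simp add: K_def)
  have oK: "opnorm_le K \<beta>" unfolding K_def by (rule opnorm_core[OF Y op])
  have oKT: "opnorm_le K\<^sup>T \<beta>" using opnorm_le_transpose[OF oK _ K] \<beta> by simp
  define k where "k = K\<^sup>T *\<^sub>v x"
  define Pk where "Pk = (rest Y)\<^sup>T *\<^sub>v (rest Y *\<^sub>v k)"
  define k' where "k' = (core (gd_step X \<eta> Y))\<^sup>T *\<^sub>v x"
  define Dx where "Dx = S *\<^sub>v x - K *\<^sub>v k"
  \<comment> \<open>The shift moves the gap into the argument of K^T: the new K^T at x is K^T z -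
    \<eta> J^T J K^T x, and the old lower bound applies at z.\<close>
  define z where "z = x + \<eta> \<cdot>\<^sub>v Dx"
  have R: "rest Y \<in> carrier_mat p r" using Y by simp
  have car: "k \<in> carrier_vec r" "Pk \<in> carrier_vec r" "k' \<in> carrier_vec r" "Dx \<in> carrier_vec r"
    "z \<in> carrier_vec r"
    using K R S x Y unfolding k_def Pk_def k'_def Dx_def z_def by auto
  have k': "k' = k - \<eta> \<cdot>\<^sub>v (K\<^sup>T *\<^sub>v (K *\<^sub>v k) + Pk - K\<^sup>T *\<^sub>v (S *\<^sub>v x))"
    unfolding k'_def core_step_transpose_vec[OF Y x] K_def k_def Pk_def ..
  have KDx: "K\<^sup>T *\<^sub>v Dx = K\<^sup>T *\<^sub>v (S *\<^sub>v x) - K\<^sup>T *\<^sub>v (K *\<^sub>v k)"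
    unfolding Dx_def using K S x by (intro mv_minus) auto
  have KTz: "K\<^sup>T *\<^sub>v z = k + \<eta> \<cdot>\<^sub>v (K\<^sup>T *\<^sub>v Dx)"
    unfolding z_def k_def using K x car by (simp add: mv_distrib)
  have z1: "K\<^sup>T *\<^sub>v z = k' + \<eta> \<cdot>\<^sub>v Pk"
    unfolding KTz KDx k' using K S car
    by (intro eq_vecI) (auto simp: algebra_simps simp del: index_mult_mat_vec)
  have k1: "k = K\<^sup>T *\<^sub>v z - \<eta> \<cdot>\<^sub>v (K\<^sup>T *\<^sub>v Dx)"
    unfolding KTz using K car by (intro eq_vecI) (auto simp del: index_mult_mat_vec)
  have nP: "vec_norm Pk \<le> c\<^sup>2 * vec_norm k"
    unfolding Pk_def using car by (intro rest_gram_le[OF Y J c]) auto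
  have nz: "vec_norm (K\<^sup>T *\<^sub>v z) \<le> vec_norm k' + \<eta> * c\<^sup>2 * vec_norm k"
    unfolding z1 using car eta_pos vec_norm_smult_le[OF _ nP, of \<eta>]
    by (intro vec_norm_add_le[of _ r]) (auto simp: mult_ac)
  have "vec_norm Dx \<le> 3 * b * vec_norm x"
    using opnorm_leD[OF opnorm_gap[OF Y op] _ x, of r] Y x by (simp add: gap_vec Dx_def K_def k_def)
  then have "vec_norm (K\<^sup>T *\<^sub>v Dx) \<le> \<beta> * (3 * b * vec_norm x)"
    using oKT K car \<beta> by (intro opnorm_le_apply) auto
  \<comment> \<open>Undoing the step: the old value is recovered from the new one up to the J-term
    and a term of order \<open>\<eta>\<close>.\<close>
  then have "vec_norm k \<le> (vec_norm k' + \<eta> * c\<^sup>2 * vec_norm k) + \<eta> * (\<beta> * (3 * b * vec_norm x))"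
    using K car eta_pos nz by (subst k1) (intro vec_norm_diff_le[of _ r] vec_norm_smult_le, auto)
  then have nk: "vec_norm k \<le> vec_norm k' + \<eta> * c\<^sup>2 * vec_norm k + 3 * \<eta> * sqrt (2 * b) * b * vec_norm x"
    by (simp add: \<beta>_def algebra_simps)
  have xK: "x \<bullet> (K *\<^sub>v k) = (vec_norm k)\<^sup>2"
    using scalar_prod_mult_transpose[of "K\<^sup>T" r r x k] K x car
    by (simp add: k_def vec_norm_power2)
  have "x \<bullet> z = (vec_norm x)\<^sup>2 + \<eta> * (x \<bullet> (S *\<^sub>v x)) - \<eta> * (vec_norm k)\<^sup>2"
    unfolding z_def Dx_def using K S x car xK
    by (simp add: scalar_prod_add_distrib[of _ r] scalar_prod_minus_distrib[of _ r]
        vec_norm_power2 algebra_simps)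
  moreover have "\<eta> * (a * (vec_norm x)\<^sup>2) \<le> \<eta> * (x \<bullet> (S *\<^sub>v x))"
    using S_ge[OF x] eta_pos by (intro mult_left_mono) auto
  moreover have "x \<bullet> z \<le> vec_norm x * vec_norm z"
    using scalar_prod_Cauchy_Schwarz[OF x car(5)] by simp
  ultimately have "(vec_norm x)\<^sup>2 * (1 + \<eta> * a) - \<eta> * (vec_norm k)\<^sup>2 \<le> vec_norm x * vec_norm z"
    by (simp add: algebra_simps)
  moreover have "m * vec_norm z \<le> vec_norm k' + \<eta> * c\<^sup>2 * vec_norm k"
    using below[OF car(5)] nz by (simp add: K_def)
  ultimately show ?thesis
    unfolding k'_def[symmetric] using a ab eta_pos eta_b2 m small nk
    by (intro growth_step_scalar[where j = "c\<^sup>2" and k = "vec_norm k" and z = "vec_norm z"]) auto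
qed

end

section \<open>Contraction of the gap\<close>

text \<open>The distances are bounded by the exact difference of powers, which lets the induction
  close; dropping the subtracted power gives the Cauchy property and the distance to the
  limit.\<close>

lemma geometric_steps_converge:
  fixes x :: "nat \<Rightarrow> real"
  assumes step: "\<And>t. \<bar>x (Suc t) - x t\<bar> \<le> B * q ^ t" and q: "0 \<le> q" "q < 1"
  obtains l where "x \<longlonglongrightarrow> l" and "\<And>t. \<bar>l - x t\<bar> \<le> B / (1 - q) * q ^ t"
proof -
  have B: "0 \<le> B" using step[of 0] by simp
  have dist: "\<bar>x (t + k) - x t\<bar> \<le> B / (1 - q) * (q ^ t - q ^ (t + k))" for t k
  proof (induction k)
    case (Suc k)
    have "B / (1 - q) * (q ^ t - q ^ (t + Suc k)) = B / (1 - q) * (q ^ t - q ^ (t + k)) + B * q ^ (t + k)"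
      using q by (simp add: field_simps)
    moreover have "\<bar>x (t + Suc k) - x t\<bar> \<le> \<bar>x (t + k) - x t\<bar> + \<bar>x (Suc (t + k)) - x (t + k)\<bar>" by simp
    ultimately show ?case using Suc step[of "t + k"] by linarith
  qed simp
  have "Cauchy x"
  proof (rule CauchyI')
    fix e :: real assume e: "0 < e"
    have "(\<lambda>t. B / (1 - q) * q ^ t) \<longlonglongrightarrow> B / (1 - q) * 0"
      by (rule tendsto_mult[OF tendsto_const LIMSEQ_realpow_zero[OF q]])
    then have "eventually (\<lambda>t. B / (1 - q) * q ^ t < e) sequentially"
      using e by (intro order_tendstoD(2)) auto
    then obtain M where M: "\<And>t. M \<le> t \<Longrightarrow> B / (1 - q) * q ^ t < e"
      by (auto simp: eventually_sequentially)
    have "dist (x m) (x n) < e" if "M \<le> m" "m < n" for m n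
    proof -
      have "\<bar>x n - x m\<bar> \<le> B / (1 - q) * (q ^ m - q ^ n)" using dist[of m "n - m"] that by simp
      also have "\<dots> \<le> B / (1 - q) * q ^ m" using B q by (intro mult_left_mono) auto
      also have "\<dots> < e" using M that by simp
      finally show ?thesis by (simp add: dist_real_def abs_minus_commute)
    qed
    then show "\<exists>M. \<forall>m\<ge>M. \<forall>n>m. dist (x m) (x n) < e" by blast
  qed
  then obtain l where l: "x \<longlonglongrightarrow> l" by (auto simp: Cauchy_convergent_iff convergent_def)
  have "\<bar>l - x t\<bar> \<le> B / (1 - q) * q ^ t" for t
  proof (rule Lim_bounded)
    show "(\<lambda>s. \<bar>x s - x t\<bar>) \<longlonglongrightarrow> \<bar>l - x t\<bar>" by (intro tendsto_intros l)
    show "\<forall>s\<ge>t. \<bar>x s - x t\<bar> \<le> B / (1 - q) * q ^ t"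
    proof safe
      fix s assume "t \<le> s"
      then have "\<bar>x s - x t\<bar> \<le> B / (1 - q) * (q ^ t - q ^ s)" using dist[of t "s - t"] by simp
      also have "\<dots> \<le> B / (1 - q) * q ^ t" using B q by (intro mult_left_mono) auto
      finally show "\<bar>x s - x t\<bar> \<le> B / (1 - q) * q ^ t" .
    qed
  qed
  then show ?thesis using l that by blast
qed

context gradient_descent
begin

text \<open>The terms of \<open>core_step_vec\<close> regrouped around the gap, so that both
  correction terms contain a quantity that decays.\<close>

lemma core_step_gap_vec:
  assumes Y: "Y \<in> carrier_mat p r" and v: "v \<in> carrier_vec r"
  shows "core (gd_step X \<eta> Y) *\<^sub>v v = core Y *\<^sub>v v + \<eta> \<cdot>\<^sub>v (gap Y *\<^sub>v (core Y *\<^sub>v v))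
    - \<eta> \<cdot>\<^sub>v (core Y *\<^sub>v ((rest Y)\<^sup>T *\<^sub>v (rest Y *\<^sub>v v)))"
proof -
  have gen: "x - \<eta> \<cdot>\<^sub>v (y + w - z) = x + \<eta> \<cdot>\<^sub>v (z - y) - \<eta> \<cdot>\<^sub>v w"
    if "x \<in> carrier_vec r" "y \<in> carrier_vec r" "z \<in> carrier_vec r" "w \<in> carrier_vec r"
    for x y z w :: "real vec"
    using that by (intro eq_vecI) (auto simp: algebra_simps)
  have K: "core Y \<in> carrier_mat r r" using Y by simp
  show ?thesis
    unfolding core_step_vec[OF Y v] gap_vec[OF Y mv_carrier(2)[OF K]]
    using K S by (intro gen) auto
qed

text \<open>The first-order terms of the new S - K K^T are completed to the product T D T with T = I
  - \<eta> K K^T, which shows the contraction. The completion error K K^T D K K^T and the remaining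
  terms carry \<eta>^2, except for 2 \<eta> K J^T J K^T.\<close>

lemma gap_step_vec:
  assumes Y: "Y \<in> carrier_mat p r" and x: "x \<in> carrier_vec r"
  defines "K \<equiv> core Y" and "D \<equiv> gap Y" and "P \<equiv> \<lambda>w. (rest Y)\<^sup>T *\<^sub>v (rest Y *\<^sub>v w)"
  defines "T \<equiv> \<lambda>w. w - \<eta> \<cdot>\<^sub>v (K *\<^sub>v (K\<^sup>T *\<^sub>v w))"
  shows "gap (gd_step X \<eta> Y) *\<^sub>v x = T (D *\<^sub>v (T x))
    - \<eta>\<^sup>2 \<cdot>\<^sub>v (K *\<^sub>v (K\<^sup>T *\<^sub>v (D *\<^sub>v (K *\<^sub>v (K\<^sup>T *\<^sub>v x)))))
    - \<eta>\<^sup>2 \<cdot>\<^sub>v (D *\<^sub>v (K *\<^sub>v (K\<^sup>T *\<^sub>v (D *\<^sub>v x))))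
    + (2 * \<eta>) \<cdot>\<^sub>v (K *\<^sub>v P (K\<^sup>T *\<^sub>v x))
    + \<eta>\<^sup>2 \<cdot>\<^sub>v (D *\<^sub>v (K *\<^sub>v P (K\<^sup>T *\<^sub>v x)))
    + \<eta>\<^sup>2 \<cdot>\<^sub>v (K *\<^sub>v P (K\<^sup>T *\<^sub>v (D *\<^sub>v x)))
    - \<eta>\<^sup>2 \<cdot>\<^sub>v (K *\<^sub>v P (P (K\<^sup>T *\<^sub>v x)))"
proof -
  have K: "K \<in> carrier_mat r r" and KT: "K\<^sup>T \<in> carrier_mat r r" and D: "D \<in> carrier_mat r r"
    and R: "rest Y \<in> carrier_mat p r" and RT: "(rest Y)\<^sup>T \<in> carrier_mat r p"
    using Y by (auto simp: K_def D_def)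
  have P: "P w \<in> carrier_vec r" for w using RT by (simp add: P_def)
  have P_lin: "P (u + \<eta> \<cdot>\<^sub>v v - \<eta> \<cdot>\<^sub>v w) = P u + \<eta> \<cdot>\<^sub>v P v - \<eta> \<cdot>\<^sub>v P w"
    if "u \<in> carrier_vec r" "v \<in> carrier_vec r" "w \<in> carrier_vec r" for u v w
    unfolding P_def using that R RT by (simp add: mv_distrib)
  have D_lin: "D *\<^sub>v (u + \<eta> \<cdot>\<^sub>v v - \<eta> \<cdot>\<^sub>v w) = D *\<^sub>v u + \<eta> \<cdot>\<^sub>v (D *\<^sub>v v) - \<eta> \<cdot>\<^sub>v (D *\<^sub>v w)"
    if "u \<in> carrier_vec r" "v \<in> carrier_vec r" "w \<in> carrier_vec r" for u v w
    using that D by (simp add: mv_distrib)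
  have K_lin: "K *\<^sub>v (u + \<eta> \<cdot>\<^sub>v v - \<eta> \<cdot>\<^sub>v w) = K *\<^sub>v u + \<eta> \<cdot>\<^sub>v (K *\<^sub>v v) - \<eta> \<cdot>\<^sub>v (K *\<^sub>v w)"
    if "u \<in> carrier_vec r" "v \<in> carrier_vec r" "w \<in> carrier_vec r" for u v w
    using that K by (simp add: mv_distrib)
  define k where "k = K\<^sup>T *\<^sub>v x"
  define k' where "k' = (core (gd_step X \<eta> Y))\<^sup>T *\<^sub>v x"
  define A1 B1 B2 E1 where "A1 = D *\<^sub>v x" and "B1 = K *\<^sub>v k" and "B2 = K *\<^sub>v (K\<^sup>T *\<^sub>v A1)"
    and "E1 = K *\<^sub>v P k"
  define F1 F2 where "F1 = K *\<^sub>v P (K\<^sup>T *\<^sub>v A1)" and "F2 = K *\<^sub>v P (P k)"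
  have car: "k \<in> carrier_vec r" "k' \<in> carrier_vec r" "A1 \<in> carrier_vec r" "B1 \<in> carrier_vec r"
    "B2 \<in> carrier_vec r" "E1 \<in> carrier_vec r" "F1 \<in> carrier_vec r" "F2 \<in> carrier_vec r"
    "K\<^sup>T *\<^sub>v A1 \<in> carrier_vec r"
    using K KT D Y by (auto simp: k_def k'_def A1_def B1_def B2_def E1_def F1_def F2_def)
  have Dx: "A1 = S *\<^sub>v x - B1"
    unfolding A1_def D_def B1_def K_def k_def by (rule gap_vec[OF Y x])
  have "k' = k - \<eta> \<cdot>\<^sub>v (K\<^sup>T *\<^sub>v B1 + P k - K\<^sup>T *\<^sub>v (S *\<^sub>v x))"
    unfolding k'_def core_step_transpose_vec[OF Y x] K_def k_def B1_def P_def ..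
  also have "\<dots> = k + \<eta> \<cdot>\<^sub>v (K\<^sup>T *\<^sub>v A1) - \<eta> \<cdot>\<^sub>v P k"
  proof -
    have "x - \<eta> \<cdot>\<^sub>v (y + w - z) = x + \<eta> \<cdot>\<^sub>v (z - y) - \<eta> \<cdot>\<^sub>v w"
      if "x \<in> carrier_vec r" "y \<in> carrier_vec r" "z \<in> carrier_vec r" "w \<in> carrier_vec r"
      for x y z w :: "real vec"
      using that by (intro eq_vecI) (auto simp: algebra_simps)
    moreover have "K\<^sup>T *\<^sub>v A1 = K\<^sup>T *\<^sub>v (S *\<^sub>v x) - K\<^sup>T *\<^sub>v B1"
      unfolding Dx using KT S car by (intro mv_minus) auto
    ultimately show ?thesis using car KT P by simp
  qed
  finally have k': "k' = k + \<eta> \<cdot>\<^sub>v (K\<^sup>T *\<^sub>v A1) - \<eta> \<cdot>\<^sub>v P k" .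
  have Kk': "K *\<^sub>v k' = B1 + \<eta> \<cdot>\<^sub>v B2 - \<eta> \<cdot>\<^sub>v E1"
    unfolding k' B1_def B2_def E1_def using car P by (intro K_lin)
  have DKk': "D *\<^sub>v (K *\<^sub>v k') = D *\<^sub>v B1 + \<eta> \<cdot>\<^sub>v (D *\<^sub>v B2) - \<eta> \<cdot>\<^sub>v (D *\<^sub>v E1)"
    unfolding Kk' using car by (intro D_lin)
  have "P k' = P k + \<eta> \<cdot>\<^sub>v P (K\<^sup>T *\<^sub>v A1) - \<eta> \<cdot>\<^sub>v P (P k)"
    unfolding k' using car P by (intro P_lin)
  then have KPk': "K *\<^sub>v P k' = E1 + \<eta> \<cdot>\<^sub>v F1 - \<eta> \<cdot>\<^sub>v F2"
    unfolding E1_def F1_def F2_def using P by (simp add: K_lin)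
  have "core (gd_step X \<eta> Y) *\<^sub>v k' = K *\<^sub>v k' + \<eta> \<cdot>\<^sub>v (D *\<^sub>v (K *\<^sub>v k')) - \<eta> \<cdot>\<^sub>v (K *\<^sub>v P k')"
    unfolding K_def D_def P_def by (rule core_step_gap_vec[OF Y car(2)])
  then have gap': "gap (gd_step X \<eta> Y) *\<^sub>v x = S *\<^sub>v x - ((B1 + \<eta> \<cdot>\<^sub>v B2 - \<eta> \<cdot>\<^sub>v E1)
      + \<eta> \<cdot>\<^sub>v (D *\<^sub>v B1 + \<eta> \<cdot>\<^sub>v (D *\<^sub>v B2) - \<eta> \<cdot>\<^sub>v (D *\<^sub>v E1)) - \<eta> \<cdot>\<^sub>v (E1 + \<eta> \<cdot>\<^sub>v F1 - \<eta> \<cdot>\<^sub>v F2))"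
    using Y x by (subst gap_vec) (auto simp: k'_def[symmetric] Kk' DKk'[unfolded Kk'] KPk')
  define C1 C2 C3 G where "C1 = D *\<^sub>v B1" and "C2 = D *\<^sub>v B2" and "C3 = D *\<^sub>v E1"
    and "G = K *\<^sub>v (K\<^sup>T *\<^sub>v C1)"
  have car2: "C1 \<in> carrier_vec r" "C2 \<in> carrier_vec r" "C3 \<in> carrier_vec r" "G \<in> carrier_vec r"
    "S *\<^sub>v x \<in> carrier_vec r"
    using D K S by (auto simp: C1_def C2_def C3_def G_def)
  have "D *\<^sub>v T x = A1 - \<eta> \<cdot>\<^sub>v C1"
    unfolding T_def A1_def C1_def B1_def k_def using D K x by (simp add: mv_distrib)
  then have TDT: "T (D *\<^sub>v T x) = (A1 - \<eta> \<cdot>\<^sub>v C1) - \<eta> \<cdot>\<^sub>v (B2 - \<eta> \<cdot>\<^sub>v G)"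
    unfolding T_def B2_def G_def using K KT car car2 by (simp add: mv_distrib)
  \<comment> \<open>Plain vectors replace the matrix products, so that the componentwise proof does
    not unfold them. \<open>g\<close> is the completion term, added and subtracted.\<close>
  have "s - ((b1 + \<eta> \<cdot>\<^sub>v b2 - \<eta> \<cdot>\<^sub>v e1) + \<eta> \<cdot>\<^sub>v (c1 + \<eta> \<cdot>\<^sub>v c2 - \<eta> \<cdot>\<^sub>v c3) - \<eta> \<cdot>\<^sub>v (e1 + \<eta> \<cdot>\<^sub>v f1 - \<eta> \<cdot>\<^sub>v f2))
    = ((s - b1 - \<eta> \<cdot>\<^sub>v c1) - \<eta> \<cdot>\<^sub>v (b2 - \<eta> \<cdot>\<^sub>v g)) - \<eta>\<^sup>2 \<cdot>\<^sub>v g - \<eta>\<^sup>2 \<cdot>\<^sub>v c2 + (2 * \<eta>) \<cdot>\<^sub>v e1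
      + \<eta>\<^sup>2 \<cdot>\<^sub>v c3 + \<eta>\<^sup>2 \<cdot>\<^sub>v f1 - \<eta>\<^sup>2 \<cdot>\<^sub>v f2"
    if "{s, b1, b2, c1, c2, c3, e1, f1, f2, g} \<subseteq> carrier_vec r" for s b1 b2 c1 c2 c3 e1 f1 f2 g :: "real vec"
    using that by (intro eq_vecI) (auto simp: algebra_simps power2_eq_square)
  from this[of "S *\<^sub>v x" B1 B2 C1 C2 C3 E1 F1 F2 G]
  have "gap (gd_step X \<eta> Y) *\<^sub>v x = T (D *\<^sub>v T x) - \<eta>\<^sup>2 \<cdot>\<^sub>v G - \<eta>\<^sup>2 \<cdot>\<^sub>v C2 + (2 * \<eta>) \<cdot>\<^sub>v E1
      + \<eta>\<^sup>2 \<cdot>\<^sub>v C3 + \<eta>\<^sup>2 \<cdot>\<^sub>v F1 - \<eta>\<^sup>2 \<cdot>\<^sub>v F2"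
    unfolding TDT gap' using car car2 by (simp add: Dx C1_def[symmetric] C2_def[symmetric] C3_def[symmetric])
  then show ?thesis
    unfolding A1_def B1_def B2_def C1_def C2_def C3_def E1_def F1_def F2_def G_def k_def .
qed

text \<open>T contracts by sqrt(1 - \<eta> a / 64) and stands on both sides of D. The second-order
  terms in D cost \<eta> a / 200, so 1 - \<eta> a / 128 remains valid. Of the coefficient 5, four
  units are the first-order J-term and one covers the J-terms of second order.\<close>

lemma gap_step:
  assumes Y: "Y \<in> carrier_mat p r" and op: "opnorm_le Y \<beta>"
    and D: "opnorm_le (gap Y) d" and d: "0 \<le> d"
    and J: "opnorm_le (rest Y) c" and c: "0 \<le> c" "c\<^sup>2 \<le> 2 * b"
    and below: "\<And>x. x \<in> carrier_vec r \<Longrightarrow> sqrt a / 8 * vec_norm x \<le> vec_norm ((core Y)\<^sup>T *\<^sub>v x)"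
  shows "opnorm_le (gap (gd_step X \<eta> Y)) ((1 - \<eta> * a / 128) * d + 5 * \<eta> * b * c\<^sup>2)"
proof (rule opnorm_leI[of _ r r])
  fix x :: "real vec" assume x: "x \<in> carrier_vec r"
  define n where "n = vec_norm x"
  define K where "K = core Y"
  define P where "P = (\<lambda>w. (rest Y)\<^sup>T *\<^sub>v (rest Y *\<^sub>v w))"
  define T where "T = (\<lambda>w. w - \<eta> \<cdot>\<^sub>v (K *\<^sub>v (K\<^sup>T *\<^sub>v w)))"
  define \<tau> where "\<tau> = sqrt (1 - \<eta> * (sqrt a / 8)\<^sup>2)"
  have K: "K \<in> carrier_mat r r" and KT: "K\<^sup>T \<in> carrier_mat r r" and Dc: "gap Y \<in> carrier_mat r r"
    and RT: "(rest Y)\<^sup>T \<in> carrier_mat r p"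
    using Y by (auto simp: K_def)
  have oK: "opnorm_le K \<beta>" unfolding K_def by (rule opnorm_core[OF Y op])
  have oKT: "opnorm_le K\<^sup>T \<beta>" using opnorm_le_transpose[OF oK _ K] \<beta> by simp
  have o3: "opnorm_le (gap Y) (3 * b)" by (rule opnorm_gap[OF Y op])
  have \<tau>2: "\<tau>\<^sup>2 = 1 - \<eta> * a / 64" "0 \<le> \<tau>"
    using eta_a a by (auto simp: \<tau>_def power_divide)
  have nT: "vec_norm (T w) \<le> \<tau> * y" if w: "w \<in> carrier_vec r" "vec_norm w \<le> y" for w y
  proof -
    have "(vec_norm (T w))\<^sup>2 \<le> (vec_norm w)\<^sup>2 - \<eta> * (vec_norm (K\<^sup>T *\<^sub>v w))\<^sup>2"
      using gram_step_contracts[OF KT oKT _ _ eta_beta w(1)] \<beta> eta_pos by (simp add: T_def)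
    also have "\<dots> \<le> (vec_norm w)\<^sup>2 - \<eta> * (sqrt a / 8 * vec_norm w)\<^sup>2"
      using below[OF w(1)] eta_pos a
      by (intro diff_left_mono mult_left_mono power_mono) (auto simp: K_def)
    finally have "(vec_norm (T w))\<^sup>2 \<le> (1 - \<eta> * (sqrt a / 8)\<^sup>2) * (vec_norm w)\<^sup>2"
      by (simp add: power_mult_distrib power_divide algebra_simps)
    then have "vec_norm (T w) \<le> sqrt ((1 - \<eta> * (sqrt a / 8)\<^sup>2) * (vec_norm w)\<^sup>2)" by (rule real_le_rsqrt)
    then have "vec_norm (T w) \<le> \<tau> * vec_norm w" by (simp add: real_sqrt_mult \<tau>_def)
    also have "\<dots> \<le> \<tau> * y" using w \<tau>2 by (intro mult_left_mono)
    finally show ?thesis .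
  qed
  have Tc: "T w \<in> carrier_vec r" if "w \<in> carrier_vec r" for w using that K by (simp add: T_def)
  have Pc: "P w \<in> carrier_vec r" for w using RT by (simp add: P_def)
  have nP: "vec_norm (P w) \<le> c\<^sup>2 * y" if "w \<in> carrier_vec r" "vec_norm w \<le> y" for w y
    unfolding P_def by (rule rest_gram_le[OF Y J c(1) that])
  have nK: "vec_norm (K *\<^sub>v w) \<le> \<beta> * y" if "w \<in> carrier_vec r" "vec_norm w \<le> y" for w y
    using oK K that \<beta> by (intro opnorm_le_apply) auto
  have nKT: "vec_norm (K\<^sup>T *\<^sub>v w) \<le> \<beta> * y" if "w \<in> carrier_vec r" "vec_norm w \<le> y" for w y
    using oKT KT that \<beta> by (intro opnorm_le_apply) auto
  have nD: "vec_norm (gap Y *\<^sub>v w) \<le> d * y" if "w \<in> carrier_vec r" "vec_norm w \<le> y" for w y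
    using D Dc that d by (intro opnorm_le_apply) auto
  have nD3: "vec_norm (gap Y *\<^sub>v w) \<le> 3 * b * y" if "w \<in> carrier_vec r" "vec_norm w \<le> y" for w y
    using o3 Dc that b by (intro opnorm_le_apply) auto
  have nx: "vec_norm x \<le> n" by (simp add: n_def)
  note cs = Tc Pc x mv_carrier(2)[OF K] mv_carrier(2)[OF KT] mv_carrier(2)[OF Dc]
  have 1: "vec_norm (T (gap Y *\<^sub>v T x)) \<le> \<tau> * (d * (\<tau> * n))"
    by (intro nT nD cs nx)
  have 2: "vec_norm (K *\<^sub>v (K\<^sup>T *\<^sub>v (gap Y *\<^sub>v (K *\<^sub>v (K\<^sup>T *\<^sub>v x))))) \<le> \<beta> * (\<beta> * (d * (\<beta> * (\<beta> * n))))"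
    by (intro nK nKT nD cs nx)
  \<comment> \<open>One factor D is bounded by the crude 3 b and the other by \<open>d\<close>, so
    the estimate stays linear in \<open>d\<close>.\<close>
  have 3: "vec_norm (gap Y *\<^sub>v (K *\<^sub>v (K\<^sup>T *\<^sub>v (gap Y *\<^sub>v x)))) \<le> 3 * b * (\<beta> * (\<beta> * (d * n)))"
    by (intro nD3 nK nKT nD cs nx)
  have 4: "vec_norm (K *\<^sub>v P (K\<^sup>T *\<^sub>v x)) \<le> \<beta> * (c\<^sup>2 * (\<beta> * n))"
    by (intro nK nKT nP cs nx)
  have 5: "vec_norm (gap Y *\<^sub>v (K *\<^sub>v P (K\<^sup>T *\<^sub>v x))) \<le> 3 * b * (\<beta> * (c\<^sup>2 * (\<beta> * n)))"
    by (intro nD3 nK nKT nP cs nx)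
  have 6: "vec_norm (K *\<^sub>v P (K\<^sup>T *\<^sub>v (gap Y *\<^sub>v x))) \<le> \<beta> * (c\<^sup>2 * (\<beta> * (3 * b * n)))"
    by (intro nD3 nK nKT nP cs nx)
  have 7: "vec_norm (K *\<^sub>v P (P (K\<^sup>T *\<^sub>v x))) \<le> \<beta> * (c\<^sup>2 * (c\<^sup>2 * (\<beta> * n)))"
    by (intro nK nKT nP cs nx)
  have step: "gap (gd_step X \<eta> Y) *\<^sub>v x = T (gap Y *\<^sub>v (T x))
    - \<eta>\<^sup>2 \<cdot>\<^sub>v (K *\<^sub>v (K\<^sup>T *\<^sub>v (gap Y *\<^sub>v (K *\<^sub>v (K\<^sup>T *\<^sub>v x)))))
    - \<eta>\<^sup>2 \<cdot>\<^sub>v (gap Y *\<^sub>v (K *\<^sub>v (K\<^sup>T *\<^sub>v (gap Y *\<^sub>v x))))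
    + (2 * \<eta>) \<cdot>\<^sub>v (K *\<^sub>v P (K\<^sup>T *\<^sub>v x))
    + \<eta>\<^sup>2 \<cdot>\<^sub>v (gap Y *\<^sub>v (K *\<^sub>v P (K\<^sup>T *\<^sub>v x)))
    + \<eta>\<^sup>2 \<cdot>\<^sub>v (K *\<^sub>v P (K\<^sup>T *\<^sub>v (gap Y *\<^sub>v x)))
    - \<eta>\<^sup>2 \<cdot>\<^sub>v (K *\<^sub>v P (P (K\<^sup>T *\<^sub>v x)))"
    unfolding T_def P_def K_def by (rule gap_step_vec[OF Y x])
  have "vec_norm (gap (gd_step X \<eta> Y) *\<^sub>v x) \<le> \<tau> * (d * (\<tau> * n)) + \<eta>\<^sup>2 * (\<beta> * (\<beta> * (d * (\<beta> * (\<beta> * n)))))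
    + \<eta>\<^sup>2 * (3 * b * (\<beta> * (\<beta> * (d * n)))) + 2 * \<eta> * (\<beta> * (c\<^sup>2 * (\<beta> * n)))
    + \<eta>\<^sup>2 * (3 * b * (\<beta> * (c\<^sup>2 * (\<beta> * n)))) + \<eta>\<^sup>2 * (\<beta> * (c\<^sup>2 * (\<beta> * (3 * b * n))))
    + \<eta>\<^sup>2 * (\<beta> * (c\<^sup>2 * (c\<^sup>2 * (\<beta> * n))))"
    unfolding step
    using eta_pos
    by (intro vec_norm_add_le[of _ r] vec_norm_diff_le[of _ r] vec_norm_smult_le 1 2 3 4 5 6 7
        add_carrier_vec minus_carrier_vec smult_carrier_vec[THEN iffD2] cs) auto
  also have "\<dots> = n * (\<tau>\<^sup>2 * d + \<eta>\<^sup>2 * 10 * b\<^sup>2 * d + 4 * \<eta> * b * c\<^sup>2 + 12 * \<eta>\<^sup>2 * b\<^sup>2 * c\<^sup>2 + \<eta>\<^sup>2 * 2 * b * (c\<^sup>2 * c\<^sup>2))"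
  proof -
    have "\<tau> * (d * (\<tau> * n)) + \<eta>\<^sup>2 * (y * (y * (d * (y * (y * n)))))
      + \<eta>\<^sup>2 * (3 * z * (y * (y * (d * n)))) + 2 * \<eta> * (y * (c\<^sup>2 * (y * n)))
      + \<eta>\<^sup>2 * (3 * z * (y * (c\<^sup>2 * (y * n)))) + \<eta>\<^sup>2 * (y * (c\<^sup>2 * (y * (3 * z * n))))
      + \<eta>\<^sup>2 * (y * (c\<^sup>2 * (c\<^sup>2 * (y * n))))
      = n * (\<tau>\<^sup>2 * d + \<eta>\<^sup>2 * 10 * z\<^sup>2 * d + 4 * \<eta> * z * c\<^sup>2 + 12 * \<eta>\<^sup>2 * z\<^sup>2 * c\<^sup>2 + \<eta>\<^sup>2 * 2 * z * (c\<^sup>2 * c\<^sup>2))"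
      if "z = y * y / 2" for y z :: real
      unfolding that by (simp add: power2_eq_square algebra_simps)
    from this[of b \<beta>] show ?thesis using \<beta>(3) by simp
  qed
  also have "\<dots> \<le> n * ((1 - \<eta> * a / 128) * d + 5 * \<eta> * b * c\<^sup>2)"
  proof (intro mult_left_mono)
    have e1: "\<eta>\<^sup>2 * 10 * b\<^sup>2 * d = \<eta> * a / 200 * d"
      using eta_b2 by (simp add: power2_eq_square algebra_simps)
    have "0 \<le> \<eta> * a * d" using eta_pos a d by simp
    then have "\<tau>\<^sup>2 * d + \<eta>\<^sup>2 * 10 * b\<^sup>2 * d \<le> (1 - \<eta> * a / 128) * d"
      unfolding e1 \<tau>2 by (simp add: algebra_simps)
    moreover have "\<eta>\<^sup>2 * 2 * b * (c\<^sup>2 * c\<^sup>2) \<le> \<eta>\<^sup>2 * 2 * b * (2 * b * c\<^sup>2)"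
      using c b by (intro mult_left_mono mult_right_mono) auto
    \<comment> \<open>16 collects 12 from the two mixed terms and 4 from the term with c^4, after
      one factor c^2 is bounded by 2 b.\<close>
    moreover have "16 * \<eta>\<^sup>2 * b\<^sup>2 * c\<^sup>2 \<le> \<eta> * b * c\<^sup>2"
    proof -
      have "(16 * (\<eta> * b)) * (\<eta> * b * c\<^sup>2) \<le> 1 * (\<eta> * b * c\<^sup>2)"
        using eta_b eta_pos b by (intro mult_right_mono) auto
      then show ?thesis by (simp add: power2_eq_square algebra_simps)
    qed
    ultimately show "\<tau>\<^sup>2 * d + \<eta>\<^sup>2 * 10 * b\<^sup>2 * d + 4 * \<eta> * b * c\<^sup>2 + 12 * \<eta>\<^sup>2 * b\<^sup>2 * c\<^sup>2
        + \<eta>\<^sup>2 * 2 * b * (c\<^sup>2 * c\<^sup>2) \<le> (1 - \<eta> * a / 128) * d + 5 * \<eta> * b * c\<^sup>2"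
      by (simp add: power2_eq_square algebra_simps)
  qed (simp add: n_def)
  finally show "vec_norm (gap (gd_step X \<eta> Y) *\<^sub>v x)
      \<le> ((1 - \<eta> * a / 128) * d + 5 * \<eta> * b * c\<^sup>2) * vec_norm x"
    by (simp add: n_def mult_ac)
qed (use Y in auto)

lemma core_increment:
  assumes Y: "Y \<in> carrier_mat p r" and op: "opnorm_le Y \<beta>"
    and D: "opnorm_le (gap Y) d" "0 \<le> d" and J: "opnorm_le (rest Y) c" "0 \<le> c"
  shows "opnorm_le (core (gd_step X \<eta> Y) - core Y) (\<eta> * \<beta> * (d + c\<^sup>2))"
proof (rule opnorm_leI[of _ r r])
  fix v :: "real vec" assume v: "v \<in> carrier_vec r"
  have K: "core Y \<in> carrier_mat r r" and K': "core (gd_step X \<eta> Y) \<in> carrier_mat r r"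
    and Dc: "gap Y \<in> carrier_mat r r" and RT: "(rest Y)\<^sup>T \<in> carrier_mat r p"
    using Y by auto
  let ?P = "(rest Y)\<^sup>T *\<^sub>v (rest Y *\<^sub>v v)"
  have oK: "opnorm_le (core Y) \<beta>" by (rule opnorm_core[OF Y op])
  have P: "?P \<in> carrier_vec r" using RT by simp
  have "(core (gd_step X \<eta> Y) - core Y) *\<^sub>v v = core (gd_step X \<eta> Y) *\<^sub>v v - core Y *\<^sub>v v"
    using K K' v by (intro minus_mult_distrib_mat_vec[of _ r r])
  also have "\<dots> = \<eta> \<cdot>\<^sub>v (gap Y *\<^sub>v (core Y *\<^sub>v v)) - \<eta> \<cdot>\<^sub>v (core Y *\<^sub>v ?P)"
  proof -
    have "x + y - z - x = y - z"
      if "x \<in> carrier_vec r" "y \<in> carrier_vec r" "z \<in> carrier_vec r" for x y z :: "real vec"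
      using that by (intro eq_vecI) auto
    then show ?thesis unfolding core_step_gap_vec[OF Y v] using K Dc by simp
  qed
  also have "vec_norm \<dots> \<le> \<eta> * (d * (\<beta> * vec_norm v)) + \<eta> * (\<beta> * (c\<^sup>2 * vec_norm v))"
    using K Dc P D \<beta> eta_pos v
    by (intro vec_norm_diff_le[of _ r] vec_norm_smult_le opnorm_le_apply[OF D(1) Dc]
        opnorm_le_apply[OF oK K] rest_gram_le[OF Y J]) auto
  finally show "vec_norm ((core (gd_step X \<eta> Y) - core Y) *\<^sub>v v) \<le> \<eta> * \<beta> * (d + c\<^sup>2) * vec_norm v"
    by (simp add: algebra_simps)
qed (use Y in \<open>auto intro!: minus_carrier_mat\<close>)

end

section \<open>Linear convergence\<close>

text \<open>This is \<open>1 - \<eta> * a / 128\<close> for the stepsize of the locale. It stands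
  outside the locale because the constant of the theorem is fixed before \<open>p\<close>,
  \<open>U\<close> and \<open>S\<close>.\<close>

definition gd_rate :: "real \<Rightarrow> real \<Rightarrow> real" where
  "gd_rate a b = 1 - a / (2000 * b\<^sup>2) * a / 128"

text \<open>The outer \<open>r\<close> comes from the Frobenius norm and \<open>r * r\<close> from
  passing from entries to operator bounds. The quotient sums the geometric series of the increments
  of K, and the final \<open>sqrt (2 * b)\<close> bounds J.\<close>

definition gd_const :: "real \<Rightarrow> real \<Rightarrow> nat \<Rightarrow> real" where
  "gd_const a b r = real r * (real r * real r *
     (a / (2000 * b\<^sup>2) * sqrt (2 * b) * (5 * b + 1280 * b\<^sup>2 / a) / (1 - gd_rate a b)) + sqrt (2 * b))"

context gradient_descent
begin

text \<open>The lower bound is put on the transpose because the gap multiplies K from the left,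
  which is where \<open>growth_step\<close> applies it.\<close>

definition invariant :: "real \<Rightarrow> real \<Rightarrow> real mat \<Rightarrow> bool" where
  "invariant c m Y \<longleftrightarrow> Y \<in> carrier_mat p r \<and> opnorm_le Y \<beta> \<and> opnorm_le (rest Y) c \<and>
     (\<forall>x \<in> carrier_vec r. m * vec_norm x \<le> vec_norm ((core Y)\<^sup>T *\<^sub>v x))"

text \<open>J is small against the initial bound \<open>m0\<close>. As \<open>m\<close> stays above
  \<open>m0\<close> and the bound \<open>c\<close> is kept, the same condition serves every later
  step.\<close>

lemma invariant_step:
  assumes inv: "invariant c m Y" and c: "0 \<le> c" "c\<^sup>2 \<le> a / 4" "c\<^sup>2 \<le> a * m0 / (2 * sqrt b)"
    and m: "0 < m0" "m0 \<le> m"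
  shows "invariant c (min (sqrt a / 8) (m * (1 + \<eta> * a / 16))) (gd_step X \<eta> Y)"
proof -
  have Y: "Y \<in> carrier_mat p r" and op: "opnorm_le Y \<beta>" and J: "opnorm_le (rest Y) c"
    and below: "\<And>x. x \<in> carrier_vec r \<Longrightarrow> m * vec_norm x \<le> vec_norm ((core Y)\<^sup>T *\<^sub>v x)"
    using inv by (auto simp: invariant_def)
  have "a * m0 / (2 * sqrt b) \<le> a * m / (2 * sqrt b)"
    using a b m by (intro divide_right_mono mult_left_mono) auto
  then have "c\<^sup>2 \<le> a * m / (2 * sqrt b)" using c by linarith
  then show ?thesis unfolding invariant_def
    using bounded_step[OF Y op] rest_step_nonincreasing[OF Y op J c(1)]
      growth_step[OF Y op J c(1,2) _ _ below] m Y by auto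
qed

text \<open>Once the cap is reached, another step only preserves it; below the cap each step
  multiplies the bound. The iterated minima collapse to one.\<close>

lemma invariant_growth:
  assumes inv: "invariant c m0 Y" and c: "0 \<le> c" "c\<^sup>2 \<le> a / 4" "c\<^sup>2 \<le> a * m0 / (2 * sqrt b)"
    and m: "0 < m0" "m0 \<le> sqrt a / 8"
  shows "invariant c (min (sqrt a / 8) (m0 * (1 + \<eta> * a / 16) ^ t)) ((gd_step X \<eta> ^^ t) Y)"
proof (induction t)
  case 0
  then show ?case using inv m by (simp add: min_absorb2)
next
  case (Suc t)
  define g where "g = 1 + \<eta> * a / 16"
  have g: "1 \<le> g" using eta_pos a by (simp add: g_def)
  have "m0 * 1 \<le> m0 * g ^ t" using m g by (intro mult_left_mono one_le_power) auto
  then have le: "m0 \<le> min (sqrt a / 8) (m0 * g ^ t)" using m by simp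
  have "min s (min s x * g) = min s (x * g)" if "0 \<le> s" for s x :: real
  proof (cases "s \<le> x")
    case True
    have "s * 1 \<le> s * g" using that g by (intro mult_left_mono)
    moreover have "s * g \<le> x * g" using True g by (intro mult_right_mono) auto
    ultimately show ?thesis using True by simp
  qed simp
  from this[of "sqrt a / 8" "m0 * g ^ t"]
  have "min (sqrt a / 8) (min (sqrt a / 8) (m0 * g ^ t) * g) = min (sqrt a / 8) (m0 * g ^ Suc t)"
    using a by (simp add: mult_ac)
  then show ?case
    using invariant_step[OF Suc.IH[folded g_def] c m(1) le] by (simp add: g_def)
qed

lemma invariant_floor:
  assumes inv: "invariant c (sqrt a / 8) Y" and c: "0 \<le> c" "c\<^sup>2 \<le> a / 4" "c\<^sup>2 \<le> a * (sqrt a / 8) / (2 * sqrt b)"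
  shows "invariant c (sqrt a / 8) ((gd_step X \<eta> ^^ t) Y)"
proof -
  have "sqrt a / 8 * 1 \<le> sqrt a / 8 * (1 + \<eta> * a / 16) ^ t"
    using a eta_pos by (intro mult_left_mono one_le_power) auto
  then have "min (sqrt a / 8) (sqrt a / 8 * (1 + \<eta> * a / 16) ^ t) = sqrt a / 8"
    by (intro min_absorb1) simp
  then show ?thesis using invariant_growth[OF inv c, of t] a by (metis divide_pos_pos order_refl real_sqrt_gt_zero zero_less_numeral)
qed

text \<open>1 - \<eta> a / 64 is the rate of |J|^2, and its square root that of |J|. Since (1 -
  u/128)^2 \<ge> 1 - u/64, the rate of the gap dominates both.\<close>

lemma rate: "gd_rate a b = 1 - \<eta> * a / 128" "0 < gd_rate a b" "gd_rate a b < 1"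
    "1 - \<eta> * a / 64 \<le> gd_rate a b" "0 < 1 - \<eta> * a / 64" "sqrt (1 - \<eta> * a / 64) \<le> gd_rate a b"
proof -
  show eq: "gd_rate a b = 1 - \<eta> * a / 128" by (simp add: gd_rate_def \<eta>)
  have u: "0 < \<eta> * a" using eta_pos a by simp
  show "0 < gd_rate a b" "gd_rate a b < 1" "1 - \<eta> * a / 64 \<le> gd_rate a b" "0 < 1 - \<eta> * a / 64"
    using u eta_a by (simp_all add: eq)
  have "1 - u / 64 \<le> (1 - u / 128)\<^sup>2" for u :: real
    using zero_le_square[of u] by (simp add: power2_eq_square algebra_simps)
  then show "sqrt (1 - \<eta> * a / 64) \<le> gd_rate a b"
    unfolding eq using u eta_a by (intro real_le_lsqrt) auto
qed

text \<open>The constant \<open>E\<close> solves \<open>E (\<rho>' - \<rho>) = 10 \<eta> b\<^sup>2\<close> for the two rates \<open>\<rho>'\<close> and \<open>\<rho>\<close>, so that the term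
  by which \<open>J\<close> disturbs the gap is absorbed exactly.\<close>

lemma contraction:
  assumes inv: "invariant c (sqrt a / 8) Y" and c: "0 \<le> c" "c\<^sup>2 \<le> a / 4" "c\<^sup>2 \<le> a * (sqrt a / 8) / (2 * sqrt b)"
  defines "E \<equiv> 1280 * b\<^sup>2 / a"
  shows "opnorm_le (rest ((gd_step X \<eta> ^^ t) Y)) (\<beta> * sqrt (1 - \<eta> * a / 64) ^ t) \<and>
    opnorm_le (gap ((gd_step X \<eta> ^^ t) Y)) ((3 * b + E) * gd_rate a b ^ t - E * (1 - \<eta> * a / 64) ^ t)"
proof (induction t)
  case 0
  have "c\<^sup>2 \<le> \<beta>\<^sup>2" using c ab b by (simp add: \<beta>)
  then have "c \<le> \<beta>" by (rule power2_le_imp_le) (use \<beta>(1) in simp)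
  then have "opnorm_le (rest Y) \<beta>" using inv opnorm_le_mono by (auto simp: invariant_def)
  moreover have "opnorm_le (gap Y) (3 * b)" using inv opnorm_gap by (auto simp: invariant_def)
  ultimately show ?case by simp
next
  case (Suc t)
  define Z where "Z = (gd_step X \<eta> ^^ t) Y"
  define \<rho> q where "\<rho> = 1 - \<eta> * a / 64" and "q = gd_rate a b"
  have \<rho>: "0 < \<rho>" "\<rho> \<le> q" using rate by (auto simp: \<rho>_def q_def)
  have E: "0 \<le> E" using a by (simp add: E_def)
  have inv_t: "invariant c (sqrt a / 8) Z" unfolding Z_def by (rule invariant_floor[OF inv c])
  have Z: "Z \<in> carrier_mat p r" and op: "opnorm_le Z \<beta>"
    and below: "\<And>x. x \<in> carrier_vec r \<Longrightarrow> sqrt a / 8 * vec_norm x \<le> vec_norm ((core Z)\<^sup>T *\<^sub>v x)"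
    using inv_t by (auto simp: invariant_def)
  have J: "opnorm_le (rest Z) (\<beta> * sqrt \<rho> ^ t)"
    and D: "opnorm_le (gap Z) ((3 * b + E) * q ^ t - E * \<rho> ^ t)"
    using Suc.IH by (auto simp: Z_def \<rho>_def q_def)
  have J0: "0 \<le> \<beta> * sqrt \<rho> ^ t" using \<beta>(1) \<rho> by simp
  have "opnorm_le (rest (gd_step X \<eta> Z)) (\<beta> * sqrt \<rho> ^ t * sqrt (1 - \<eta> * (sqrt a / 8)\<^sup>2))"
  proof (rule rest_step[OF Z op J J0])
    fix v :: "real vec" assume v: "v \<in> carrier_vec r"
    \<comment> \<open>The invariant bounds K^T, whereas the decay of J needs K itself.\<close>
    show "sqrt a / 8 * vec_norm v \<le> vec_norm (core Z *\<^sub>v v)"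
      using bounded_below_transpose[of "(core Z)\<^sup>T" r "sqrt a / 8" v] Z below v a by simp
  qed (use a in simp)
  also have "sqrt (1 - \<eta> * (sqrt a / 8)\<^sup>2) = sqrt \<rho>" using a by (simp add: \<rho>_def power_divide)
  finally have rest: "opnorm_le (rest (gd_step X \<eta> Z)) (\<beta> * sqrt \<rho> ^ Suc t)" by (simp add: mult_ac)
  have sq: "(\<beta> * sqrt \<rho> ^ t)\<^sup>2 = 2 * b * \<rho> ^ t"
    using \<rho> by (simp add: power_mult_distrib \<beta> power_mult[symmetric] mult.commute[of t])
      (simp add: power_mult)
  have \<rho>t: "\<rho> ^ t \<le> q ^ t" "\<rho> ^ t \<le> 1" "0 \<le> \<rho> ^ t"
    using \<rho> rate by (auto intro!: power_mono power_le_one simp: q_def)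
  have "0 \<le> 3 * b * q ^ t" using b rate by (simp add: q_def less_imp_le)
  moreover have "E * \<rho> ^ t \<le> E * q ^ t" using \<rho>t E by (intro mult_left_mono)
  ultimately have d: "0 \<le> (3 * b + E) * q ^ t - E * \<rho> ^ t" by (simp add: distrib_right)
  have "opnorm_le (gap (gd_step X \<eta> Z))
      ((1 - \<eta> * a / 128) * ((3 * b + E) * q ^ t - E * \<rho> ^ t) + 5 * \<eta> * b * (\<beta> * sqrt \<rho> ^ t)\<^sup>2)"
  proof (rule gap_step[OF Z op D d J J0 _ below])
    show "(\<beta> * sqrt \<rho> ^ t)\<^sup>2 \<le> 2 * b" unfolding sq using \<rho>t b by simp
  qed
  also have "(1 - \<eta> * a / 128) * ((3 * b + E) * q ^ t - E * \<rho> ^ t) + 5 * \<eta> * b * (\<beta> * sqrt \<rho> ^ t)\<^sup>2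
      = (3 * b + E) * q ^ Suc t - E * \<rho> ^ Suc t"
  proof -
    have Ea: "E * (\<eta> * a / 128) = 10 * \<eta> * b\<^sup>2" using a by (simp add: E_def)
    have "E * \<rho> ^ Suc t = E * q * \<rho> ^ t - E * (\<eta> * a / 128) * \<rho> ^ t"
      by (simp add: q_def rate(1) \<rho>_def algebra_simps)
    then show ?thesis unfolding sq Ea rate(1)[symmetric] q_def[symmetric]
      by (simp add: power2_eq_square algebra_simps)
  qed
  finally show ?case using rest by (simp add: Z_def \<rho>_def q_def)
qed

lemma gd_converges:
  assumes inv: "invariant c (sqrt a / 8) Y" and c: "0 \<le> c" "c\<^sup>2 \<le> a / 4" "c\<^sup>2 \<le> a * (sqrt a / 8) / (2 * sqrt b)"
  obtains L where "L \<in> carrier_mat r r" "L * L\<^sup>T = S"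
    and "\<And>t. frob_norm (U * L - (gd_step X \<eta> ^^ t) Y) \<le> gd_const a b r * gd_rate a b ^ t"
proof -
  define E where "E = 1280 * b\<^sup>2 / a"
  define \<rho> q where "\<rho> = 1 - \<eta> * a / 64" and "q = gd_rate a b"
  define Z where "Z t = (gd_step X \<eta> ^^ t) Y" for t
  define B where "B = \<eta> * \<beta> * (5 * b + E)"
  have E: "0 \<le> E" using a by (simp add: E_def)
  have B: "0 \<le> B" using eta_pos \<beta>(1) b E by (simp add: B_def)
  have q: "0 < q" "q < 1" "\<rho> \<le> q" "0 < \<rho>" "sqrt \<rho> \<le> q" using rate by (auto simp: q_def \<rho>_def)
  have Z_Suc: "Z (Suc t) = gd_step X \<eta> (Z t)" for t by (simp add: Z_def)
  have inv_t: "invariant c (sqrt a / 8) (Z t)" for t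
    unfolding Z_def by (rule invariant_floor[OF inv c])
  have Z: "Z t \<in> carrier_mat p r" and op: "opnorm_le (Z t) \<beta>" for t
    using inv_t by (auto simp: invariant_def)
  have K: "core (Z t) \<in> carrier_mat r r" for t using Z by simp
  have J: "opnorm_le (rest (Z t)) (\<beta> * q ^ t)" for t
  proof (rule opnorm_le_mono)
    show "opnorm_le (rest (Z t)) (\<beta> * sqrt \<rho> ^ t)"
      using contraction[OF inv c] by (simp add: Z_def \<rho>_def)
    show "\<beta> * sqrt \<rho> ^ t \<le> \<beta> * q ^ t" using q \<beta>(1) by (intro mult_left_mono power_mono) auto
  qed
  have D: "opnorm_le (gap (Z t)) ((3 * b + E) * q ^ t)" for t
  proof (rule opnorm_le_mono)
    show "opnorm_le (gap (Z t)) ((3 * b + E) * q ^ t - E * \<rho> ^ t)"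
      using contraction[OF inv c] by (simp add: Z_def \<rho>_def q_def E_def)
    show "(3 * b + E) * q ^ t - E * \<rho> ^ t \<le> (3 * b + E) * q ^ t" using E q by simp
  qed
  have incr: "opnorm_le (core (Z (Suc t)) - core (Z t)) (B * q ^ t)" for t
  proof (rule opnorm_le_mono)
    show "opnorm_le (core (Z (Suc t)) - core (Z t)) (\<eta> * \<beta> * ((3 * b + E) * q ^ t + (\<beta> * q ^ t)\<^sup>2))"
      unfolding Z_Suc using b E q \<beta>(1) by (intro core_increment Z op D J) auto
    \<comment> \<open>J enters the increment of K squared; one of the two factors
      \<open>q ^ t\<close> is bounded by 1.\<close>
    have "(\<beta> * q ^ t)\<^sup>2 = 2 * b * (q ^ t * q ^ t)" by (simp add: power_mult_distrib \<beta>) (simp add: power2_eq_square)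
    also have "\<dots> \<le> 2 * b * (1 * q ^ t)"
      using q b by (intro mult_left_mono mult_right_mono power_le_one) auto
    finally have "\<eta> * \<beta> * ((3 * b + E) * q ^ t + (\<beta> * q ^ t)\<^sup>2) \<le> \<eta> * \<beta> * ((3 * b + E) * q ^ t + 2 * b * q ^ t)"
      using eta_pos \<beta>(1) by (intro mult_left_mono add_left_mono) auto
    then show "\<eta> * \<beta> * ((3 * b + E) * q ^ t + (\<beta> * q ^ t)\<^sup>2) \<le> B * q ^ t"
      by (simp add: B_def algebra_simps)
  qed
  \<comment> \<open>Convergence is taken entry by entry; returning to operator bounds costs the
    factor \<open>r * r\<close>.\<close>
  have "\<exists>l. (\<lambda>t. core (Z t) $$ (i, j)) \<longlonglongrightarrow> l \<and> (\<forall>t. \<bar>l - core (Z t) $$ (i, j)\<bar> \<le> B / (1 - q) * q ^ t)"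
    if ij: "i < r" "j < r" for i j
  proof -
    have "\<bar>core (Z (Suc t)) $$ (i, j) - core (Z t) $$ (i, j)\<bar> \<le> B * q ^ t" for t
      using abs_index_mat_le_opnorm[OF incr minus_carrier_mat[OF K] ij, of t] K[of t] ij by auto
    then show ?thesis using geometric_steps_converge[of "\<lambda>t. core (Z t) $$ (i, j)" B q] q
      by (metis less_imp_le)
  qed
  then obtain l where l: "\<And>i j. i < r \<Longrightarrow> j < r \<Longrightarrow> (\<lambda>t. core (Z t) $$ (i, j)) \<longlonglongrightarrow> l i j"
    and l_le: "\<And>i j t. i < r \<Longrightarrow> j < r \<Longrightarrow> \<bar>l i j - core (Z t) $$ (i, j)\<bar> \<le> B / (1 - q) * q ^ t"
    by metis
  define L where "L = Matrix.mat r r (\<lambda>(i, j). l i j)"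
  have L: "L \<in> carrier_mat r r" by (simp add: L_def)
  \<comment> \<open>Uniqueness of limits: K K^T tends to L L^T by continuity and to S because the
    gap tends to 0.\<close>
  have "(L * L\<^sup>T) $$ (i, j) = S $$ (i, j)" if ij: "i < r" "j < r" for i j
  proof (rule LIMSEQ_unique)
    have "(\<lambda>t. \<Sum>k<r. core (Z t) $$ (i, k) * core (Z t) $$ (j, k)) \<longlonglongrightarrow> (\<Sum>k<r. l i k * l j k)"
      using ij by (intro tendsto_intros l) auto
    moreover have "(core (Z t) * (core (Z t))\<^sup>T) $$ (i, j) = (\<Sum>k<r. core (Z t) $$ (i, k) * core (Z t) $$ (j, k))" for t
      using K[of t] ij by (auto simp: scalar_prod_def atLeast0LessThan)
    moreover have "(L * L\<^sup>T) $$ (i, j) = (\<Sum>k<r. l i k * l j k)"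
      using ij by (simp add: L_def scalar_prod_def atLeast0LessThan)
    ultimately show "(\<lambda>t. (core (Z t) * (core (Z t))\<^sup>T) $$ (i, j)) \<longlonglongrightarrow> (L * L\<^sup>T) $$ (i, j)" by simp
    have "\<bar>S $$ (i, j) - (core (Z t) * (core (Z t))\<^sup>T) $$ (i, j)\<bar> \<le> (3 * b + E) * q ^ t" for t
    proof -
      have "gap (Z t) $$ (i, j) = S $$ (i, j) - (core (Z t) * (core (Z t))\<^sup>T) $$ (i, j)"
        unfolding gap_def using K[of t] ij by (intro index_minus_mat) auto
      then show ?thesis using abs_index_mat_le_opnorm[OF D carriers(3)[OF Z] ij, of t] by simp
    qed
    then have bound: "\<forall>\<^sub>F t in sequentially. norm (S $$ (i, j) - (core (Z t) * (core (Z t))\<^sup>T) $$ (i, j)) \<le> (3 * b + E) * q ^ t"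
      by (intro always_eventually allI) (simp only: real_norm_def)
    have "(\<lambda>t. (3 * b + E) * q ^ t) \<longlonglongrightarrow> (3 * b + E) * 0"
      by (rule tendsto_mult[OF tendsto_const LIMSEQ_realpow_zero]) (use q in auto)
    then have "(\<lambda>t. (3 * b + E) * q ^ t) \<longlonglongrightarrow> 0" by simp
    with bound have "(\<lambda>t. S $$ (i, j) - (core (Z t) * (core (Z t))\<^sup>T) $$ (i, j)) \<longlonglongrightarrow> 0"
      by (rule Lim_null_comparison)
    from tendsto_diff[OF tendsto_const[of "S $$ (i, j)"] this]
    show "(\<lambda>t. (core (Z t) * (core (Z t))\<^sup>T) $$ (i, j)) \<longlonglongrightarrow> S $$ (i, j)" by simp
  qed
  then have LLT: "L * L\<^sup>T = S" using L S by (intro eq_matI) auto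
  have "frob_norm (U * L - Z t) \<le> gd_const a b r * q ^ t" for t
  proof -
    define e where "e = real r * real r * (B / (1 - q) * q ^ t)"
    have e: "0 \<le> e" using B q by (simp add: e_def)
    have LK: "L - core (Z t) \<in> carrier_mat r r" using L K[of t] by auto
    have oLK: "opnorm_le (L - core (Z t)) e" unfolding e_def
    proof (rule opnorm_le_entries[OF LK])
      fix i j assume ij: "i < r" "j < r"
      then have "(L - core (Z t)) $$ (i, j) = l i j - core (Z t) $$ (i, j)"
        using K[of t] by (simp add: L_def)
      then show "\<bar>(L - core (Z t)) $$ (i, j)\<bar> \<le> B / (1 - q) * q ^ t" using l_le[OF ij] by simp
    qed (use B q in simp)
    have M: "U * L - Z t \<in> carrier_mat p r" using Z[of t] by auto
    have "opnorm_le (U * L - Z t) (e + \<beta> * q ^ t)"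
    proof (rule opnorm_leI[OF M])
      fix v :: "real vec" assume v: "v \<in> carrier_vec r"
      have UL: "U * L \<in> carrier_mat p r" using U L by auto
      have J_car: "rest (Z t) \<in> carrier_mat p r" using Z by simp
      have "(U * L - Z t) *\<^sub>v v = (U * L) *\<^sub>v v - Z t *\<^sub>v v"
        using UL Z[of t] v by (intro minus_mult_distrib_mat_vec[of _ p r])
      also have "(U * L) *\<^sub>v v = U *\<^sub>v (L *\<^sub>v v)" using U L v by (intro assoc_mult_mat_vec[of _ p r]) auto
      \<comment> \<open>Splitting the iterate as U K + J turns the error into U (L - K) - J, and
        both parts decay.\<close>
      also have "U *\<^sub>v (L *\<^sub>v v) - Z t *\<^sub>v v = U *\<^sub>v ((L - core (Z t)) *\<^sub>v v) - rest (Z t) *\<^sub>v v"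
      proof -
        have "(L - core (Z t)) *\<^sub>v v = L *\<^sub>v v - core (Z t) *\<^sub>v v"
          using L K[of t] v by (intro minus_mult_distrib_mat_vec[of _ r r])
        then have "U *\<^sub>v ((L - core (Z t)) *\<^sub>v v) = U *\<^sub>v (L *\<^sub>v v) - U *\<^sub>v (core (Z t) *\<^sub>v v)"
          using U L K[of t] by (simp add: mv_minus)
        moreover have "x - z = (x - y) - (z - y)"
          if "x \<in> carrier_vec p" "y \<in> carrier_vec p" "z \<in> carrier_vec p" for x y z :: "real vec"
          using that by (intro eq_vecI) auto
        ultimately show ?thesis using rest_vec[OF Z v] U Z[of t] by simp
      qed
      finally have eq: "(U * L - Z t) *\<^sub>v v = U *\<^sub>v ((L - core (Z t)) *\<^sub>v v) - rest (Z t) *\<^sub>v v" .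
      have "vec_norm ((L - core (Z t)) *\<^sub>v v) \<le> e * vec_norm v" by (rule opnorm_leD[OF oLK LK v])
      then have "vec_norm (U *\<^sub>v ((L - core (Z t)) *\<^sub>v v)) \<le> 1 * (e * vec_norm v)"
        using LK by (intro opnorm_le_apply[OF opnorm_U U]) auto
      moreover have "vec_norm (rest (Z t) *\<^sub>v v) \<le> \<beta> * q ^ t * vec_norm v"
        by (rule opnorm_leD[OF J J_car v])
      ultimately show "vec_norm ((U * L - Z t) *\<^sub>v v) \<le> (e + \<beta> * q ^ t) * vec_norm v"
        unfolding eq distrib_right using U J_car by (intro vec_norm_diff_le[of _ p]) auto
    qed
    then have "frob_norm (U * L - Z t) \<le> real r * (e + \<beta> * q ^ t)"
      using M e \<beta>(1) q by (intro frob_norm_le_opnorm[of _ _ p]) auto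
    also have "\<dots> = real r * (real r * real r * (B / (1 - q)) + \<beta>) * q ^ t"
      unfolding e_def distrib_right[of _ _ "q ^ t"] by (simp only: mult.assoc distrib_right)
    also have "real r * (real r * real r * (B / (1 - q)) + \<beta>) = gd_const a b r"
      by (simp add: gd_const_def B_def E_def q_def \<beta>_def \<eta>)
    finally show ?thesis .
  qed
  then show ?thesis using that[OF L LLT] by (simp add: Z_def q_def)
qed

end

section \<open>Iteration counts and the distance to the target\<close>

text \<open>\<open>C\<close> depends on \<open>g\<close> and \<open>A\<close> only. The maximum with
  1 absorbs the rounding and ln A; a negative quotient of logarithms is rounded to 0 steps.\<close>

lemma geometric_count:
  fixes g A :: real
  assumes g: "1 < g" and A: "0 < A"
  obtains C :: real where "0 \<le> C"
    and "\<And>s. 0 < s \<Longrightarrow> \<exists>n. A \<le> s * g ^ n \<and> real n \<le> C * max 1 (ln (1 / s))"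
proof -
  have lg: "0 < ln g" using g by simp
  define C where "C = 1 + (\<bar>ln A\<bar> + 1) / ln g"
  have "\<exists>n. A \<le> s * g ^ n \<and> real n \<le> C * max 1 (ln (1 / s))" if s: "0 < s" for s
  proof -
    define M where "M = max 1 (ln (1 / s))"
    define n where "n = nat \<lceil>ln (A / s) / ln g\<rceil>"
    have M: "1 \<le> M" "ln (1 / s) \<le> M" by (simp_all add: M_def)
    have "ln (A / s) / ln g \<le> real n" unfolding n_def by linarith
    then have "ln (A / s) \<le> real n * ln g" using lg by (simp add: divide_le_eq)
    also have "\<dots> = ln (g ^ n)" using g by (simp add: ln_realpow)
    finally have "A / s \<le> g ^ n" using A s g by (subst (asm) ln_le_cancel_iff) auto
    then have 1: "A \<le> s * g ^ n" using s by (simp add: divide_le_eq mult.commute)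
    have "ln (A / s) = ln A + ln (1 / s)" using A s by (simp add: ln_div)
    also have "\<dots> \<le> \<bar>ln A\<bar> * M + M"
    proof (intro add_mono M)
      have "\<bar>ln A\<bar> * 1 \<le> \<bar>ln A\<bar> * M" using M by (intro mult_left_mono) auto
      then show "ln A \<le> \<bar>ln A\<bar> * M" by linarith
    qed
    finally have "ln (A / s) / ln g \<le> (\<bar>ln A\<bar> * M + M) / ln g" using lg by (intro divide_right_mono) auto
    also have "\<dots> = (\<bar>ln A\<bar> + 1) / ln g * M" by (simp add: distrib_right)
    finally have le: "ln (A / s) / ln g \<le> (\<bar>ln A\<bar> + 1) / ln g * M" .
    have "0 \<le> (\<bar>ln A\<bar> + 1) / ln g * M" using lg M by simp
    then have "real n \<le> 1 + (\<bar>ln A\<bar> + 1) / ln g * M" using le unfolding n_def by linarith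
    also have "\<dots> \<le> C * M" using M by (simp add: C_def distrib_right)
    finally show ?thesis using 1 by (auto simp: M_def)
  qed
  moreover have "0 \<le> C" using lg by (simp add: C_def)
  ultimately show ?thesis using that by blast
qed

lemma gd_rate_bounds:
  assumes "0 < a" "a \<le> b"
  shows "0 < gd_rate a b" "gd_rate a b < 1"
proof -
  have "a * a \<le> b * b" using assms by (intro mult_mono) auto
  moreover have "0 < a * a" "0 < b * b" using assms by auto
  ultimately have "0 < a * a / (b * b)" "a * a / (b * b) \<le> 1" by (auto simp: divide_le_eq)
  moreover have "gd_rate a b = 1 - a * a / (b * b) / 256000" by (simp add: gd_rate_def power2_eq_square)
  ultimately show "0 < gd_rate a b" "gd_rate a b < 1" by simp_all
qed

lemma gd_const_pos:
  assumes "0 < a" "a \<le> b" "0 < r"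
  shows "0 < gd_const a b r"
proof -
  have "0 < a / (2000 * b\<^sup>2) * sqrt (2 * b) * (5 * b + 1280 * b\<^sup>2 / a) / (1 - gd_rate a b)"
    using assms gd_rate_bounds[OF assms(1,2)]
    by (intro divide_pos_pos mult_pos_pos add_pos_pos) auto
  then show ?thesis unfolding gd_const_def using assms
    by (intro mult_pos_pos add_pos_pos) auto
qed

text \<open>\<open>n1\<close> raises \<sigma> / 4 to the threshold sqrt(a) / 8, and
  \<open>n2\<close> contracts to accuracy \<open>\<epsilon>\<close>. The 5 is made of three calls of
  the subroutine, one extra step before it and one step after it.\<close>

lemma gd_iteration_count:
  assumes a: "0 < a" "a \<le> b" and r: "0 < r"
  obtains C :: real where "0 \<le> C"
    and "\<And>\<sigma> \<epsilon>. 0 < \<sigma> \<Longrightarrow> 0 < \<epsilon> \<Longrightarrow> \<exists>n1 n2.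
      sqrt a / 2 \<le> \<sigma> * (1 + a / (2000 * b\<^sup>2) * a / 16) ^ n1 \<and> gd_const a b r * gd_rate a b ^ n2 \<le> \<epsilon> \<and>
      real (n1 + n2 + 5) \<le> C * (max 1 (ln (1 / \<sigma>)) + max 1 (ln (1 / \<epsilon>)))"
proof -
  have q: "0 < gd_rate a b" "gd_rate a b < 1" by (rule gd_rate_bounds[OF a])+
  have "1 < 1 + a / (2000 * b\<^sup>2) * a / 16" "0 < sqrt a / 2" using a by auto
  then obtain C1 where C1: "0 \<le> C1" and n1: "\<And>s. 0 < s \<Longrightarrow>
      \<exists>n. sqrt a / 2 \<le> s * (1 + a / (2000 * b\<^sup>2) * a / 16) ^ n \<and> real n \<le> C1 * max 1 (ln (1 / s))"
    using geometric_count by metis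
  have "1 < 1 / gd_rate a b" using q by (simp add: less_divide_eq)
  then obtain C2 where C2: "0 \<le> C2" and n2: "\<And>s. 0 < s \<Longrightarrow>
      \<exists>n. gd_const a b r \<le> s * (1 / gd_rate a b) ^ n \<and> real n \<le> C2 * max 1 (ln (1 / s))"
    using geometric_count[OF _ gd_const_pos[OF a r]] by metis
  show ?thesis
  proof (rule that[of "C1 + C2 + 5"])
    fix \<sigma> \<epsilon> :: real assume pos: "0 < \<sigma>" "0 < \<epsilon>"
    define M1 M2 where "M1 = max 1 (ln (1 / \<sigma>))" and "M2 = max 1 (ln (1 / \<epsilon>))"
    have M: "1 \<le> M1" "1 \<le> M2" by (simp_all add: M1_def M2_def)
    obtain n1 where *: "sqrt a / 2 \<le> \<sigma> * (1 + a / (2000 * b\<^sup>2) * a / 16) ^ n1" "real n1 \<le> C1 * M1"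
      using n1[OF pos(1)] by (auto simp: M1_def)
    obtain n2 where n2: "gd_const a b r \<le> \<epsilon> * (1 / gd_rate a b) ^ n2" "real n2 \<le> C2 * M2"
      using n2[OF pos(2)] by (auto simp: M2_def)
    have "gd_const a b r * gd_rate a b ^ n2 \<le> \<epsilon>"
      using n2(1) q by (simp add: power_divide le_divide_eq)
    moreover have "real (n1 + n2 + 5) \<le> (C1 + C2 + 5) * (M1 + M2)"
    proof -
      have "C1 * M1 \<le> C1 * (M1 + M2)" "C2 * M2 \<le> C2 * (M1 + M2)"
        using C1 C2 M by (auto intro!: mult_left_mono)
      then show ?thesis using * n2 M by (simp add: distrib_right)
    qed
    ultimately show "\<exists>n1 n2. sqrt a / 2 \<le> \<sigma> * (1 + a / (2000 * b\<^sup>2) * a / 16) ^ n1 \<and>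
      gd_const a b r * gd_rate a b ^ n2 \<le> \<epsilon> \<and>
      real (n1 + n2 + 5) \<le> (C1 + C2 + 5) * (max 1 (ln (1 / \<sigma>)) + max 1 (ln (1 / \<epsilon>)))"
      using * unfolding M1_def M2_def by blast
  qed (use C1 C2 in simp)
qed

section \<open>Column rank, orthogonal complements and diagonal matrices\<close>

lemma mat_mult_unit_vec:
  fixes A :: "real mat"
  assumes "A \<in> carrier_mat m n" "j < n"
  shows "A *\<^sub>v unit_vec n j = col A j"
  using assms by (intro eq_vecI) auto

text \<open>Linear independence is stated for the set of columns, which forgets repetitions.
  Distinctness is therefore settled first: two equal columns would put a difference of unit vectors
  into the kernel.\<close>

lemma full_col_rankI:
  assumes Y: "Y \<in> carrier_mat p r"
    and inj: "\<And>v. v \<in> carrier_vec r \<Longrightarrow> Y *\<^sub>v v = 0\<^sub>v p \<Longrightarrow> v = 0\<^sub>v r"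
  shows "Y \<in> full_col_rank p r"
proof -
  interpret vec_space "TYPE(real)" p .
  have dist: "distinct (cols Y)"
  proof (rule ccontr)
    assume "\<not> distinct (cols Y)"
    then obtain i j where ij: "i < r" "j < r" "i \<noteq> j" "col Y i = col Y j"
      using Y by (auto simp: distinct_conv_nth)
    have "Y *\<^sub>v (unit_vec r i - unit_vec r j) = col Y i - col Y j"
      using Y ij by (simp add: mult_minus_distrib_mat_vec[of _ p r] mat_mult_unit_vec)
    also have "\<dots> = 0\<^sub>v p" using ij Y by auto
    finally have "unit_vec r i - unit_vec r j = (0\<^sub>v r :: real vec)" by (intro inj) auto
    then have "(unit_vec r i - unit_vec r j) $ i = (0\<^sub>v r :: real vec) $ i" by simp
    then show False using ij by simp
  qed
  have "lin_indpt (set (cols Y))" using lin_depE[OF Y _ dist] inj by blast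
  then show ?thesis using lin_indpt_full_rank[OF Y dist] Y by (simp add: full_col_rank_def)
qed

text \<open>\<open>w\<close> lies in the column space of \<open>V\<close>, where V^T is isometric,
  while V^T U = 0. Applied to Y0 v, it shows that \<open>rest Y0\<close> and \<open>J0\<close> have
  the same norm on every vector.\<close>

lemma rest_norm_le:
  assumes V: "orth_compl_basis p r U V" and U: "U \<in> carrier_mat p r" and UTU: "U\<^sup>T * U = 1\<^sub>m r"
    and w: "w \<in> carrier_vec p" "U\<^sup>T *\<^sub>v w = 0\<^sub>v r" and y: "y = w + U *\<^sub>v z" "z \<in> carrier_vec r"
  shows "vec_norm w = vec_norm (V\<^sup>T *\<^sub>v y)"
proof -
  interpret vec_space "TYPE(real)" p .
  have Vc: "V \<in> carrier_mat p (p - r)" and VTV: "V\<^sup>T * V = 1\<^sub>m (p - r)"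
    and col: "col_space V = {v \<in> carrier_vec p. \<forall>u \<in> col_space U. v \<bullet> u = 0}"
    using V by (auto simp: orth_compl_basis_def)
  have colV: "col_space V = {y \<in> carrier_vec p. \<exists>x \<in> carrier_vec (p - r). V *\<^sub>v x = y}"
    and colU: "col_space U = {y \<in> carrier_vec p. \<exists>x \<in> carrier_vec r. U *\<^sub>v x = y}"
    using col_space_eq[of V] col_space_eq[of U] Vc U by auto
  have "w \<bullet> u = 0" if "u \<in> col_space U" for u
  proof -
    obtain x where x: "x \<in> carrier_vec r" "u = U *\<^sub>v x" using \<open>u \<in> col_space U\<close> colU by auto
    have "x \<bullet> (U\<^sup>T *\<^sub>v w) = u \<bullet> w" using scalar_prod_mult_transpose[OF U x(1) w(1)] x by simp
    moreover have "u \<in> carrier_vec p" using x U by auto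
    ultimately show ?thesis using comm_scalar_prod[OF w(1)] w(2) x(1) by simp
  qed
  then have "w \<in> col_space V" using w col by auto
  then obtain c where c: "c \<in> carrier_vec (p - r)" "V *\<^sub>v c = w" using colV by auto
  have VTw: "V\<^sup>T *\<^sub>v w = c"
    using c Vc VTV by (metis assoc_mult_mat_vec one_mult_mat_vec transpose_carrier_mat)
  define s where "s = V\<^sup>T *\<^sub>v (U *\<^sub>v z)"
  have s: "s \<in> carrier_vec (p - r)" using Vc U y by (auto simp: s_def)
  have "V *\<^sub>v s \<in> col_space V" using colV Vc s by auto
  moreover have "U *\<^sub>v z \<in> col_space U" using colU U y by auto
  ultimately have "(V *\<^sub>v s) \<bullet> (U *\<^sub>v z) = 0" using col by auto
  \<comment> \<open>V^T U z vanishes since its square is the product of V s with U z, and the two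
    column spaces are orthogonal.\<close>
  then have "s \<bullet> s = 0"
    using scalar_prod_mult_transpose[OF Vc s, of "U *\<^sub>v z"] U y by (auto simp: s_def)
  then have s0: "s = 0\<^sub>v (p - r)" using vec_norm_zero_iff[OF s] by (simp add: vec_norm_def)
  have "V\<^sup>T *\<^sub>v y = V\<^sup>T *\<^sub>v w + s"
    unfolding y(1) s_def using Vc U w y by (intro mult_add_distrib_mat_vec[of _ "p - r" p]) auto
  then have "V\<^sup>T *\<^sub>v y = c" using VTw s0 c by simp
  moreover have "(vec_norm w)\<^sup>2 = (vec_norm c)\<^sup>2"
    using scalar_prod_mult_transpose[OF Vc c(1) w(1)] VTw c by (simp add: vec_norm_power2)
  ultimately show ?thesis by simp
qed

lemma diagonal_mult_vec:
  fixes S :: "real mat"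
  assumes "S \<in> carrier_mat r r" "diagonal_mat S" "x \<in> carrier_vec r" "i < r"
  shows "(S *\<^sub>v x) $ i = S $$ (i, i) * x $ i"
proof -
  have "(S *\<^sub>v x) $ i = (\<Sum>j<r. S $$ (i, j) * x $ j)"
    using assms by (simp add: scalar_prod_def atLeast0LessThan)
  also have "\<dots> = (\<Sum>j<r. if j = i then S $$ (i, i) * x $ i else 0)"
    using assms by (intro sum.cong) (auto simp: diagonal_mat_def)
  finally show ?thesis using assms by simp
qed

lemma gradient_descent_diagonal:
  assumes U: "U \<in> carrier_mat p r" "U\<^sup>T * U = 1\<^sub>m r"
    and S: "S \<in> carrier_mat r r" "diagonal_mat S"
    and S_bounds: "\<And>i. i < r \<Longrightarrow> a \<le> S $$ (i, i)" "\<And>i. i < r \<Longrightarrow> S $$ (i, i) \<le> b"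
    and a: "0 < a" "a \<le> b"
  shows "gradient_descent p r U S a b (a / (2000 * b\<^sup>2))"
proof
  show "S\<^sup>T = S" using S by (intro eq_matI) (auto simp: diagonal_mat_def, metis)
  show "opnorm_le S b"
  proof (rule opnorm_leI[OF S(1)])
    fix x :: "real vec" assume x: "x \<in> carrier_vec r"
    have "(vec_norm (S *\<^sub>v x))\<^sup>2 = (\<Sum>i<r. ((S *\<^sub>v x) $ i)\<^sup>2)"
      unfolding vec_norm_power2 using S x
      by (simp add: scalar_prod_def power2_eq_square atLeast0LessThan del: index_mult_mat_vec)
    also have "\<dots> \<le> (\<Sum>i<r. b\<^sup>2 * (x $ i)\<^sup>2)"
    proof (rule sum_mono)
      fix i assume "i \<in> {..<r}"
      then have i: "i < r" by simp
      have "(S $$ (i, i))\<^sup>2 \<le> b\<^sup>2" using S_bounds[OF i] a by (intro power_mono) auto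
      then show "((S *\<^sub>v x) $ i)\<^sup>2 \<le> b\<^sup>2 * (x $ i)\<^sup>2"
        unfolding diagonal_mult_vec[OF S x i] power_mult_distrib by (intro mult_right_mono) auto
    qed
    also have "\<dots> = (b * vec_norm x)\<^sup>2"
      unfolding power_mult_distrib vec_norm_power2 using x
      by (simp add: scalar_prod_def power2_eq_square atLeast0LessThan sum_distrib_left)
    finally show "vec_norm (S *\<^sub>v x) \<le> b * vec_norm x"
      by (rule power2_le_imp_le) (use a in simp)
  qed
  show "a * (vec_norm x)\<^sup>2 \<le> x \<bullet> (S *\<^sub>v x)" if x: "x \<in> carrier_vec r" for x
  proof -
    have "a * (vec_norm x)\<^sup>2 = (\<Sum>i<r. a * (x $ i * x $ i))"
      unfolding vec_norm_power2 using x by (simp add: scalar_prod_def atLeast0LessThan sum_distrib_left)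
    also have "\<dots> \<le> (\<Sum>i<r. x $ i * (S *\<^sub>v x) $ i)"
    proof (rule sum_mono)
      fix i assume "i \<in> {..<r}"
      then have i: "i < r" by simp
      have "a * (x $ i * x $ i) \<le> S $$ (i, i) * (x $ i * x $ i)"
        using S_bounds(1)[OF i] by (intro mult_right_mono) auto
      then show "a * (x $ i * x $ i) \<le> x $ i * (S *\<^sub>v x) $ i"
        unfolding diagonal_mult_vec[OF S x i] by (simp add: mult_ac)
    qed
    also have "\<dots> = x \<bullet> (S *\<^sub>v x)"
      using S x by (simp add: scalar_prod_def atLeast0LessThan)
    finally show ?thesis .
  qed
qed (use assms in auto)

section \<open>Diagonal square roots and factors of the target\<close>

lemma map_sqrt_diagonal:
  assumes "S \<in> carrier_mat r r" "diagonal_mat S"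
  shows "map_mat sqrt S = mat_diag r (\<lambda>i. sqrt (S $$ (i, i)))"
  using assms by (intro eq_matI) (auto simp: mat_diag_def diagonal_mat_def)

lemma diagonal_eq_mat_diag:
  assumes "S \<in> carrier_mat r r" "diagonal_mat S"
  shows "S = mat_diag r (\<lambda>i. S $$ (i, i))"
  using assms by (intro eq_matI) (auto simp: mat_diag_def diagonal_mat_def)

lemma transpose_mat_diag [simp]: "(mat_diag n f)\<^sup>T = mat_diag n f"
  by (intro eq_matI) (auto simp: mat_diag_def)

lemma mat_diag_cong: "(\<And>i. i < n \<Longrightarrow> f i = g i) \<Longrightarrow> mat_diag n f = mat_diag n g"
  by (intro eq_matI) (auto simp: mat_diag_def)

lemma quot_dist_le:
  assumes "Q \<in> orth_group (dim_col Y)"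
  shows "quot_dist Y Ystar \<le> frob_norm (Ystar * Q - Y)"
  unfolding quot_dist_def using assms by (intro cINF_lower) (auto intro!: bdd_belowI[of _ 0])

text \<open>A factor \<open>L\<close> of \<open>S\<close> differs from \<open>S\<^sup>1\<^sup>/\<^sup>2\<close> by the orthogonal matrix \<open>S\<^sup>-\<^sup>1\<^sup>/\<^sup>2 L\<close>.\<close>

lemma quot_dist_le_factor:
  assumes U: "U \<in> carrier_mat p r" and S: "S \<in> carrier_mat r r" "diagonal_mat S"
    and pos: "\<And>i. i < r \<Longrightarrow> 0 < S $$ (i, i)"
    and L: "L \<in> carrier_mat r r" "L * L\<^sup>T = S" and Y: "Y \<in> carrier_mat p r"
  shows "quot_dist Y (U * map_mat sqrt S) \<le> frob_norm (U * L - Y)"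
proof -
  define R where "R = mat_diag r (\<lambda>i. sqrt (S $$ (i, i)))"
  define E where "E = mat_diag r (\<lambda>i. 1 / sqrt (S $$ (i, i)))"
  define Q where "Q = E * L"
  have R: "R \<in> carrier_mat r r" and E: "E \<in> carrier_mat r r" by (simp_all add: R_def E_def)
  have Q: "Q \<in> carrier_mat r r" using E L by (simp add: Q_def)
  have RE: "R * E = 1\<^sub>m r" unfolding R_def E_def mat_diag_diag mat_diag_one[symmetric]
    using pos by (intro mat_diag_cong) (auto simp: less_imp_neq[symmetric])
  have ESE: "E * S * E = 1\<^sub>m r"
  proof -
    have "E * mat_diag r (\<lambda>i. S $$ (i, i)) * E
        = mat_diag r (\<lambda>i. 1 / sqrt (S $$ (i, i)) * S $$ (i, i) * (1 / sqrt (S $$ (i, i))))"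
      unfolding E_def mat_diag_diag ..
    also have "\<dots> = mat_diag r (\<lambda>x. 1)"
    proof (rule mat_diag_cong)
      have cancel: "1 / w * (w * w) * (1 / w) = 1" if "w \<noteq> 0" for w :: real
        using that by simp
      fix i assume "i < r"
      then have "0 < S $$ (i, i)" by (rule pos)
      then have "sqrt (S $$ (i, i)) * sqrt (S $$ (i, i)) = S $$ (i, i)" "sqrt (S $$ (i, i)) \<noteq> 0" by auto
      then show "1 / sqrt (S $$ (i, i)) * S $$ (i, i) * (1 / sqrt (S $$ (i, i))) = 1"
        using cancel by metis
    qed
    finally show ?thesis unfolding diagonal_eq_mat_diag[OF S, symmetric] by simp
  qed
  have "Q * Q\<^sup>T = E * L * (L\<^sup>T * E)" unfolding Q_def using transpose_mult[OF E L(1)] by (simp add: E_def)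
  also have "\<dots> = E * (L * L\<^sup>T) * E"
    using E L(1) by (simp add: assoc_mult_mat[of _ r r _ r _ r])
  also have "\<dots> = 1\<^sub>m r" unfolding L(2) by (rule ESE)
  finally have QQT: "Q * Q\<^sup>T = 1\<^sub>m r" .
  then have "Q\<^sup>T * Q = 1\<^sub>m r" using mat_mult_left_right_inverse[OF Q _ QQT] Q by simp
  then have "Q \<in> orth_group (dim_col Y)" using Q QQT Y by (simp add: orth_group_def)
  moreover have "U * map_mat sqrt S * Q = U * L"
  proof -
    have "U * map_mat sqrt S * Q = U * (R * Q)"
      unfolding map_sqrt_diagonal[OF S] R_def[symmetric] using U R Q by (intro assoc_mult_mat)
    also have "R * Q = R * E * L" unfolding Q_def using R E L by (simp add: assoc_mult_mat[of _ r r _ r _ r])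
    finally show ?thesis using L by (simp add: RE)
  qed
  ultimately show ?thesis using quot_dist_le by metis
qed

lemma gram_factor:
  assumes U: "U \<in> carrier_mat p r" "U\<^sup>T * U = 1\<^sub>m r" and S: "S \<in> carrier_mat r r" "diagonal_mat S"
    and pos: "\<And>i. i < r \<Longrightarrow> 0 < S $$ (i, i)"
  shows "(U * map_mat sqrt S)\<^sup>T * (U * map_mat sqrt S) = S"
proof -
  define R where "R = mat_diag r (\<lambda>i. sqrt (S $$ (i, i)))"
  have R: "R \<in> carrier_mat r r" by (simp add: R_def)
  have UR: "U * R \<in> carrier_mat p r" using U R by auto
  have "(U * R)\<^sup>T * (U * R) = (R * U\<^sup>T) * (U * R)"
    using transpose_mult[OF U(1) R] by (simp add: R_def)
  also have "\<dots> = R * (U\<^sup>T * (U * R))" using U R UR by (intro assoc_mult_mat[of _ r r _ p _ r]) auto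
  also have "U\<^sup>T * (U * R) = (U\<^sup>T * U) * R" using U R by (intro assoc_mult_mat[symmetric, of _ r p _ r _ r]) auto
  also have "R * (U\<^sup>T * U * R) = R * R" using U R by simp
  also have "\<dots> = mat_diag r (\<lambda>i. S $$ (i, i))"
    unfolding R_def mat_diag_diag using pos by (intro mat_diag_cong) (simp add: less_imp_le)
  also have "\<dots> = S" using diagonal_eq_mat_diag[OF S] by simp
  finally show ?thesis by (simp add: map_sqrt_diagonal[OF S] R_def)
qed

lemma sing_val_factor:
  assumes r: "0 < r" and decomp: "reduced_eigendecomp p r X U S" and Ystar: "Ystar = U * map_mat sqrt S"
  shows "0 < sing_val r Ystar" and "sing_val r Ystar \<le> sing_val 1 Ystar"
    and "\<And>i. i < r \<Longrightarrow> (sing_val r Ystar)\<^sup>2 \<le> S $$ (i, i)"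
    and "\<And>i. i < r \<Longrightarrow> S $$ (i, i) \<le> (sing_val 1 Ystar)\<^sup>2"
proof -
  have U: "U \<in> carrier_mat p r" "U\<^sup>T * U = 1\<^sub>m r" and S: "S \<in> carrier_mat r r" "diagonal_mat S"
    and pos: "\<And>i. i < r \<Longrightarrow> 0 < S $$ (i, i)"
    using decomp by (auto simp: reduced_eigendecomp_def)
  have "Ystar \<in> carrier_mat p r" using U S by (auto simp: Ystar)
  note sv = sing_val_diagonal_gram[OF this r gram_factor[OF U S pos, folded Ystar] S(2) pos]
  show s: "0 < sing_val r Ystar" by (rule sv(1))
  have s1: "0 < sing_val 1 Ystar" by (rule sv(2))
  show le: "\<And>i. i < r \<Longrightarrow> (sing_val r Ystar)\<^sup>2 \<le> S $$ (i, i)" by (rule sv(3))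
  show ge: "\<And>i. i < r \<Longrightarrow> S $$ (i, i) \<le> (sing_val 1 Ystar)\<^sup>2" by (rule sv(4))
  show "sing_val r Ystar \<le> sing_val 1 Ystar"
    by (rule power2_le_imp_le) (use order_trans[OF le[OF r] ge[OF r]] s1 in simp_all)
qed

text \<open>The growth phase starts from the lower bound \<sigma> / 4 with \<sigma> =
  \<open>sing_val r K0\<close>. For this value the 8 in the hypothesis on \<open>J0\<close> becomes
  the 2 of \<open>growth_step\<close>, and \<sigma> \<le> sqrt(a) / 2 places the start below the
  threshold sqrt(a) / 8. After \<open>n1\<close> steps the threshold is reached, and every further
  step contracts.\<close>

lemma gd_reaches_accuracy:
  assumes r: "0 < r" and decomp: "reduced_eigendecomp p r X U S" and Ystar: "Ystar = U * map_mat sqrt S"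
    and perp: "orth_compl_basis p r U Uperp" and Y0: "Y0 \<in> carrier_mat p r"
    and K0: "K0 = U\<^sup>T * Y0" and J0: "J0 = Uperp\<^sup>T * Y0"
    and init: "sing_val 1 Y0 \<le> sing_val 1 Ystar" "sing_val 1 J0 \<le> sing_val r Ystar / 2"
      "0 < sing_val r K0" "sing_val r K0 \<le> sing_val r Ystar / 2"
      "(sing_val 1 J0)\<^sup>2 \<le> (sing_val r Ystar)\<^sup>2 / (8 * sing_val 1 Ystar) * sing_val r K0"
  defines "a \<equiv> (sing_val r Ystar)\<^sup>2" and "b \<equiv> (sing_val 1 Ystar)\<^sup>2"
  defines "\<eta> \<equiv> a / (2000 * b\<^sup>2)"
  assumes n1: "sqrt a / 2 \<le> sing_val r K0 * (1 + \<eta> * a / 16) ^ n1"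
  shows "(gd_step X \<eta> ^^ (t + n1)) Y0 \<in> full_col_rank p r"
    and "quot_dist ((gd_step X \<eta> ^^ (t + n1)) Y0) Ystar \<le> gd_const a b r * gd_rate a b ^ t"
proof -
  have U_orth: "U \<in> carrier_mat p r" "U\<^sup>T * U = 1\<^sub>m r" and S_diag: "S \<in> carrier_mat r r" "diagonal_mat S"
    and pos: "\<And>i. i < r \<Longrightarrow> 0 < S $$ (i, i)" and X_decomp: "X = U * S * U\<^sup>T"
    using decomp by (auto simp: reduced_eigendecomp_def)
  note sv = sing_val_factor[OF r decomp Ystar]
  have ab: "a \<le> b" using sv(1,2) by (auto simp: a_def b_def intro: power_mono)
  have a: "0 < a" using sv(1) by (simp add: a_def)
  have sqrt_a: "sqrt a = sing_val r Ystar" and sqrt_b: "sqrt b = sing_val 1 Ystar"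
    using sv(1,2) by (simp_all add: a_def b_def)
  interpret gradient_descent p r U S a b \<eta>
    unfolding \<eta>_def using sv(3,4) a ab by (intro gradient_descent_diagonal U_orth S_diag) (auto simp: a_def b_def)
  have X_eq: "gradient_descent.X U S = X" by (simp add: X_decomp X_def)
  define c \<sigma> where "c = sing_val 1 J0" and "\<sigma> = sing_val r K0"
  have V: "Uperp \<in> carrier_mat p (p - r)" using perp by (simp add: orth_compl_basis_def)
  have J0c: "J0 \<in> carrier_mat (p - r) r" and K0c: "K0 \<in> carrier_mat r r"
    using V U Y0 by (auto simp: J0 K0)
  have oJ0: "opnorm_le J0 c" unfolding c_def by (rule opnorm_le_sing_val[OF J0c r])
  have c: "0 \<le> c"
    using order_trans[OF vec_norm_nonneg vec_norm_col_le[OF oJ0 J0c r]] .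
  have \<sigma>: "0 < \<sigma>" "\<sigma> \<le> sqrt a / 2" using init by (simp_all add: \<sigma>_def sqrt_a)
  have c_bounds: "c\<^sup>2 \<le> a / 4" "c\<^sup>2 \<le> a * (\<sigma> / 4) / (2 * sqrt b)"
  proof -
    have "c\<^sup>2 \<le> (sing_val r Ystar / 2)\<^sup>2" using init c unfolding c_def by (intro power_mono)
    then show "c\<^sup>2 \<le> a / 4" by (simp add: a_def power_divide)
    show "c\<^sup>2 \<le> a * (\<sigma> / 4) / (2 * sqrt b)"
      using init(5) by (simp add: c_def \<sigma>_def a_def sqrt_b)
  qed
  have inv0: "invariant c (\<sigma> / 4) Y0" unfolding invariant_def
  proof safe
    have "sing_val 1 Ystar \<le> \<beta>"
      unfolding \<beta>_def sqrt_b[symmetric] using b by (intro real_sqrt_le_mono) simp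
    then show "opnorm_le Y0 \<beta>"
      using opnorm_le_mono[OF opnorm_le_sing_val[OF Y0 r]] init(1) by simp
    show "opnorm_le (rest Y0) c"
    proof (rule opnorm_leI[of _ p r])
      fix v :: "real vec" assume v: "v \<in> carrier_vec r"
      have R: "rest Y0 \<in> carrier_mat p r" and K: "core Y0 \<in> carrier_mat r r" using Y0 by auto
      have "x = (x - y) + y" if "x \<in> carrier_vec p" "y \<in> carrier_vec p" for x y :: "real vec"
        using that by (intro eq_vecI) auto
      then have "Y0 *\<^sub>v v = rest Y0 *\<^sub>v v + U *\<^sub>v (core Y0 *\<^sub>v v)"
        unfolding rest_vec[OF Y0 v] using Y0 U by simp
      then have "vec_norm (rest Y0 *\<^sub>v v) = vec_norm (Uperp\<^sup>T *\<^sub>v (Y0 *\<^sub>v v))"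
        using UT_rest[OF Y0 v] R K by (intro rest_norm_le[OF perp U UTU]) auto
      also have "Uperp\<^sup>T *\<^sub>v (Y0 *\<^sub>v v) = J0 *\<^sub>v v"
        unfolding J0 using V Y0 v by (intro assoc_mult_mat_vec[symmetric, of _ "p - r" p]) auto
      also have "vec_norm (J0 *\<^sub>v v) \<le> c * vec_norm v" by (rule opnorm_leD[OF oJ0 J0c v])
      finally show "vec_norm (rest Y0 *\<^sub>v v) \<le> c * vec_norm v" .
    qed (use Y0 in simp)
    fix x :: "real vec" assume x: "x \<in> carrier_vec r"
    have "\<sigma> * vec_norm x \<le> vec_norm (K0\<^sup>T *\<^sub>v x)"
      using sing_val_last_le[OF K0c r] \<sigma>(1) x unfolding \<sigma>_def
      by (intro bounded_below_transpose[OF K0c]) auto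
    moreover have "\<sigma> / 4 * vec_norm x \<le> \<sigma> * vec_norm x" using \<sigma> by (intro mult_right_mono) auto
    ultimately show "\<sigma> / 4 * vec_norm x \<le> vec_norm ((core Y0)\<^sup>T *\<^sub>v x)" by (simp add: core_def K0)
  qed (rule Y0)
  define Z where "Z = (gd_step X \<eta> ^^ n1) Y0"
  have m: "0 < \<sigma> / 4" "\<sigma> / 4 \<le> sqrt a / 8" using \<sigma> by simp_all
  have "sqrt a / 8 \<le> \<sigma> / 4 * (1 + \<eta> * a / 16) ^ n1" using n1 by (simp add: \<sigma>_def)
  then have inv1: "invariant c (sqrt a / 8) Z"
    using invariant_growth[OF inv0 c c_bounds m, of n1] by (simp add: Z_def X_eq min_absorb1)
  have c2: "c\<^sup>2 \<le> a * (sqrt a / 8) / (2 * sqrt b)"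
  proof -
    have "a * (\<sigma> / 4) / (2 * sqrt b) \<le> a * (sqrt a / 8) / (2 * sqrt b)"
      using m a b by (intro divide_right_mono mult_left_mono) auto
    then show ?thesis using c_bounds by linarith
  qed
  obtain L where L: "L \<in> carrier_mat r r" "L * L\<^sup>T = S"
    and conv: "\<And>t. frob_norm (U * L - (gd_step X \<eta> ^^ t) Z) \<le> gd_const a b r * gd_rate a b ^ t"
    using gd_converges[OF inv1 c c_bounds(1) c2] unfolding X_eq by blast
  have Zt: "(gd_step X \<eta> ^^ (t + n1)) Y0 = (gd_step X \<eta> ^^ t) Z" by (simp add: Z_def funpow_add)
  define Y where "Y = (gd_step X \<eta> ^^ t) Z"
  have inv2: "invariant c (sqrt a / 8) Y"
    using invariant_floor[OF inv1 c c_bounds(1) c2, of t] by (simp add: Y_def X_eq)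
  then have Y: "Y \<in> carrier_mat p r" by (simp add: invariant_def)
  show "quot_dist ((gd_step X \<eta> ^^ (t + n1)) Y0) Ystar \<le> gd_const a b r * gd_rate a b ^ t"
    unfolding Zt Ystar using quot_dist_le_factor[OF U S_diag pos L Y] conv[of t] by (simp add: Y_def)
  have "Y \<in> full_col_rank p r"
  proof (rule full_col_rankI[OF Y])
    fix v :: "real vec" assume v: "v \<in> carrier_vec r" "Y *\<^sub>v v = 0\<^sub>v p"
    \<comment> \<open>Full column rank persists because K, and with it the iterate, stays bounded
      below.\<close>
    have "sqrt a / 8 * vec_norm v \<le> vec_norm (core Y *\<^sub>v v)"
      using bounded_below_transpose[of "(core Y)\<^sup>T" r "sqrt a / 8" v] Y inv2 v a
      by (simp add: invariant_def)
    also have "\<dots> \<le> vec_norm (Y *\<^sub>v v)" by (rule core_le[OF Y v(1)])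
    also have "\<dots> = 0" unfolding v(2) by (simp add: vec_norm_zero_iff[of _ p])
    finally have "vec_norm v \<le> 0" using a by (simp add: mult_le_0_iff)
    then show "v = 0\<^sub>v r" using vec_norm_zero_iff[OF v(1)] by (simp add: order_antisym)
  qed
  then show "(gd_step X \<eta> ^^ (t + n1)) Y0 \<in> full_col_rank p r" by (simp add: Zt Y_def)
qed

theorem theorem6:
  fixes chat cmax :: real
  assumes "4 \<le> chat" and "0 < cmax" and "sqrt cmax \<le> 1 / (56 * chat\<^sup>2)"
  shows "\<exists>C :: real \<Rightarrow> real \<Rightarrow> nat \<Rightarrow> real \<Rightarrow> real.
    \<forall>(p::nat) (r::nat) X U S Uperp Ystar Y0 K0 J0 (\<epsilon>::real) (\<zeta>::real).
      0 < r \<and> r \<le> p \<and>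
      X \<in> carrier_mat p p \<and> psd_mat X \<and> vec_space.rank p X = r \<and>
      reduced_eigendecomp p r X U S \<and> Ystar = U * map_mat sqrt S \<and>
      orth_compl_basis p r U Uperp \<and>
      Y0 \<in> full_col_rank p r \<and>
      K0 = transpose_mat U * Y0 \<and> J0 = transpose_mat Uperp * Y0 \<and>
      sing_val 1 Y0 \<le> sing_val 1 Ystar \<and>
      sing_val 1 J0 \<le> sing_val r Ystar / 2 \<and>
      0 < sing_val r K0 \<and> sing_val r K0 \<le> sing_val r Ystar / 2 \<and>
      (sing_val 1 J0)\<^sup>2 \<le> (sing_val r Ystar)\<^sup>2 / (8 * sing_val 1 Ystar) * sing_val r K0 \<and>
      0 < \<epsilon> \<and> 0 < \<zeta> \<and> \<zeta> < 1
      \<longrightarrow>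
      (\<exists>(T0::nat) (T1::nat) (\<eta>::real) (L::real) (\<rho>::real) (K::real) (inj_rad::real) (acc::real).
        0 < T0 \<and> 0 < T1 \<and> 0 < \<eta> \<and> 0 < L \<and> 0 < \<rho> \<and> 0 < K \<and> 0 < inj_rad \<and> 0 < acc \<and>
        algorithm_prob
          \<lparr>par_chat = chat, par_cmax = cmax, par_L = L, par_rho = \<rho>, par_K = K,
           par_inj = inj_rad, par_acc = acc, par_fail = \<zeta>\<rparr>
          X T0 T1 \<eta> Y0
          (\<lambda>Y calls. Y \<in> full_col_rank p r \<and> quot_dist Y Ystar \<le> \<epsilon> \<and>
             real calls \<le> C (sing_val r Ystar) (sing_val 1 Ystar) r \<zeta> *
               (max 1 (ln (1 / sing_val r K0)) + max 1 ((ln (real p)) ^ 4) + max 1 (ln (1 / \<epsilon>))))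
        \<ge> ennreal (1 - \<zeta>))"
proof -
  \<comment> \<open>The guard makes this hold for all triples, so a choice function of
    \<open>s\<close>, \<open>s'\<close> and \<open>r\<close> exists before \<open>p\<close> and the
    matrices are introduced.\<close>
  have "\<exists>C. 0 < s \<and> s \<le> s' \<and> 0 < r \<longrightarrow> 0 \<le> C \<and> (\<forall>\<sigma> \<epsilon>. 0 < \<sigma> \<and> 0 < \<epsilon> \<longrightarrow> (\<exists>n1 n2.
      sqrt (s\<^sup>2) / 2 \<le> \<sigma> * (1 + s\<^sup>2 / (2000 * (s'\<^sup>2)\<^sup>2) * s\<^sup>2 / 16) ^ n1 \<and>
      gd_const (s\<^sup>2) (s'\<^sup>2) r * gd_rate (s\<^sup>2) (s'\<^sup>2) ^ n2 \<le> \<epsilon> \<and>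
      real (n1 + n2 + 5) \<le> C * (max 1 (ln (1 / \<sigma>)) + max 1 (ln (1 / \<epsilon>)))))"
    for s s' :: real and r :: nat
  proof (cases "0 < s \<and> s \<le> s' \<and> 0 < r")
    case True
    then have "0 < s\<^sup>2" "s\<^sup>2 \<le> s'\<^sup>2" "0 < r" by (auto intro: power_mono)
    from gd_iteration_count[OF this] show ?thesis by metis
  qed blast
  then obtain C where C: "\<And>s s' r. 0 < s \<Longrightarrow> s \<le> s' \<Longrightarrow> 0 < r \<Longrightarrow> 0 \<le> C s s' r"
    and count: "\<And>s s' r \<sigma> \<epsilon>. 0 < s \<Longrightarrow> s \<le> s' \<Longrightarrow> 0 < r \<Longrightarrow> 0 < \<sigma> \<Longrightarrow> 0 < \<epsilon> \<Longrightarrow> \<exists>n1 n2.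
      sqrt (s\<^sup>2) / 2 \<le> \<sigma> * (1 + s\<^sup>2 / (2000 * (s'\<^sup>2)\<^sup>2) * s\<^sup>2 / 16) ^ n1 \<and>
      gd_const (s\<^sup>2) (s'\<^sup>2) r * gd_rate (s\<^sup>2) (s'\<^sup>2) ^ n2 \<le> \<epsilon> \<and>
      real (n1 + n2 + 5) \<le> C s s' r * (max 1 (ln (1 / \<sigma>)) + max 1 (ln (1 / \<epsilon>)))"
    by metis
  show ?thesis
  proof (intro exI[of _ "\<lambda>s s' r \<zeta>. C s s' r"] allI impI, elim conjE)
    fix p r X U S Uperp Ystar Y0 K0 J0 and \<epsilon> \<zeta> :: real
    assume r: "0 < r" "r \<le> p" and decomp: "reduced_eigendecomp p r X U S"
      and Ystar: "Ystar = U * map_mat sqrt S" and perp: "orth_compl_basis p r U Uperp"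
      and Y0: "Y0 \<in> full_col_rank p r" and K0: "K0 = U\<^sup>T * Y0" and J0: "J0 = Uperp\<^sup>T * Y0"
      and init: "sing_val 1 Y0 \<le> sing_val 1 Ystar" "sing_val 1 J0 \<le> sing_val r Ystar / 2"
        "0 < sing_val r K0" "sing_val r K0 \<le> sing_val r Ystar / 2"
        "(sing_val 1 J0)\<^sup>2 \<le> (sing_val r Ystar)\<^sup>2 / (8 * sing_val 1 Ystar) * sing_val r K0"
      and pos: "0 < \<epsilon>" "0 < \<zeta>" "\<zeta> < 1"
    define s s' where "s = sing_val r Ystar" and "s' = sing_val 1 Ystar"
    define \<eta> where "\<eta> = s\<^sup>2 / (2000 * (s'\<^sup>2)\<^sup>2)"
    have Y0c: "Y0 \<in> carrier_mat p r" using Y0 by (simp add: full_col_rank_def)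
    note reach = gd_reaches_accuracy[OF r(1) decomp Ystar perp Y0c K0 J0 init, folded s_def s'_def, folded \<eta>_def]
    have s: "0 < s" "s \<le> s'"
      using sing_val_factor(1,2)[OF r(1) decomp Ystar] by (simp_all add: s_def s'_def)
    obtain n1 n2 where n1: "sqrt (s\<^sup>2) / 2 \<le> sing_val r K0 * (1 + \<eta> * s\<^sup>2 / 16) ^ n1"
      and n2: "gd_const (s\<^sup>2) (s'\<^sup>2) r * gd_rate (s\<^sup>2) (s'\<^sup>2) ^ n2 \<le> \<epsilon>"
      and calls: "real (n1 + n2 + 5) \<le> C s s' r * (max 1 (ln (1 / sing_val r K0)) + max 1 (ln (1 / \<epsilon>)))"
      using count[OF s r(1) init(3) pos(1)] unfolding \<eta>_def by blast
    \<comment> \<open>The extra step keeps \<open>T0\<close> positive even if both counts are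
      0.\<close>
    define T0 where "T0 = n2 + 1 + n1"
    define Z where "Z = (gd_step X \<eta> ^^ T0) Y0"
    have Z: "Z \<in> carrier_mat p r"
      using reach(1)[OF n1, of "n2 + 1"] by (simp add: Z_def T0_def full_col_rank_def)
    have chat: "0 < chat" using assms(1) by simp
    obtain L \<rho> acc where P: "0 < L" "0 < \<rho>" "0 < acc"
      and prob: "\<And>T1 Q. Q ((gd_step X \<eta> ^^ T1) Z) (T0 + 3 + T1) \<Longrightarrow>
        1 \<le> algorithm_prob \<lparr>par_chat = chat, par_cmax = cmax, par_L = L, par_rho = \<rho>, par_K = 1,
           par_inj = 1, par_acc = acc, par_fail = \<zeta>\<rparr> X T0 T1 \<eta> Y0 Q"
      using algorithm_prob_ge_1[OF Z_def[symmetric] Z r chat assms(2) pos(2), where K = 1 and inj_rad = 1]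
      by blast
    let ?B = "C s s' r * (max 1 (ln (1 / sing_val r K0)) + max 1 ((ln (real p)) ^ 4) + max 1 (ln (1 / \<epsilon>)))"
    \<comment> \<open>The final phase is a single step, enough for \<open>T1\<close> to be positive:
      the accuracy is already reached before the subroutine and is kept.\<close>
    define Y where "Y = (gd_step X \<eta> ^^ 1) Z"
    have Y: "Y = (gd_step X \<eta> ^^ (n2 + 2 + n1)) Y0" by (simp add: Y_def Z_def T0_def)
    have "quot_dist Y Ystar \<le> gd_const (s\<^sup>2) (s'\<^sup>2) r * gd_rate (s\<^sup>2) (s'\<^sup>2) ^ (n2 + 2)"
      unfolding Y by (rule reach(2)[OF n1])
    also have "\<dots> \<le> gd_const (s\<^sup>2) (s'\<^sup>2) r * gd_rate (s\<^sup>2) (s'\<^sup>2) ^ n2"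
    proof -
      have a: "0 < s\<^sup>2" "s\<^sup>2 \<le> s'\<^sup>2" using s by (auto intro: power_mono)
      show ?thesis using gd_rate_bounds[OF a] gd_const_pos[OF a r(1)]
        by (intro mult_left_mono power_decreasing) auto
    qed
    also note n2
    finally have dist: "quot_dist Y Ystar \<le> \<epsilon>" .
    have rank: "Y \<in> full_col_rank p r" unfolding Y by (rule reach(1)[OF n1])
    have "C s s' r * (max 1 (ln (1 / sing_val r K0)) + max 1 (ln (1 / \<epsilon>))) \<le> ?B"
      using C[OF s r(1)] by (intro mult_left_mono) auto
    \<comment> \<open>\<open>T0 + 3 + T1\<close> with \<open>T1 = 1\<close> equals
      \<open>n1 + n2 + 5\<close>.\<close>
    then have "real (T0 + 3 + 1) \<le> ?B" using calls by (simp add: T0_def)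
    then have "1 \<le> algorithm_prob \<lparr>par_chat = chat, par_cmax = cmax, par_L = L, par_rho = \<rho>, par_K = 1,
           par_inj = 1, par_acc = acc, par_fail = \<zeta>\<rparr> X T0 1 \<eta> Y0
         (\<lambda>Y calls. Y \<in> full_col_rank p r \<and> quot_dist Y Ystar \<le> \<epsilon> \<and> real calls \<le> ?B)"
      using dist rank by (intro prob) (simp add: Y_def)
    moreover have "ennreal (1 - \<zeta>) \<le> 1" using pos by (simp add: ennreal_le_1)
    ultimately have prob_ge: "ennreal (1 - \<zeta>) \<le> algorithm_prob \<lparr>par_chat = chat, par_cmax = cmax, par_L = L, par_rho = \<rho>, par_K = 1,
           par_inj = 1, par_acc = acc, par_fail = \<zeta>\<rparr> X T0 1 \<eta> Y0
         (\<lambda>Y calls. Y \<in> full_col_rank p r \<and> quot_dist Y Ystar \<le> \<epsilon> \<and> real calls \<le> ?B)"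
      by (rule order_trans[rotated])
    have "0 < \<eta>" "0 < T0" using s by (simp_all add: \<eta>_def T0_def)
    then have conj: "0 < T0 \<and> 0 < (1::nat) \<and> 0 < \<eta> \<and> 0 < L \<and> 0 < \<rho> \<and> 0 < (1::real) \<and> 0 < (1::real) \<and>
        0 < acc \<and> ennreal (1 - \<zeta>) \<le> algorithm_prob \<lparr>par_chat = chat, par_cmax = cmax, par_L = L, par_rho = \<rho>,
           par_K = 1, par_inj = 1, par_acc = acc, par_fail = \<zeta>\<rparr> X T0 1 \<eta> Y0
         (\<lambda>Y calls. Y \<in> full_col_rank p r \<and> quot_dist Y Ystar \<le> \<epsilon> \<and> real calls \<le> ?B)"
      by (intro conjI P prob_ge) simp_all
    show "\<exists>(T0::nat) (T1::nat) (\<eta>::real) (L::real) (\<rho>::real) (K::real) (inj_rad::real) (acc::real).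
        0 < T0 \<and> 0 < T1 \<and> 0 < \<eta> \<and> 0 < L \<and> 0 < \<rho> \<and> 0 < K \<and> 0 < inj_rad \<and> 0 < acc \<and>
        algorithm_prob
          \<lparr>par_chat = chat, par_cmax = cmax, par_L = L, par_rho = \<rho>, par_K = K,
           par_inj = inj_rad, par_acc = acc, par_fail = \<zeta>\<rparr>
          X T0 T1 \<eta> Y0
          (\<lambda>Y calls. Y \<in> full_col_rank p r \<and> quot_dist Y Ystar \<le> \<epsilon> \<and>
             real calls \<le> C (sing_val r Ystar) (sing_val 1 Ystar) r *
               (max 1 (ln (1 / sing_val r K0)) + max 1 ((ln (real p)) ^ 4) + max 1 (ln (1 / \<epsilon>))))
        \<ge> ennreal (1 - \<zeta>)"
      by (rule exI[of _ T0], rule exI[of _ "1::nat"], rule exI[of _ \<eta>], rule exI[of _ L],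
          rule exI[of _ \<rho>], rule exI[of _ "1::real"], rule exI[of _ "1::real"], rule exI[of _ acc])
        (rule conj[unfolded s_def s'_def])
  qed
qed

end
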